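(* Let $K$ be a local field with residue characteristic $p$, with $\mu_p(K)\neq\{1\}$ and with residue field of cardinality $p^{f_K}$; let $\rho_K=\rho_{e,p}$ with $e=v_K(p)$. Then there is a unique $(I_K,\beta_K)\in\mathrm{Jump}_{\rho_K}^*$ such that $$U_\bullet(K)\simeq M_{\rho_K}^{f_K-1}\oplus\big(M_{\rho_K}^*/\mathbb{Z}_p v_{(I_K,\beta_K)}\big)$$ as filtered $\mathbb{Z}_p$-modules.
   Context: A local field $K$ is a field with a non-archimedean absolute value for which it is a non-discrete locally compact space; $v_K$ is its normalized valuation, $O$ its ring of integers, $m$ its maximal ideal, $p$ its residue characteristic. $\mu_p(K)=\{\alpha\in K:\alpha^p=1\}$. $U_i(K)=1+m^i$; $U_1(K)$ is a (multiplicatively written) $\mathbb{Z}_p$-module and $U_\bullet(K)$ is $U_1(K)$ with the filtration $(U_i(K))_{i\ge1}$. A filtered $\mathbb{Z}_p$-module $M_\bullet$ is a sequence of $\mathbb{Z}_p$-modules $M_1\supseteq M_2\supseteq\cdots$ with $\bigcap_i M_i=\{0\}$; its weight map $w(x)=\sup\{i: x\in M_i\}$ determines the filtration. A morphism $M_\bullet\to N_\bullet$ is a $\mathbb{Z}_p$-linear map $\phi:M_1\to N_1$ with $\phi(M_i)\subseteq N_i$ for all $i$; isomorphisms are morphisms with an inverse morphism. Products and direct sums carry the termwise filtration; a quotient $M_1/N$ by a closed submodule $N$ carries the filtration $((M_i+N)/N)_{i\ge1}$. A shift is a strictly increasing function $\rho:\mathbb{Z}_{\ge1}\to\mathbb{Z}_{\ge1}$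 with $\rho(1)>1$; $T_\rho=\mathbb{Z}_{\ge1}\setminus\rho(\mathbb{Z}_{\ge1})$. If $T_\rho$ is finite, $e^*=\max(T_\rho)+1$ and $T_\rho^*=T_\rho\cup\{e^*\}$. $\rho_{e,p}(i)=\min\{i+e,pi\}$. For $i\ge1$, $S_i$ is $\mathbb{Z}_p$ with weight map $w(x)=\rho^{\mathrm{ord}_p(x)}(i)$ (iterate of $\rho$; $w(0)=\infty$). $M_\rho=\prod_{i\in T_\rho}S_i$, $M_\rho^*=\prod_{i\in T_\rho^*}S_i$; $M_\rho^{f-1}$ is the direct sum of $f-1$ copies of $M_\rho$. $\mathrm{Jump}_\rho^*$ (extended $\rho$-jump sets) is the set of pairs $(I,\beta)$ with $I\subseteq T_\rho^*$ finite (possibly empty) and $\beta:I\to\mathbb{Z}_{\ge1}$ strictly decreasing such that $i\mapsto\rho^{\beta(i)}(i)$ is strictly increasing on $I$. For such $(I,\beta)$, $v_{(I,\beta)}=(x_j)_{j\in T_\rho^*}\in M_\rho^*$ has $x_j=0$ if $j\notin I$ and $x_j=p^{\beta(j)}$ if $j\in I$. *)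

theory Defs
  imports "HOL-Analysis.Analysis" "HOL-Algebra.Algebra"
begin

hide_const (open) Wellorder_Constructions.zero

section \<open>Local fields\<close>

locale nonarchimedean_abs =
  fixes absv :: "'a::field \<Rightarrow> real"
  assumes absv_nonneg: "0 \<le> absv x"
    and absv_eq_0_iff: "absv x = 0 \<longleftrightarrow> x = 0"
    and absv_mult: "absv (x * y) = absv x * absv y"
    and absv_ultrametric: "absv (x + y) \<le> max (absv x) (absv y)"

definition absv_topology :: "('a::field \<Rightarrow> real) \<Rightarrow> 'a topology" where
  "absv_topology absv = Metric_space.mtopology UNIV (\<lambda>x y. absv (x - y))"

locale local_field = nonarchimedean_abs +
  assumes locally_compact: "locally_compact_space (absv_topology absv)"
    and non_discrete: "absv_topology absv \<noteq> discrete_topology UNIV"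

definition integer_ring :: "('a::field \<Rightarrow> real) \<Rightarrow> 'a ring" where
  "integer_ring absv =
     \<lparr>carrier = {x. absv x \<le> 1}, mult = (*), one = 1, zero = 0, add = (+)\<rparr>"

definition max_ideal :: "('a::field \<Rightarrow> real) \<Rightarrow> 'a set" where
  "max_ideal absv = {x. absv x < 1}"

definition residue_field :: "('a::field \<Rightarrow> real) \<Rightarrow> 'a set ring" where
  "residue_field absv = integer_ring absv Quot max_ideal absv"

definition residue_characteristic :: "('a::field \<Rightarrow> real) \<Rightarrow> nat" where
  "residue_characteristic absv =
     (LEAST n. 0 < n \<and>
        [n] \<cdot>\<^bsub>residue_field absv\<^esub> \<one>\<^bsub>residue_field absv\<^esub> = \<zero>\<^bsub>residue_field absv\<^esub>)"

definition uniformizer :: "('a::field \<Rightarrow> real) \<Rightarrow> 'a \<Rightarrow> bool" where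
  "uniformizer absv \<pi> \<longleftrightarrow>
     \<pi> \<in> carrier (integer_ring absv) \<and> max_ideal absv = PIdl\<^bsub>integer_ring absv\<^esub> \<pi>"

text \<open>The normalized valuation on the nonzero elements; the value at \<open>0\<close> (mathematically
  \<open>\<infinity>\<close>) is left unspecified.\<close>

definition normalized_valuation :: "('a::field \<Rightarrow> real) \<Rightarrow> 'a \<Rightarrow> int" where
  "normalized_valuation absv x =
     (THE n. \<exists>\<pi>. uniformizer absv \<pi> \<and> absv x = absv \<pi> powi n)"

definition higher_units :: "('a::field \<Rightarrow> real) \<Rightarrow> nat \<Rightarrow> 'a set" where
  "higher_units absv i =
     {1 + x | x. x \<in> max_ideal absv [^]\<^bsub>ideals_set (integer_ring absv)\<^esub> i}"


section \<open>The ring of p-adic integers\<close>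

text \<open>The inverse limit of the rings \<open>\<int>/p\<^sup>n\<int>\<close>: an element is its sequence of residues,
  the \<open>n\<close>-th one represented in \<open>{0..<p\<^sup>n}\<close>.\<close>

definition Zp :: "nat \<Rightarrow> (nat \<Rightarrow> int) ring" where
  "Zp p =
     \<lparr>carrier = {a. \<forall>n. a n \<in> {0..<int p ^ n} \<and> a (Suc n) mod int p ^ n = a n},
      mult = (\<lambda>a b n. (a n * b n) mod int p ^ n),
      one = (\<lambda>n. 1 mod int p ^ n),
      zero = (\<lambda>n. 0),
      add = (\<lambda>a b n. (a n + b n) mod int p ^ n)\<rparr>"

definition Zp_of_int :: "nat \<Rightarrow> int \<Rightarrow> (nat \<Rightarrow> int)" where
  "Zp_of_int p k = (\<lambda>n. k mod int p ^ n)"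

text \<open>Only meaningful for nonzero arguments.\<close>

definition Zp_ord :: "nat \<Rightarrow> (nat \<Rightarrow> int) \<Rightarrow> nat" where
  "Zp_ord p a = (GREATEST n. Zp_of_int p (int p ^ n) divides\<^bsub>Zp p\<^esub> a)"


section \<open>Filtered modules\<close>

text \<open>The carrier is the first step of the filtration. The value \<open>filt M 0\<close> carries no
  information and is never used.\<close>

record ('a, 'b) filtered_module = "('a, 'b) module" +
  filt :: "nat \<Rightarrow> 'b set"

locale filtered_module = module R M
  for R :: "('a, 'r) ring_scheme" and M :: "('a, 'b, 'm) filtered_module_scheme" (structure) +
  assumes filt_1: "filt M 1 = carrier M"
    and filt_submodule: "1 \<le> i \<Longrightarrow> submodule (filt M i) R M"
    and filt_Suc: "1 \<le> i \<Longrightarrow> filt M (Suc i) \<subseteq> filt M i"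
    and filt_separated: "(\<Inter>i\<in>{1..}. filt M i) = {\<zero>\<^bsub>M\<^esub>}"

definition fm_hom ::
  "('a, 'r) ring_scheme \<Rightarrow> ('a, 'b, 'm) filtered_module_scheme \<Rightarrow>
   ('a, 'c, 'n) filtered_module_scheme \<Rightarrow> ('b \<Rightarrow> 'c) set" where
  "fm_hom R M N =
     {\<phi>. \<phi> \<in> carrier M \<rightarrow> carrier N \<and>
         (\<forall>x\<in>carrier M. \<forall>y\<in>carrier M. \<phi> (x \<oplus>\<^bsub>M\<^esub> y) = \<phi> x \<oplus>\<^bsub>N\<^esub> \<phi> y) \<and>
         (\<forall>a\<in>carrier R. \<forall>x\<in>carrier M. \<phi> (a \<odot>\<^bsub>M\<^esub> x) = a \<odot>\<^bsub>N\<^esub> \<phi> x) \<and>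
         (\<forall>i\<ge>1. \<phi> ` filt M i \<subseteq> filt N i)}"

definition fm_iso ::
  "('a, 'r) ring_scheme \<Rightarrow> ('a, 'b, 'm) filtered_module_scheme \<Rightarrow>
   ('a, 'c, 'n) filtered_module_scheme \<Rightarrow> bool" where
  "fm_iso R M N \<longleftrightarrow>
     filtered_module R M \<and> filtered_module R N \<and>
     (\<exists>\<phi>\<in>fm_hom R M N. \<exists>\<psi>\<in>fm_hom R N M.
        (\<forall>x\<in>carrier M. \<psi> (\<phi> x) = x) \<and> (\<forall>y\<in>carrier N. \<phi> (\<psi> y) = y))"

text \<open>In the following module records the ring fields \<open>mult\<close> and \<open>one\<close>, inherited from the
  record type \<^typ>\<open>('a, 'b) module\<close>, are irrelevant.\<close>

definition fm_prod ::
  "'i set \<Rightarrow> ('i \<Rightarrow> ('a, 'b) filtered_module) \<Rightarrow> ('a, 'i \<Rightarrow> 'b) filtered_module" where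
  "fm_prod I M =
     \<lparr>carrier = (\<Pi>\<^sub>E i\<in>I. carrier (M i)),
      mult = undefined, one = undefined,
      zero = (\<lambda>i\<in>I. \<zero>\<^bsub>M i\<^esub>),
      add = (\<lambda>x y. \<lambda>i\<in>I. x i \<oplus>\<^bsub>M i\<^esub> y i),
      smult = (\<lambda>a x. \<lambda>i\<in>I. a \<odot>\<^bsub>M i\<^esub> x i),
      filt = (\<lambda>j. \<Pi>\<^sub>E i\<in>I. filt (M i) j)\<rparr>"

definition fm_sum ::
  "('a, 'b) filtered_module \<Rightarrow> ('a, 'c) filtered_module \<Rightarrow> ('a, 'b \<times> 'c) filtered_module"
  (infixr \<open>\<oplus>\<^sub>f\<close> 65) where
  "M \<oplus>\<^sub>f N =
     \<lparr>carrier = carrier M \<times> carrier N,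
      mult = undefined, one = undefined,
      zero = (\<zero>\<^bsub>M\<^esub>, \<zero>\<^bsub>N\<^esub>),
      add = (\<lambda>(x, y) (x', y'). (x \<oplus>\<^bsub>M\<^esub> x', y \<oplus>\<^bsub>N\<^esub> y')),
      smult = (\<lambda>a (x, y). (a \<odot>\<^bsub>M\<^esub> x, a \<odot>\<^bsub>N\<^esub> y)),
      filt = (\<lambda>j. filt M j \<times> filt N j)\<rparr>"

text \<open>A finite direct sum is the finite product.\<close>

definition fm_power ::
  "('a, 'b) filtered_module \<Rightarrow> nat \<Rightarrow> ('a, nat \<Rightarrow> 'b) filtered_module" where
  "fm_power M n = fm_prod {..<n} (\<lambda>_. M)"

definition fm_quotient ::
  "('a, 'b) filtered_module \<Rightarrow> 'b set \<Rightarrow> ('a, 'b set) filtered_module" where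
  "fm_quotient M N =
     \<lparr>carrier = a_rcosets\<^bsub>M\<^esub> N,
      mult = undefined, one = undefined,
      zero = N,
      add = set_add M,
      smult = (\<lambda>a C. \<Union>x\<in>C. N +>\<^bsub>M\<^esub> (a \<odot>\<^bsub>M\<^esub> x)),
      filt = (\<lambda>i. (\<lambda>x. N +>\<^bsub>M\<^esub> x) ` set_add M (filt M i) N)\<rparr>"

definition cyclic_span :: "('a, 'r) ring_scheme \<Rightarrow> ('a, 'b, 'm) module_scheme \<Rightarrow> 'b \<Rightarrow> 'b set" where
  "cyclic_span R M v = {a \<odot>\<^bsub>M\<^esub> v | a. a \<in> carrier R}"


section \<open>The filtered module of principal units\<close>

text \<open>The \<open>p\<close>-adic power of \<open>u\<close> with exponent \<open>a\<close> is the limit of the powers of \<open>u\<close> whose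
  exponents are the integers \<open>a n\<close> converging to \<open>a\<close>.\<close>

definition padic_power :: "('a::field \<Rightarrow> real) \<Rightarrow> (nat \<Rightarrow> int) \<Rightarrow> 'a \<Rightarrow> 'a" where
  "padic_power absv a u =
     (THE l. limitin (absv_topology absv) (\<lambda>n. u ^ nat (a n)) l sequentially)"

definition principal_units :: "('a::field \<Rightarrow> real) \<Rightarrow> (nat \<Rightarrow> int, 'a) filtered_module" where
  "principal_units absv =
     \<lparr>carrier = higher_units absv 1,
      mult = undefined, one = undefined,
      zero = 1, add = (*), smult = padic_power absv,
      filt = higher_units absv\<rparr>"


section \<open>Shifts and jump sets\<close>

text \<open>Maps on the positive integers are represented by functions on \<^typ>\<open>nat\<close>, whose value at
  \<open>0\<close> is irrelevant.\<close>

definition shift :: "(nat \<Rightarrow> nat) \<Rightarrow> bool" where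
  "shift \<rho> \<longleftrightarrow> \<rho> ` {1..} \<subseteq> {1..} \<and> strict_mono_on {1..} \<rho> \<and> \<rho> 1 > 1"

definition shift_gaps :: "(nat \<Rightarrow> nat) \<Rightarrow> nat set" where
  "shift_gaps \<rho> = {1..} - \<rho> ` {1..}"

text \<open>The next two definitions are only meaningful if \<^term>\<open>shift_gaps \<rho>\<close> is finite.\<close>

definition e_star :: "(nat \<Rightarrow> nat) \<Rightarrow> nat" where
  "e_star \<rho> = Max (shift_gaps \<rho>) + 1"

definition shift_gaps_star :: "(nat \<Rightarrow> nat) \<Rightarrow> nat set" where
  "shift_gaps_star \<rho> = insert (e_star \<rho>) (shift_gaps \<rho>)"

definition field_shift :: "nat \<Rightarrow> nat \<Rightarrow> nat \<Rightarrow> nat" where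
  "field_shift e p i = min (i + e) (p * i)"

lemma shift_field_shift:
  assumes "e \<ge> 1" "p \<ge> 2"
  shows "shift (field_shift e p)"
proof -
  have "field_shift e p i < field_shift e p j" if "i < j" for i j
  proof -
    have "p * i < p * j" using that assms by simp
    then show ?thesis using that unfolding field_shift_def by linarith
  qed
  moreover have "field_shift e p i \<ge> 1" if "i \<ge> 1" for i
    using that assms by (simp add: field_shift_def)
  moreover have "field_shift e p 1 > 1"
    using assms by (simp add: field_shift_def)
  ultimately show ?thesis
    by (auto simp: shift_def strict_mono_on_def)
qed

definition S_weight :: "nat \<Rightarrow> (nat \<Rightarrow> nat) \<Rightarrow> nat \<Rightarrow> (nat \<Rightarrow> int) \<Rightarrow> enat" where
  "S_weight p \<rho> i x =
     (if x = \<zero>\<^bsub>Zp p\<^esub> then \<infinity> else enat ((\<rho> ^^ Zp_ord p x) i))"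

definition S_mod :: "nat \<Rightarrow> (nat \<Rightarrow> nat) \<Rightarrow> nat \<Rightarrow> (nat \<Rightarrow> int, nat \<Rightarrow> int) filtered_module" where
  "S_mod p \<rho> i =
     \<lparr>carrier = carrier (Zp p),
      mult = undefined, one = undefined,
      zero = \<zero>\<^bsub>Zp p\<^esub>, add = (\<oplus>\<^bsub>Zp p\<^esub>), smult = (\<otimes>\<^bsub>Zp p\<^esub>),
      filt = (\<lambda>j. {x \<in> carrier (Zp p). enat j \<le> S_weight p \<rho> i x})\<rparr>"

definition M_mod ::
  "nat \<Rightarrow> (nat \<Rightarrow> nat) \<Rightarrow> (nat \<Rightarrow> int, nat \<Rightarrow> nat \<Rightarrow> int) filtered_module" where
  "M_mod p \<rho> = fm_prod (shift_gaps \<rho>) (S_mod p \<rho>)"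

definition M_star_mod ::
  "nat \<Rightarrow> (nat \<Rightarrow> nat) \<Rightarrow> (nat \<Rightarrow> int, nat \<Rightarrow> nat \<Rightarrow> int) filtered_module" where
  "M_star_mod p \<rho> = fm_prod (shift_gaps_star \<rho>) (S_mod p \<rho>)"

text \<open>The function \<open>\<beta>\<close> is taken extensional, i.e. \<open>undefined\<close> outside \<open>I\<close>, so that pairs
  \<open>(I, \<beta>)\<close> are equal iff the sets and the functions on them agree.\<close>

definition ext_jump_sets :: "(nat \<Rightarrow> nat) \<Rightarrow> (nat set \<times> (nat \<Rightarrow> nat)) set" where
  "ext_jump_sets \<rho> =
     {(I, \<beta>). I \<subseteq> shift_gaps_star \<rho> \<and> finite I \<and> \<beta> \<in> I \<rightarrow>\<^sub>E {1..} \<and>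
        strict_antimono_on I \<beta> \<and> strict_mono_on I (\<lambda>i. (\<rho> ^^ \<beta> i) i)}"

definition jump_vector ::
  "nat \<Rightarrow> (nat \<Rightarrow> nat) \<Rightarrow> nat set \<times> (nat \<Rightarrow> nat) \<Rightarrow> (nat \<Rightarrow> nat \<Rightarrow> int)" where
  "jump_vector p \<rho> = (\<lambda>(I, \<beta>).
     (\<lambda>j\<in>shift_gaps_star \<rho>. if j \<in> I then Zp_of_int p (int p ^ \<beta> j) else \<zero>\<^bsub>Zp p\<^esub>))"

end

theory Submission
  imports Defs "HOL-Number_Theory.Cong"
begin

text \<open>
  Write \<open>U i\<close> for \<open>U\<^sub>i(K)\<close> and \<open>i0\<close> for the valuation of \<open>\<zeta> - 1\<close>, where \<open>\<zeta>\<close> is a nontrivial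
  \<open>p\<close>-th root of unity. The \<open>p\<close>-power map induces isomorphisms \<open>U i / U (i + 1) \<rightarrow> U (\<rho> i) / U (\<rho> i + 1)\<close>
  except at \<open>i = i0\<close>, where its kernel is generated by \<open>\<zeta>\<close> and its cokernel has order \<open>p\<close>; moreover
  \<open>\<rho> i0 = e*\<close>. Lifting bases of the graded pieces at the gaps of \<open>\<rho>\<close>, together with one element at
  \<open>e*\<close>, hence gives a strict surjection of filtered modules onto \<open>U\<close> whose kernel is generated by
  \<open>p z\<close>, where \<open>z\<close> is any expression of \<open>\<zeta>\<close> in the basis. Collecting at every level the part of
  \<open>\<zeta>\<close> supported there, \<open>\<zeta> = \<Prod>i. y i ^ p ^ b i\<close>. A factor \<open>j\<close> with \<open>b i \<le> b j\<close> and
  \<open>\<rho>\<^bsup>b i\<^esup> i \<le> \<rho>\<^bsup>b j\<^esup> j\<close> can be absorbed into \<open>y i\<close>, and the minimal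
  factors that remain form a jump set with \<open>\<beta> i = b i + 1\<close>.

  For uniqueness, \<open>(I, \<beta>)\<close> is read off from the invariant that records, for an element \<open>x\<close> of
  order \<open>p\<close>, the pairs \<open>(k, j)\<close> such that \<open>x\<close> lies in \<open>M\<^sub>j + p\<^sup>k M\<close>: it is the condition
  \<open>j \<le> \<rho>\<^bsup>\<beta> i - 1\<^esup> i\<close> for all \<open>i\<close> in \<open>I\<close> with \<open>\<beta> i \<le> k\<close>.
\<close>

section \<open>The p-adic integers\<close>

text \<open>In \<open>(1 + y) ^ p\<close> two terms compete: \<open>p * y\<close> times a unit, of
  valuation v(y) + e, and \<open>y ^ p\<close>, of valuation p v(y). Unless (p - 1) v(y) = e, one of
  them dominates; the p-power map is then injective between graded pieces, hence bijective, since
  each piece has p^f elements. For y = \<zeta> - 1 the two terms must cancel, so the tie occurs at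
  an integer level. There the class of \<zeta> is lost, and by counting exactly one dimension of the
  target is missed. The obstacle is that the relation makes the exponents of a product ambiguous. Up
  to level e* their weights can still be read off the product; beyond it only after one coordinate
  has been normalized to zero, which fixes the multiple of the relation. Single levels are treated
  with natural exponents, where exponent p - 1 serves as -1 modulo the next level; p-adic exponents
  enter only as limits.\<close>

lemma Zp_carrier_iff:
  "a \<in> carrier (Zp p) \<longleftrightarrow> (\<forall>n. 0 \<le> a n \<and> a n < int p ^ n \<and> a (Suc n) mod int p ^ n = a n)"
  by (auto simp: Zp_def)

lemma Zp_zero: "\<zero>\<^bsub>Zp p\<^esub> = (\<lambda>n. 0)"
  and Zp_one: "\<one>\<^bsub>Zp p\<^esub> = (\<lambda>n. 1 mod int p ^ n)"
  and Zp_add: "a \<oplus>\<^bsub>Zp p\<^esub> b = (\<lambda>n. (a n + b n) mod int p ^ n)"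
  and Zp_mult: "a \<otimes>\<^bsub>Zp p\<^esub> b = (\<lambda>n. (a n * b n) mod int p ^ n)"
  by (simp_all add: Zp_def)

lemmas Zp_simps = Zp_zero Zp_one Zp_add Zp_mult

lemma mod_power_mod:
  fixes x :: int
  assumes "m \<le> n"
  shows "x mod int p ^ n mod int p ^ m = x mod int p ^ m"
  using assms by (simp add: le_imp_power_dvd mod_mod_cancel)

lemma mod_power_Suc_mod: "(x :: int) mod (int p * int p ^ n) mod int p ^ n = x mod int p ^ n"
  using mod_power_mod[of n "Suc n" x p] by simp

lemma Zp_mod:
  assumes "a \<in> carrier (Zp p)" "m \<le> n"
  shows "a n mod int p ^ m = a m"
  using assms(2)
proof (induction n rule: dec_induct)
  case base
  then show ?case using assms(1) by (simp add: Zp_carrier_iff)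
next
  case (step k)
  have "a (Suc k) mod int p ^ m = a (Suc k) mod int p ^ k mod int p ^ m"
    using step by (simp add: mod_power_mod)
  also have "\<dots> = a m" using step assms(1) by (simp add: Zp_carrier_iff)
  finally show ?case .
qed

lemma Zp_carrierI:
  assumes "p > 0" "\<And>n. a n mod int p ^ n = a n" "\<And>n. a (Suc n) mod int p ^ n = a n"
  shows "a \<in> carrier (Zp p)"
proof -
  have "0 \<le> a n \<and> a n < int p ^ n" for n
    using assms(1) assms(2)[of n] by (metis of_nat_0_less_iff pos_mod_bound pos_mod_sign zero_less_power)
  then show ?thesis using assms by (simp add: Zp_carrier_iff)
qed

lemma Zp_0: "a \<in> carrier (Zp p) \<Longrightarrow> a 0 = 0"
  unfolding Zp_carrier_iff by (drule spec[of _ 0]) simp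

lemma Zp_nonneg: "a \<in> carrier (Zp p) \<Longrightarrow> 0 \<le> a n"
  by (simp add: Zp_carrier_iff)

lemma Zp_self_mod: "a \<in> carrier (Zp p) \<Longrightarrow> a n mod int p ^ n = a n"
  by (simp add: Zp_carrier_iff)

lemma Zp_of_int_closed: "p > 0 \<Longrightarrow> Zp_of_int p k \<in> carrier (Zp p)"
  by (rule Zp_carrierI) (auto simp: Zp_of_int_def mod_power_Suc_mod)

lemma Zp_zero_closed: "p > 0 \<Longrightarrow> \<zero>\<^bsub>Zp p\<^esub> \<in> carrier (Zp p)"
  by (rule Zp_carrierI) (auto simp: Zp_simps)

lemma Zp_add_closed:
  assumes "p > 0" "a \<in> carrier (Zp p)" "b \<in> carrier (Zp p)"
  shows "a \<oplus>\<^bsub>Zp p\<^esub> b \<in> carrier (Zp p)"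
proof (rule Zp_carrierI)
  fix n show "(a \<oplus>\<^bsub>Zp p\<^esub> b) (Suc n) mod int p ^ n = (a \<oplus>\<^bsub>Zp p\<^esub> b) n"
    using Zp_mod[OF assms(2), of n "Suc n"] Zp_mod[OF assms(3), of n "Suc n"] unfolding Zp_add
    by (subst mod_power_mod, simp) (simp add: mod_add_eq flip: mod_add_eq[of "a (Suc n)" _ "b (Suc n)"])
qed (auto simp: Zp_simps assms)

lemma Zp_mult_closed:
  assumes "p > 0" "a \<in> carrier (Zp p)" "b \<in> carrier (Zp p)"
  shows "a \<otimes>\<^bsub>Zp p\<^esub> b \<in> carrier (Zp p)"
proof (rule Zp_carrierI)
  fix n show "(a \<otimes>\<^bsub>Zp p\<^esub> b) (Suc n) mod int p ^ n = (a \<otimes>\<^bsub>Zp p\<^esub> b) n"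
    using Zp_mod[OF assms(2), of n "Suc n"] Zp_mod[OF assms(3), of n "Suc n"] unfolding Zp_mult
    by (subst mod_power_mod, simp) (simp add: mod_mult_eq flip: mod_mult_eq[of "a (Suc n)" _ "b (Suc n)"])
qed (auto simp: Zp_simps assms)

lemma Zp_cring:
  assumes "p > 0"
  shows "cring (Zp p)"
proof (rule cringI)
  have neg: "(\<lambda>n. (- a n) mod int p ^ n) \<in> carrier (Zp p)" if "a \<in> carrier (Zp p)" for a
  proof (rule Zp_carrierI[OF assms])
    fix n show "- a (Suc n) mod int p ^ Suc n mod int p ^ n = - a n mod int p ^ n"
      using Zp_mod[OF that, of n "Suc n"] by (subst mod_power_mod, simp) (simp flip: mod_minus_eq[of "a (Suc n)"])
  qed simp
  show "abelian_group (Zp p)"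
  proof (rule abelian_groupI)
    fix a assume a: "a \<in> carrier (Zp p)"
    show "\<exists>b\<in>carrier (Zp p). b \<oplus>\<^bsub>Zp p\<^esub> a = \<zero>\<^bsub>Zp p\<^esub>"
      using neg[OF a] by (rule bexI[rotated]) (auto simp: Zp_simps mod_simps)
    show "\<zero>\<^bsub>Zp p\<^esub> \<oplus>\<^bsub>Zp p\<^esub> a = a"
      using a by (auto simp: Zp_simps Zp_self_mod)
  qed (auto simp: Zp_simps mod_simps algebra_simps Zp_add_closed[OF assms, unfolded Zp_simps] 
         Zp_zero_closed[OF assms, unfolded Zp_simps])
  have one: "\<one>\<^bsub>Zp p\<^esub> \<in> carrier (Zp p)"
    using Zp_of_int_closed[OF assms, of 1] by (simp add: Zp_of_int_def Zp_simps)
  show "comm_monoid (Zp p)"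
  proof (rule comm_monoidI)
    fix a assume a: "a \<in> carrier (Zp p)"
    show "\<one>\<^bsub>Zp p\<^esub> \<otimes>\<^bsub>Zp p\<^esub> a = a"
      using a by (auto simp: Zp_simps Zp_self_mod mod_simps)
  qed (use one in \<open>auto simp: Zp_simps mod_simps algebra_simps
        Zp_mult_closed[OF assms, unfolded Zp_simps]\<close>)
qed (auto simp: Zp_simps mod_simps algebra_simps)

text \<open>Division by p^k of an element whose residue at \<open>k\<close> vanishes. Dividing a
  residue modulo p^(n + k) by p^k leaves a residue modulo p^n, hence the shifted index.\<close>

definition Zp_shift :: "nat \<Rightarrow> nat \<Rightarrow> (nat \<Rightarrow> int) \<Rightarrow> (nat \<Rightarrow> int)" where
  "Zp_shift p k a = (\<lambda>n. a (n + k) div int p ^ k)"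

lemma Zp_dvd:
  assumes "a \<in> carrier (Zp p)" "a k = 0"
  shows "int p ^ k dvd a (n + k)"
  using Zp_mod[OF assms(1), of k "n + k"] assms(2) by auto

lemma Zp_shift_closed:
  assumes "p > 0" "a \<in> carrier (Zp p)" "a k = 0"
  shows "Zp_shift p k a \<in> carrier (Zp p)"
proof -
  have pk: "int p ^ k > 0" using assms by simp
  have div_mod: "(x div int p ^ k) mod int p ^ n = (x mod int p ^ (n + k)) div int p ^ k"
    if "int p ^ k dvd x" for x n
  proof -
    obtain y where "x = int p ^ k * y" using \<open>int p ^ k dvd x\<close> by blast
    then show ?thesis using pk
      by (simp add: power_add mult.commute[of _ "int p ^ k"] flip: mult_mod_right)
  qed
  show ?thesis
  proof (rule Zp_carrierI[OF assms(1)])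
    fix n
    show "Zp_shift p k a n mod int p ^ n = Zp_shift p k a n"
      unfolding Zp_shift_def using div_mod[OF Zp_dvd[OF assms(2,3)]] Zp_self_mod[OF assms(2)] by metis
    show "Zp_shift p k a (Suc n) mod int p ^ n = Zp_shift p k a n"
      unfolding Zp_shift_def using div_mod[OF Zp_dvd[OF assms(2,3)], of "Suc n" n] 
        Zp_mod[OF assms(2), of "n + k" "Suc n + k"] by simp
  qed
qed

lemma Zp_shift_mult:
  assumes "p > 0" "a \<in> carrier (Zp p)" "a k = 0"
  shows "Zp_of_int p (int p ^ k) \<otimes>\<^bsub>Zp p\<^esub> Zp_shift p k a = a"
proof
  fix n
  have "int p ^ k * (a (n + k) div int p ^ k) = a (n + k)"
    using Zp_dvd[OF assms(2,3)] by simp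
  then show "(Zp_of_int p (int p ^ k) \<otimes>\<^bsub>Zp p\<^esub> Zp_shift p k a) n = a n"
    using Zp_mod[OF assms(2), of n "n + k"]
    by (simp add: Zp_simps Zp_of_int_def Zp_shift_def mod_simps)
qed

lemma Zp_power_divides_iff:
  assumes "p > 0" "a \<in> carrier (Zp p)"
  shows "Zp_of_int p (int p ^ k) divides\<^bsub>Zp p\<^esub> a \<longleftrightarrow> a k = 0"
proof
  assume "Zp_of_int p (int p ^ k) divides\<^bsub>Zp p\<^esub> a"
  then obtain b where "a = Zp_of_int p (int p ^ k) \<otimes>\<^bsub>Zp p\<^esub> b"
    unfolding factor_def by blast
  then show "a k = 0" by (simp add: Zp_simps Zp_of_int_def mod_simps)
next
  assume "a k = 0"
  then show "Zp_of_int p (int p ^ k) divides\<^bsub>Zp p\<^esub> a"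
    unfolding factor_def using Zp_shift_closed[OF assms] Zp_shift_mult[OF assms] by metis
qed

lemma Zp_eq_0_mono:
  assumes "a \<in> carrier (Zp p)" "a n = 0" "m \<le> n"
  shows "a m = 0"
  using Zp_mod[OF assms(1,3)] assms(2) by simp

text \<open>The vanishing residues occupy an initial segment of indices, bounded because
  \<open>a\<close> is nonzero; so the \<open>GREATEST\<close> in \<open>Zp_ord\<close> is
  attained.\<close>

lemma Zp_ord_props:
  assumes "p > 0" "a \<in> carrier (Zp p)" "a \<noteq> \<zero>\<^bsub>Zp p\<^esub>"
  shows "a k = 0 \<longleftrightarrow> k \<le> Zp_ord p a"
proof -
  obtain n where n: "a n \<noteq> 0" using assms(3) by (auto simp: Zp_simps)
  have bd: "\<forall>y. a y = 0 \<longrightarrow> y \<le> n" using Zp_eq_0_mono[OF assms(2)] n nat_le_linear by metis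
  have ord: "Zp_ord p a = (GREATEST n. a n = 0)"
    by (simp add: Zp_ord_def Zp_power_divides_iff[OF assms(1,2)])
  have "a (Zp_ord p a) = 0"
    unfolding ord using GreatestI_nat[of "\<lambda>n. a n = 0" 0, OF Zp_0[OF assms(2)]] bd by blast
  then show ?thesis
    using Greatest_le_nat[of "\<lambda>n. a n = 0", folded ord] bd Zp_eq_0_mono[OF assms(2)] by blast
qed

text \<open>The residue of \<open>a\<close> at \<open>n\<close> can be recovered from that of p^k a
  at the finer level \<open>n + k\<close>.\<close>

lemma Zp_torsion_free:
  assumes "p > 1" "a \<in> carrier (Zp p)" "Zp_of_int p (int p ^ k) \<otimes>\<^bsub>Zp p\<^esub> a = \<zero>\<^bsub>Zp p\<^esub>"
  shows "a = \<zero>\<^bsub>Zp p\<^esub>"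
proof
  fix n
  have "(int p ^ k * a (n + k)) mod int p ^ (n + k) = 0"
    using fun_cong[OF assms(3), of "n + k"] by (simp add: Zp_simps Zp_of_int_def mod_simps)
  then have "int p ^ k * int p ^ n dvd int p ^ k * a (n + k)"
    by (simp add: power_add mult.commute mod_eq_0_iff_dvd)
  then have "int p ^ n dvd a (n + k)" using assms(1) by simp
  then show "a n = \<zero>\<^bsub>Zp p\<^esub> n" using Zp_mod[OF assms(2), of n "n + k"] by (simp add: Zp_simps)
qed

lemma Zp_of_int_mult: "Zp_of_int p a \<otimes>\<^bsub>Zp p\<^esub> Zp_of_int p b = Zp_of_int p (a * b)"
  by (simp add: Zp_simps Zp_of_int_def mod_simps)

lemma Zp_cancel:
  assumes "p > 1" "a \<in> carrier (Zp p)" "b \<in> carrier (Zp p)"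
    "Zp_of_int p (int p ^ k) \<otimes>\<^bsub>Zp p\<^esub> a = Zp_of_int p (int p ^ k) \<otimes>\<^bsub>Zp p\<^esub> b"
  shows "a = b"
proof -
  interpret Z: cring "Zp p" using Zp_cring assms(1) by simp
  have c: "Zp_of_int p (int p ^ k) \<in> carrier (Zp p)" using Zp_of_int_closed assms(1) by simp
  have "Zp_of_int p (int p ^ k) \<otimes>\<^bsub>Zp p\<^esub> (a \<ominus>\<^bsub>Zp p\<^esub> b) = \<zero>\<^bsub>Zp p\<^esub>"
    using assms c by (simp add: Z.r_minus Z.r_distr a_minus_def Z.r_neg)
  then have "a \<ominus>\<^bsub>Zp p\<^esub> b = \<zero>\<^bsub>Zp p\<^esub>" using Zp_torsion_free assms by simp
  then show ?thesis using assms by simp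
qed

section \<open>Shifts\<close>

lemma shiftD:
  assumes "shift \<rho>"
  shows "i \<ge> 1 \<Longrightarrow> \<rho> i \<ge> 1" "1 \<le> i \<Longrightarrow> i < j \<Longrightarrow> \<rho> i < \<rho> j"
  using assms by (auto simp: shift_def strict_mono_on_def)

lemma shift_less_iff: "shift \<rho> \<Longrightarrow> 1 \<le> i \<Longrightarrow> 1 \<le> j \<Longrightarrow> \<rho> i < \<rho> j \<longleftrightarrow> i < j"
  by (metis linorder_neqE_nat order_less_asym shiftD(2))

lemma shift_increasing:
  assumes "shift \<rho>" "i \<ge> 1"
  shows "i < \<rho> i"
  using assms(2)
proof (induction i rule: dec_induct)
  case base
  then show ?case using assms by (simp add: shift_def)
next
  case (step n)
  then show ?case using shiftD(2)[OF assms(1), of n "Suc n"] by simp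
qed

lemma shift_pow_ge1: "shift \<rho> \<Longrightarrow> i \<ge> 1 \<Longrightarrow> (\<rho> ^^ k) i \<ge> 1"
  by (induction k) (auto simp: shiftD(1)[simplified])

lemma shift_pow_less: "shift \<rho> \<Longrightarrow> 1 \<le> i \<Longrightarrow> i < j \<Longrightarrow> (\<rho> ^^ k) i < (\<rho> ^^ k) j"
  by (induction k) (auto simp: shiftD(2)[simplified] shift_pow_ge1[simplified])

lemma shift_pow_less_iff: 
  "shift \<rho> \<Longrightarrow> 1 \<le> i \<Longrightarrow> 1 \<le> j \<Longrightarrow> (\<rho> ^^ k) i < (\<rho> ^^ k) j \<longleftrightarrow> i < j"
  by (metis linorder_neqE_nat order_less_asym shift_pow_less)

lemma shift_pow_le_iff: 
  "shift \<rho> \<Longrightarrow> 1 \<le> i \<Longrightarrow> 1 \<le> j \<Longrightarrow> (\<rho> ^^ k) i \<le> (\<rho> ^^ k) j \<longleftrightarrow> i \<le> j"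
  by (metis linorder_not_less shift_pow_less_iff)

lemma shift_pow_inj: 
  "shift \<rho> \<Longrightarrow> 1 \<le> i \<Longrightarrow> 1 \<le> j \<Longrightarrow> (\<rho> ^^ k) i = (\<rho> ^^ k) j \<longleftrightarrow> i = j"
  by (metis linorder_neqE_nat order_less_irrefl shift_pow_less)

lemma shift_pow_increasing: "shift \<rho> \<Longrightarrow> 1 \<le> i \<Longrightarrow> k < l \<Longrightarrow> (\<rho> ^^ k) i < (\<rho> ^^ l) i"
proof (induction l rule: less_induct)
  case (less l)
  then obtain m where m: "l = Suc m" by (cases l) auto
  have "(\<rho> ^^ m) i < (\<rho> ^^ l) i"
    using less m shift_increasing shift_pow_ge1 by simp
  then show ?case using less m by (cases "k = m") force+
qed

lemma shift_pow_mono: "shift \<rho> \<Longrightarrow> 1 \<le> i \<Longrightarrow> k \<le> l \<Longrightarrow> (\<rho> ^^ k) i \<le> (\<rho> ^^ l) i"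
  using shift_pow_increasing[of \<rho> i k l] by (cases "k = l") auto

lemma shift_pow_ge: "shift \<rho> \<Longrightarrow> 1 \<le> i \<Longrightarrow> k < (\<rho> ^^ k) i"
proof (induction k)
  case (Suc k)
  then show ?case using shift_increasing[of \<rho> "(\<rho> ^^ k) i"] shift_pow_ge1[of \<rho> i k] by simp
qed simp

lemma shift_gaps_star_ge1: "i \<in> shift_gaps_star \<rho> \<Longrightarrow> 1 \<le> i"
  by (auto simp: shift_gaps_star_def shift_gaps_def e_star_def)

text \<open>Weight at least \<open>j\<close> means that the order of \<open>x\<close> exceeds every
  \<open>k\<close> with \<rho>^k(i) < j, and order above \<open>k\<close> is a vanishing residue at
  \<open>Suc k\<close>. This form covers x = 0 uniformly; the conditions \<open>wt_nat\<close> and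
  \<open>wt\<close> below imitate it.\<close>

lemma S_filt_iff:
  assumes "p > 0" "shift \<rho>" "i \<ge> 1"
  shows "x \<in> filt (S_mod p \<rho> i) j \<longleftrightarrow>
    x \<in> carrier (Zp p) \<and> (\<forall>k. (\<rho> ^^ k) i < j \<longrightarrow> x (Suc k) = 0)"
proof (cases "x \<in> carrier (Zp p) \<and> x \<noteq> \<zero>\<^bsub>Zp p\<^esub>")
  case True
  define r where "r = Zp_ord p x"
  have ord: "x k = 0 \<longleftrightarrow> k \<le> r" for k unfolding r_def
    using Zp_ord_props[OF assms(1)] True by blast
  have "j \<le> (\<rho> ^^ r) i \<longleftrightarrow> (\<forall>k. (\<rho> ^^ k) i < j \<longrightarrow> Suc k \<le> r)"
  proof
    assume "j \<le> (\<rho> ^^ r) i"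
    then show "\<forall>k. (\<rho> ^^ k) i < j \<longrightarrow> Suc k \<le> r"
      using shift_pow_mono[OF assms(2,3), of r] by (meson leD leI less_le_trans not_less_eq_eq)
  next
    assume "\<forall>k. (\<rho> ^^ k) i < j \<longrightarrow> Suc k \<le> r"
    then show "j \<le> (\<rho> ^^ r) i" by (meson leI not_less_eq_eq order_refl)
  qed
  then show ?thesis using True by (simp add: S_mod_def S_weight_def ord r_def[symmetric])
next
  case False
  then show ?thesis by (auto simp: S_mod_def S_weight_def Zp_simps)
qed

section \<open>Constructions of filtered modules\<close>

text \<open>Transport of structure along a bijection: only the source has to be known as a filtered
  module, so the axioms never have to be checked on a quotient. The filtrations must correspond
  exactly, since a mere inclusion would not make the inverse filtered.\<close>

lemma fm_iso_transport:
  assumes M: "filtered_module R M" and bij: "bij_betw \<theta> (carrier M) (carrier N)"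
    and th_zero: "\<theta> \<zero>\<^bsub>M\<^esub> = \<zero>\<^bsub>N\<^esub>"
    and th_add: "\<And>x y. x \<in> carrier M \<Longrightarrow> y \<in> carrier M \<Longrightarrow> \<theta> (x \<oplus>\<^bsub>M\<^esub> y) = \<theta> x \<oplus>\<^bsub>N\<^esub> \<theta> y"
    and th_smult: "\<And>a x. a \<in> carrier R \<Longrightarrow> x \<in> carrier M \<Longrightarrow> \<theta> (a \<odot>\<^bsub>M\<^esub> x) = a \<odot>\<^bsub>N\<^esub> \<theta> x"
    and th_filt: "\<And>i. 1 \<le> i \<Longrightarrow> filt N i = \<theta> ` filt M i"
  shows "fm_iso R M N"
proof -
  interpret filtered_module R M by (rule M)
  define \<psi> where "\<psi> = inv_into (carrier M) \<theta>"
  have \<psi>: "\<psi> (\<theta> x) = x" if "x \<in> carrier M" for x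
    using that bij unfolding \<psi>_def by (simp add: bij_betw_inv_into_left)
  have N: "y \<in> carrier N \<longleftrightarrow> (\<exists>x\<in>carrier M. y = \<theta> x)" for y
    using bij by (auto simp: bij_betw_def)
  have N': "carrier N = \<theta> ` carrier M" using bij by (simp add: bij_betw_def)
  have sub: "filt M i \<subseteq> carrier M" if "1 \<le> i" for i
    using submoduleE(1)[OF filt_submodule[OF that]] .
  have N_group: "abelian_group N"
  proof (rule abelian_groupI)
    show "\<zero>\<^bsub>N\<^esub> \<in> carrier N" by (simp add: th_zero[symmetric] N')
    fix y assume "y \<in> carrier N"
    then obtain x where "x \<in> carrier M" "y = \<theta> x" using N by blast
    then show "\<exists>z\<in>carrier N. z \<oplus>\<^bsub>N\<^esub> y = \<zero>\<^bsub>N\<^esub>"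
      using th_add[of "\<ominus>\<^bsub>M\<^esub> x" x] th_zero
      by (intro bexI[of _ "\<theta> (\<ominus>\<^bsub>M\<^esub> x)"]) (auto simp: N' M.l_neg)
  qed (auto simp: N' th_add[symmetric] th_zero[symmetric] M.a_ac)
  have N_module: "module R N"
    by (rule moduleI[OF R.cring_axioms N_group])
      (auto simp: N' th_add[symmetric] th_smult[symmetric] smult_l_distr smult_r_distr smult_assoc1)
  interpret N: module R N by (rule N_module)
  have inter: "(\<Inter>i\<in>{1..}. filt N i) = \<theta> ` (\<Inter>i\<in>{1..}. filt M i)"
  proof (subst image_INT[of \<theta> "carrier M"])
    show "inj_on \<theta> (carrier M)" using bij by (simp add: bij_betw_def)
    show "\<forall>i\<in>{1..}. filt M i \<subseteq> carrier M" using sub by auto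
    show "\<Inter> (filt N ` {1..}) = (\<Inter>x\<in>{1..}. \<theta> ` filt M x)" using th_filt by auto
  qed auto
  have "filtered_module R N"
  proof (intro filtered_module.intro filtered_module_axioms.intro N_module)
    show "filt N 1 = carrier N" using th_filt[of 1] filt_1 bij by (auto simp: bij_betw_def)
    show "(\<Inter>i\<in>{1..}. filt N i) = {\<zero>\<^bsub>N\<^esub>}"
      using inter filt_separated th_zero by simp
    fix i :: nat assume i: "1 \<le> i"
    have neg: "\<ominus>\<^bsub>N\<^esub> \<theta> x = \<theta> (\<ominus>\<^bsub>M\<^esub> x)" if "x \<in> carrier M" for x
      by (rule N.minus_equality) (use that in \<open>auto simp: N' th_add[symmetric] th_zero M.l_neg\<close>)
    note E = submoduleE[OF filt_submodule[OF i]]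
    show "submodule (filt N i) R N"
    proof (rule N.submoduleI)
      have "\<zero>\<^bsub>M\<^esub> \<in> filt M i"
        using filt_separated i by blast
      then show "\<zero>\<^bsub>N\<^esub> \<in> filt N i" using th_zero th_filt[OF i] by force
    qed (use sub[OF i] E in \<open>auto simp: th_filt[OF i] N' neg subset_eq th_add[symmetric] th_smult[symmetric]\<close>)
    show "filt N (Suc i) \<subseteq> filt N i" using th_filt filt_Suc i by (simp add: image_mono)
  qed
  moreover have "\<theta> \<in> fm_hom R M N"
    using N' th_filt by (auto simp: fm_hom_def th_add th_smult)
  moreover have "\<psi> \<in> fm_hom R N M"
    using sub th_filt by (auto simp: fm_hom_def N' \<psi> th_add[symmetric] th_smult[symmetric] subset_eq)
  moreover have "\<forall>y\<in>carrier N. \<theta> (\<psi> y) = y" using N \<psi> by auto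
  ultimately show ?thesis unfolding fm_iso_def using M \<psi> by blast
qed

lemma fm_iso_sym: "fm_iso R M N \<Longrightarrow> fm_iso R N M"
  unfolding fm_iso_def by blast

lemma fm_prod_module:
  assumes "cring R" and M: "\<And>i. i \<in> I \<Longrightarrow> module R (M i)"
  shows "module R (fm_prod I M)"
proof (rule moduleI[OF assms(1)])
  have grp: "abelian_group (M i)" if "i \<in> I" for i using M[OF that] by (simp add: module_def)
  note E = abelian_groupE[OF grp]
  show "abelian_group (fm_prod I M)"
  proof (rule abelian_groupI)
    show "\<zero>\<^bsub>fm_prod I M\<^esub> \<in> carrier (fm_prod I M)" using E(2) by (auto simp: fm_prod_def)
    fix x assume x: "x \<in> carrier (fm_prod I M)"
    define y where "y = (\<lambda>i\<in>I. \<ominus>\<^bsub>M i\<^esub> x i)"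
    have "y \<in> carrier (fm_prod I M)" "y \<oplus>\<^bsub>fm_prod I M\<^esub> x = \<zero>\<^bsub>fm_prod I M\<^esub>"
      using x abelian_group.a_inv_closed[OF grp] abelian_group.l_neg[OF grp]
      unfolding y_def by (auto simp: fm_prod_def PiE_iff fun_eq_iff)
    then show "\<exists>y\<in>carrier (fm_prod I M). y \<oplus>\<^bsub>fm_prod I M\<^esub> x = \<zero>\<^bsub>fm_prod I M\<^esub>" by blast
    show "\<zero>\<^bsub>fm_prod I M\<^esub> \<oplus>\<^bsub>fm_prod I M\<^esub> x = x"
      using x E(5) by (auto simp: fm_prod_def PiE_iff fun_eq_iff extensional_def)
    fix y assume y: "y \<in> carrier (fm_prod I M)"
    show "x \<oplus>\<^bsub>fm_prod I M\<^esub> y = y \<oplus>\<^bsub>fm_prod I M\<^esub> x"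
      using x y E(4) by (auto simp: fm_prod_def PiE_iff fun_eq_iff)
    show "x \<oplus>\<^bsub>fm_prod I M\<^esub> y \<in> carrier (fm_prod I M)"
      using x y E(1) by (auto simp: fm_prod_def PiE_iff)
    fix z assume z: "z \<in> carrier (fm_prod I M)"
    show "x \<oplus>\<^bsub>fm_prod I M\<^esub> y \<oplus>\<^bsub>fm_prod I M\<^esub> z = x \<oplus>\<^bsub>fm_prod I M\<^esub> (y \<oplus>\<^bsub>fm_prod I M\<^esub> z)"
      using x y z E(3) by (auto simp: fm_prod_def PiE_iff fun_eq_iff)
  qed
next
  fix a x assume "a \<in> carrier R" "x \<in> carrier (fm_prod I M)"
  then show "a \<odot>\<^bsub>fm_prod I M\<^esub> x \<in> carrier (fm_prod I M)"
    using module.smult_closed[OF M] by (auto simp: fm_prod_def PiE_iff)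
next
  fix a b x assume "a \<in> carrier R" "b \<in> carrier R" "x \<in> carrier (fm_prod I M)"
  then show "(a \<oplus>\<^bsub>R\<^esub> b) \<odot>\<^bsub>fm_prod I M\<^esub> x = a \<odot>\<^bsub>fm_prod I M\<^esub> x \<oplus>\<^bsub>fm_prod I M\<^esub> b \<odot>\<^bsub>fm_prod I M\<^esub> x"
    and "(a \<otimes>\<^bsub>R\<^esub> b) \<odot>\<^bsub>fm_prod I M\<^esub> x = a \<odot>\<^bsub>fm_prod I M\<^esub> (b \<odot>\<^bsub>fm_prod I M\<^esub> x)"
    using module.smult_l_distr[OF M] module.smult_assoc1[OF M] 
    by (auto simp: fm_prod_def PiE_iff fun_eq_iff)
next
  fix a x y assume "a \<in> carrier R" "x \<in> carrier (fm_prod I M)" "y \<in> carrier (fm_prod I M)"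
  then show "a \<odot>\<^bsub>fm_prod I M\<^esub> (x \<oplus>\<^bsub>fm_prod I M\<^esub> y) = a \<odot>\<^bsub>fm_prod I M\<^esub> x \<oplus>\<^bsub>fm_prod I M\<^esub> a \<odot>\<^bsub>fm_prod I M\<^esub> y"
    using module.smult_r_distr[OF M] by (auto simp: fm_prod_def PiE_iff fun_eq_iff)
next
  fix x assume "x \<in> carrier (fm_prod I M)"
  then show "\<one>\<^bsub>R\<^esub> \<odot>\<^bsub>fm_prod I M\<^esub> x = x"
    using module.smult_one[OF M] by (auto simp: fm_prod_def PiE_iff fun_eq_iff extensional_def)
qed

lemma S_mod_module:
  assumes "p > 0"
  shows "module (Zp p) (S_mod p \<rho> i)"
proof -
  interpret Z: cring "Zp p" by (rule Zp_cring[OF assms])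
  have "abelian_group (S_mod p \<rho> i)"
    by (rule abelian_groupI) (use Z.l_neg in \<open>auto simp: S_mod_def Z.a_ac\<close>)
  then show ?thesis
    by (rule moduleI[OF Z.cring_axioms]) (auto simp: S_mod_def Z.l_distr Z.r_distr Z.m_assoc)
qed

lemma M_star_mod_module: "p > 0 \<Longrightarrow> module (Zp p) (M_star_mod p \<rho>)"
  unfolding M_star_mod_def by (intro fm_prod_module Zp_cring S_mod_module)

lemma M_star_mod_sel:
  "carrier (M_star_mod p \<rho>) = (shift_gaps_star \<rho> \<rightarrow>\<^sub>E carrier (Zp p))"
  "\<zero>\<^bsub>M_star_mod p \<rho>\<^esub> = (\<lambda>i\<in>shift_gaps_star \<rho>. \<zero>\<^bsub>Zp p\<^esub>)"
  "x \<oplus>\<^bsub>M_star_mod p \<rho>\<^esub> y = (\<lambda>i\<in>shift_gaps_star \<rho>. x i \<oplus>\<^bsub>Zp p\<^esub> y i)"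
  "a \<odot>\<^bsub>M_star_mod p \<rho>\<^esub> x = (\<lambda>i\<in>shift_gaps_star \<rho>. a \<otimes>\<^bsub>Zp p\<^esub> x i)"
  "filt (M_star_mod p \<rho>) j = (\<Pi>\<^sub>E i\<in>shift_gaps_star \<rho>. filt (S_mod p \<rho> i) j)"
  by (simp_all add: M_star_mod_def fm_prod_def S_mod_def)

section \<open>Cyclic submodules, cosets and the quotient filtration\<close>

context module
begin

lemma cyclic_span_submodule:
  assumes "v \<in> carrier M"
  shows "submodule (cyclic_span R M v) R M"
proof (rule submoduleI)
  show "\<zero>\<^bsub>M\<^esub> \<in> cyclic_span R M v"
    unfolding cyclic_span_def using assms smult_l_null[of v] R.zero_closed by force
qed (use assms in \<open>auto simp: cyclic_span_def simp flip: smult_l_distr smult_assoc1 smult_l_minus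
       intro: R.add.inv_closed R.add.m_closed R.m_closed\<close>)

lemma submodule_abelian_subgroup:
  assumes "submodule N R M"
  shows "abelian_subgroup N M"
proof (rule abelian_subgroupI3)
  show "additive_subgroup N M"
    using submodule.axioms(1)[OF assms] by (simp add: additive_subgroup_def)
qed (rule M.abelian_group_axioms)

lemma coset_eq_iff:
  assumes "submodule N R M" "x \<in> carrier M" "y \<in> carrier M"
  shows "N +>\<^bsub>M\<^esub> x = N +>\<^bsub>M\<^esub> y \<longleftrightarrow> (\<exists>n\<in>N. x = n \<oplus>\<^bsub>M\<^esub> y)"
proof -
  interpret N: abelian_subgroup N M by (rule submodule_abelian_subgroup[OF assms(1)])
  have "N +>\<^bsub>M\<^esub> x = N +>\<^bsub>M\<^esub> y \<longleftrightarrow> x \<in> N +>\<^bsub>M\<^esub> y"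
    using N.a_rcos_self[OF assms(2)] N.a_repr_independence'[OF _ assms(3)] by auto
  then show ?thesis by (auto simp: a_r_coset_def')
qed

lemma coset_eq_self_iff:
  assumes "submodule N R M" "x \<in> carrier M"
  shows "N +>\<^bsub>M\<^esub> x = N \<longleftrightarrow> x \<in> N"
proof -
  have N: "N \<subseteq> carrier M" using submoduleE(1)[OF assms(1)] .
  have "N +>\<^bsub>M\<^esub> \<zero>\<^bsub>M\<^esub> = N" using N by (rule M.a_coset_add_zero)
  then show ?thesis
    using coset_eq_iff[OF assms M.zero_closed] N by (metis M.r_zero subsetD)
qed

text \<open>The quotient defines scalar multiplication as a union over all representatives; the
  union collapses because each representative yields the same coset.\<close>

lemma quotient_smult:
  assumes "submodule N R M" "a \<in> carrier R" "y \<in> carrier M"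
  shows "(\<Union>x\<in>N +>\<^bsub>M\<^esub> y. N +>\<^bsub>M\<^esub> (a \<odot>\<^bsub>M\<^esub> x)) = N +>\<^bsub>M\<^esub> (a \<odot>\<^bsub>M\<^esub> y)"
proof -
  interpret N: abelian_subgroup N M by (rule submodule_abelian_subgroup[OF assms(1)])
  note E = submoduleE[OF assms(1)]
  have "N +>\<^bsub>M\<^esub> (a \<odot>\<^bsub>M\<^esub> x) = N +>\<^bsub>M\<^esub> (a \<odot>\<^bsub>M\<^esub> y)" if x: "x \<in> N +>\<^bsub>M\<^esub> y" for x
  proof -
    obtain n where n: "n \<in> N" "x = n \<oplus>\<^bsub>M\<^esub> y" using x by (auto simp: a_r_coset_def')
    then have "n \<in> carrier M" using E(1) by blast
    with n assms E(4)[of a n] show ?thesis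
      by (subst coset_eq_iff[OF assms(1)]) (auto simp: smult_r_distr)
  qed
  then have "(\<Union>x\<in>N +>\<^bsub>M\<^esub> y. N +>\<^bsub>M\<^esub> (a \<odot>\<^bsub>M\<^esub> x)) = (\<Union>x\<in>N +>\<^bsub>M\<^esub> y. N +>\<^bsub>M\<^esub> (a \<odot>\<^bsub>M\<^esub> y))"
    by (intro SUP_cong) auto
  also have "\<dots> = N +>\<^bsub>M\<^esub> (a \<odot>\<^bsub>M\<^esub> y)"
    using N.a_rcos_self[OF assms(3)] by blast
  finally show ?thesis .
qed

lemma quotient_filt:
  assumes "submodule N R M" "F \<subseteq> carrier M"
  shows "(\<lambda>x. N +>\<^bsub>M\<^esub> x) ` (F <+>\<^bsub>M\<^esub> N) = (\<lambda>x. N +>\<^bsub>M\<^esub> x) ` F"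
proof -
  note E = submoduleE[OF assms(1)]
  interpret N: abelian_subgroup N M by (rule submodule_abelian_subgroup[OF assms(1)])
  have eq: "N +>\<^bsub>M\<^esub> (x \<oplus>\<^bsub>M\<^esub> n) = N +>\<^bsub>M\<^esub> x" if "x \<in> F" "n \<in> N" for x n
  proof -
    have "x \<in> carrier M" "n \<in> carrier M" using that E(1) assms(2) by auto
    then show ?thesis using that
      by (subst coset_eq_iff[OF assms(1)]) (auto simp: M.a_comm)
  qed
  have "F <+>\<^bsub>M\<^esub> N = (\<Union>x\<in>F. \<Union>n\<in>N. {x \<oplus>\<^bsub>M\<^esub> n})" by (simp add: set_add_def')
  then have "(\<lambda>x. N +>\<^bsub>M\<^esub> x) ` (F <+>\<^bsub>M\<^esub> N) = (\<Union>x\<in>F. \<Union>n\<in>N. {N +>\<^bsub>M\<^esub> (x \<oplus>\<^bsub>M\<^esub> n)})"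
    by (simp add: image_UN)
  also have "\<dots> = (\<Union>x\<in>F. \<Union>n\<in>N. {N +>\<^bsub>M\<^esub> x})"
    by (intro SUP_cong) (auto simp: eq)
  also have "\<dots> = (\<lambda>x. N +>\<^bsub>M\<^esub> x) ` F" using E(2) by auto
  finally show ?thesis .
qed

end

text \<open>The invariant behind uniqueness. Quantifying over all nonzero elements of order
  \<open>p\<close> makes it visibly invariant under isomorphism. In the targets below these elements
  are the classes of unit multiples of v / p, where v is the jump vector, so the choice among them
  is immaterial.\<close>

definition torsion_profile ::
  "nat \<Rightarrow> (nat \<Rightarrow> int, 'b, 'm) filtered_module_scheme \<Rightarrow> nat \<Rightarrow> nat \<Rightarrow> bool" where
  "torsion_profile p M k j \<longleftrightarrow>
     (\<exists>x\<in>carrier M. x \<noteq> \<zero>\<^bsub>M\<^esub> \<and> Zp_of_int p (int p ^ 1) \<odot>\<^bsub>M\<^esub> x = \<zero>\<^bsub>M\<^esub> \<and>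
        (\<exists>g\<in>filt M j. \<exists>h\<in>carrier M. x = g \<oplus>\<^bsub>M\<^esub> (Zp_of_int p (int p ^ k) \<odot>\<^bsub>M\<^esub> h)))"

lemma fm_hom_zero:
  assumes "filtered_module R M" "filtered_module R N" "\<phi> \<in> fm_hom R M N"
  shows "\<phi> \<zero>\<^bsub>M\<^esub> = \<zero>\<^bsub>N\<^esub>"
proof -
  interpret M: filtered_module R M by fact
  interpret N: filtered_module R N by fact
  have "\<phi> (\<zero>\<^bsub>R\<^esub> \<odot>\<^bsub>M\<^esub> \<zero>\<^bsub>M\<^esub>) = \<zero>\<^bsub>R\<^esub> \<odot>\<^bsub>N\<^esub> \<phi> \<zero>\<^bsub>M\<^esub>" "\<phi> \<zero>\<^bsub>M\<^esub> \<in> carrier N"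
    using assms(3) M.R.zero_closed M.M.zero_closed unfolding fm_hom_def by blast+
  then show ?thesis
    using M.smult_l_null[OF M.zero_closed] N.smult_l_null[of "\<phi> \<zero>\<^bsub>M\<^esub>"] by simp
qed

lemma torsion_profile_iso:
  assumes "p > 0" "fm_iso (Zp p) M N" "j \<ge> 1" "torsion_profile p M k j"
  shows "torsion_profile p N k j"
proof -
  obtain \<phi> \<psi> where h: "\<phi> \<in> fm_hom (Zp p) M N" "\<psi> \<in> fm_hom (Zp p) N M"
    "\<forall>x\<in>carrier M. \<psi> (\<phi> x) = x" and M: "filtered_module (Zp p) M" and N: "filtered_module (Zp p) N"
    using assms(2) by (auto simp: fm_iso_def)
  interpret M: filtered_module "Zp p" M by (rule M)
  obtain x g h' where x: "x \<in> carrier M" "x \<noteq> \<zero>\<^bsub>M\<^esub>" "Zp_of_int p (int p ^ 1) \<odot>\<^bsub>M\<^esub> x = \<zero>\<^bsub>M\<^esub>"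
    "g \<in> filt M j" "h' \<in> carrier M" "x = g \<oplus>\<^bsub>M\<^esub> (Zp_of_int p (int p ^ k) \<odot>\<^bsub>M\<^esub> h')"
    using assms(4) by (auto simp: torsion_profile_def)
  have g: "g \<in> carrier M" using M.submoduleE(1)[OF M.filt_submodule[OF assms(3)]] x(4) by blast
  have c: "Zp_of_int p m \<in> carrier (Zp p)" for m by (rule Zp_of_int_closed[OF assms(1)])
  have sm: "\<phi> (a \<odot>\<^bsub>M\<^esub> y) = a \<odot>\<^bsub>N\<^esub> \<phi> y" if "a \<in> carrier (Zp p)" "y \<in> carrier M" for a y
    using h(1) that by (simp add: fm_hom_def)
  have "\<phi> x \<noteq> \<zero>\<^bsub>N\<^esub>" using x h(3) fm_hom_zero[OF N M h(2)] by metis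
  moreover have "Zp_of_int p (int p ^ 1) \<odot>\<^bsub>N\<^esub> \<phi> x = \<zero>\<^bsub>N\<^esub>"
    using sm[OF c x(1), symmetric] x(3) fm_hom_zero[OF M N h(1)] by metis
  moreover have "\<phi> x = \<phi> g \<oplus>\<^bsub>N\<^esub> (Zp_of_int p (int p ^ k) \<odot>\<^bsub>N\<^esub> \<phi> h')"
    using h(1) g x(5) c by (simp add: fm_hom_def x(6))
  moreover have "\<phi> x \<in> carrier N" "\<phi> h' \<in> carrier N" "\<phi> g \<in> filt N j"
    using h(1) x(1,4,5) assms(3) unfolding fm_hom_def by blast+
  ultimately show ?thesis unfolding torsion_profile_def by blast
qed

lemma fm_sum_quotient_sel:
  "carrier (P \<oplus>\<^sub>f fm_quotient M N) = carrier P \<times> a_rcosets\<^bsub>M\<^esub> N"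
  "\<zero>\<^bsub>P \<oplus>\<^sub>f fm_quotient M N\<^esub> = (\<zero>\<^bsub>P\<^esub>, N)"
  "(a, C) \<oplus>\<^bsub>P \<oplus>\<^sub>f fm_quotient M N\<^esub> (b, D) = (a \<oplus>\<^bsub>P\<^esub> b, C <+>\<^bsub>M\<^esub> D)"
  "r \<odot>\<^bsub>P \<oplus>\<^sub>f fm_quotient M N\<^esub> (a, C) = (r \<odot>\<^bsub>P\<^esub> a, \<Union>x\<in>C. N +>\<^bsub>M\<^esub> (r \<odot>\<^bsub>M\<^esub> x))"
  "filt (P \<oplus>\<^sub>f fm_quotient M N) j = filt P j \<times> (\<lambda>x. N +>\<^bsub>M\<^esub> x) ` (filt M j <+>\<^bsub>M\<^esub> N)"
  by (simp_all add: fm_sum_def fm_quotient_def)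

lemma M_star_ext:
  assumes "x \<in> carrier (M_star_mod p \<rho>)" "y \<in> carrier (M_star_mod p \<rho>)"
    "\<And>i. i \<in> shift_gaps_star \<rho> \<Longrightarrow> x i = y i"
  shows "x = y"
  using assms unfolding M_star_mod_sel(1) by (rule PiE_ext)

section \<open>Uniqueness of the jump set\<close>

abbreviation jump_target ::
  "nat \<Rightarrow> (nat \<Rightarrow> nat) \<Rightarrow> nat \<Rightarrow> nat set \<times> (nat \<Rightarrow> nat) \<Rightarrow>
   (nat \<Rightarrow> int, (nat \<Rightarrow> nat \<Rightarrow> nat \<Rightarrow> int) \<times> (nat \<Rightarrow> nat \<Rightarrow> int) set) filtered_module" where
  "jump_target p \<rho> m J \<equiv> fm_power (M_mod p \<rho>) m \<oplus>\<^sub>f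
     fm_quotient (M_star_mod p \<rho>) (cyclic_span (Zp p) (M_star_mod p \<rho>) (jump_vector p \<rho> J))"

lemma jump_vector_closed: "p > 0 \<Longrightarrow> jump_vector p \<rho> J \<in> carrier (M_star_mod p \<rho>)"
  by (cases J) (auto simp: jump_vector_def M_star_mod_sel Zp_of_int_closed Zp_zero_closed)

lemma fm_power_M_mod_sel:
  "carrier (fm_power (M_mod p \<rho>) m) = ({..<m} \<rightarrow>\<^sub>E (shift_gaps \<rho> \<rightarrow>\<^sub>E carrier (Zp p)))"
  "\<zero>\<^bsub>fm_power (M_mod p \<rho>) m\<^esub> = (\<lambda>j\<in>{..<m}. \<lambda>i\<in>shift_gaps \<rho>. \<zero>\<^bsub>Zp p\<^esub>)"
  "x \<oplus>\<^bsub>fm_power (M_mod p \<rho>) m\<^esub> y = (\<lambda>j\<in>{..<m}. \<lambda>i\<in>shift_gaps \<rho>. x j i \<oplus>\<^bsub>Zp p\<^esub> y j i)"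
  "a \<odot>\<^bsub>fm_power (M_mod p \<rho>) m\<^esub> x = (\<lambda>j\<in>{..<m}. \<lambda>i\<in>shift_gaps \<rho>. a \<otimes>\<^bsub>Zp p\<^esub> x j i)"
  "filt (fm_power (M_mod p \<rho>) m) n = ({..<m} \<rightarrow>\<^sub>E (\<Pi>\<^sub>E i\<in>shift_gaps \<rho>. filt (S_mod p \<rho> i) n))"
  by (simp_all add: M_mod_def fm_prod_def S_mod_def fm_power_def)

text \<open>The free summand has no torsion, so a torsion class comes from some \<open>y\<close>
  with p y = d v. Here \<open>d\<close> is a unit, for otherwise \<open>y\<close> would be a
  multiple of \<open>v\<close>. Hence \<open>y i\<close> has order exactly \<beta>(i) - 1 for
  \<open>i\<close> in \<open>I\<close>. If k \<ge> \<beta>(i) and j > \<rho>^(\<beta>(i) - 1)(i),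
  all three contributions to \<open>y i\<close>, from \<open>v\<close>, from the filtration step and
  from p^k M, are divisible by p^\<beta>(i), a contradiction.\<close>

lemma torsion_profile_jump_targetD:
  assumes p: "p > 1" and \<rho>: "shift \<rho>" and J: "(I, \<beta>) \<in> ext_jump_sets \<rho>" and j: "j \<ge> 1"
    and prof: "torsion_profile p (jump_target p \<rho> m (I, \<beta>)) k j"
  shows "I \<noteq> {} \<and> (\<forall>i\<in>I. \<beta> i \<le> k \<longrightarrow> j \<le> (\<rho> ^^ (\<beta> i - 1)) i)"
proof -
  define M where "M = M_star_mod p \<rho>"
  define v where "v = jump_vector p \<rho> (I, \<beta>)"
  define N where "N = cyclic_span (Zp p) M v"
  have p0: "p > 0" using p by simp
  define T where "T = jump_target p \<rho> m (I, \<beta>)"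
  obtain x0 y0 z0 where x0: "x0 \<in> carrier T"
      "x0 \<noteq> \<zero>\<^bsub>T\<^esub>"
      "Zp_of_int p (int p ^ 1) \<odot>\<^bsub>T\<^esub> x0 = \<zero>\<^bsub>T\<^esub>"
    and y0: "y0 \<in> filt T j"
    and z0: "z0 \<in> carrier T"
    and xyz: "x0 = y0 \<oplus>\<^bsub>T\<^esub>
      (Zp_of_int p (int p ^ k) \<odot>\<^bsub>T\<^esub> z0)"
    using prof unfolding T_def[symmetric] torsion_profile_def by blast
  obtain a C g G h H where pairs: "x0 = (a, C)" "y0 = (g, G)" "z0 = (h, H)"
    by (metis prod.exhaust)
  note unf = pairs T_def fm_sum_def fm_quotient_def M_def[symmetric] v_def[symmetric] N_def[symmetric]
  have aC: "a \<in> carrier (fm_power (M_mod p \<rho>) m)" "C \<in> a_rcosets\<^bsub>M\<^esub> N"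
    using x0(1) by (simp_all add: unf)
  have nz: "\<not> (a = \<zero>\<^bsub>fm_power (M_mod p \<rho>) m\<^esub> \<and> C = N)"
    using x0(2) by (simp add: unf)
  have pz: "Zp_of_int p (int p ^ 1) \<odot>\<^bsub>fm_power (M_mod p \<rho>) m\<^esub> a = \<zero>\<^bsub>fm_power (M_mod p \<rho>) m\<^esub>"
      "(\<Union>x\<in>C. N +>\<^bsub>M\<^esub> (Zp_of_int p (int p ^ 1) \<odot>\<^bsub>M\<^esub> x)) = N"
    using x0(3) by (simp_all add: unf)
  have G: "G \<in> (\<lambda>x. N +>\<^bsub>M\<^esub> x) ` (filt M j <+>\<^bsub>M\<^esub> N)"
    using y0 by (simp add: unf)
  have H: "H \<in> a_rcosets\<^bsub>M\<^esub> N" using z0 by (simp add: unf)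
  have CGH: "C = G <+>\<^bsub>M\<^esub> (\<Union>x\<in>H. N +>\<^bsub>M\<^esub> (Zp_of_int p (int p ^ k) \<odot>\<^bsub>M\<^esub> x))"
    using xyz by (simp add: unf)
  interpret module "Zp p" M unfolding M_def by (rule M_star_mod_module[OF p0])
  note sel = M_star_mod_sel[of p \<rho>, folded M_def]
  have v: "v \<in> carrier M" unfolding v_def M_def by (rule jump_vector_closed[OF p0])
  have N: "submodule N (Zp p) M" unfolding N_def by (rule cyclic_span_submodule[OF v])
  have c: "Zp_of_int p l \<in> carrier (Zp p)" for l by (rule Zp_of_int_closed[OF p0])
  interpret N: abelian_subgroup N M by (rule submodule_abelian_subgroup[OF N])
  have I: "I \<subseteq> shift_gaps_star \<rho>" and \<beta>: "i \<in> I \<Longrightarrow> \<beta> i \<ge> 1" for i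
    using J by (auto simp: ext_jump_sets_def)
  obtain y where y: "y \<in> carrier M" "C = N +>\<^bsub>M\<^esub> y" using aC(2) by (auto simp: A_RCOSETS_def')
  have "a = \<zero>\<^bsub>fm_power (M_mod p \<rho>) m\<^esub>"
  proof -
    have "a l i = \<zero>\<^bsub>Zp p\<^esub>" if "l < m" "i \<in> shift_gaps \<rho>" for l i
    proof (rule Zp_torsion_free[OF p])
      show "a l i \<in> carrier (Zp p)" using aC(1) that by (auto simp: fm_power_M_mod_sel)
      show "Zp_of_int p (int p ^ 1) \<otimes>\<^bsub>Zp p\<^esub> a l i = \<zero>\<^bsub>Zp p\<^esub>"
        using fun_cong[OF fun_cong[OF pz(1)], of l i] that by (simp add: fm_power_M_mod_sel)
    qed
    moreover have "a l \<in> extensional (shift_gaps \<rho>)" if "l < m" for l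
      using aC(1) that by (auto simp: fm_power_M_mod_sel PiE_iff)
    ultimately have "a l = (\<lambda>i\<in>shift_gaps \<rho>. \<zero>\<^bsub>Zp p\<^esub>)" if "l < m" for l
      using that by (intro extensionalityI[of "a l" "shift_gaps \<rho>"]) auto
    moreover have "a \<in> extensional {..<m}"
      using aC(1) by (auto simp: fm_power_M_mod_sel PiE_iff)
    ultimately show ?thesis
      unfolding fm_power_M_mod_sel by (intro extensionalityI[of a "{..<m}"]) auto
  qed
  then have yN: "y \<notin> N" using nz y coset_eq_self_iff[OF N y(1)] by auto
  have "Zp_of_int p (int p ^ 1) \<odot>\<^bsub>M\<^esub> y \<in> N"
    using pz(2) y quotient_smult[OF N c y(1)] coset_eq_self_iff[OF N smult_closed[OF c y(1)]] by metis
  then obtain d where d: "d \<in> carrier (Zp p)" and dv: "Zp_of_int p (int p ^ 1) \<odot>\<^bsub>M\<^esub> y = d \<odot>\<^bsub>M\<^esub> v"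
    unfolding N_def cyclic_span_def by auto
  have yi: "y i \<in> carrier (Zp p)" "v i \<in> carrier (Zp p)" if "i \<in> shift_gaps_star \<rho>" for i
    using y(1) v that by (auto simp: sel)
  have dvi: "Zp_of_int p (int p ^ 1) \<otimes>\<^bsub>Zp p\<^esub> y i = d \<otimes>\<^bsub>Zp p\<^esub> v i" if "i \<in> shift_gaps_star \<rho>" for i
    using fun_cong[OF dv, of i] that by (simp add: sel)
  have d1: "d 1 \<noteq> 0"
  proof
    assume "d 1 = 0"
    define d' where "d' = Zp_shift p 1 d"
    have d': "d' \<in> carrier (Zp p)" "Zp_of_int p (int p ^ 1) \<otimes>\<^bsub>Zp p\<^esub> d' = d"
      unfolding d'_def using Zp_shift_closed[OF p0 d \<open>d 1 = 0\<close>] Zp_shift_mult[OF p0 d \<open>d 1 = 0\<close>] by auto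
    have "y i = (d' \<odot>\<^bsub>M\<^esub> v) i" if i: "i \<in> shift_gaps_star \<rho>" for i
    proof -
      have "y i = d' \<otimes>\<^bsub>Zp p\<^esub> v i"
      proof (rule Zp_cancel[OF p])
        show "Zp_of_int p (int p ^ 1) \<otimes>\<^bsub>Zp p\<^esub> y i = Zp_of_int p (int p ^ 1) \<otimes>\<^bsub>Zp p\<^esub> (d' \<otimes>\<^bsub>Zp p\<^esub> v i)"
          unfolding dvi[OF i] using d' yi[OF i] c by (simp add: R.m_assoc[symmetric])
      qed (use d' yi[OF i] in auto)
      then show ?thesis using i by (simp add: sel)
    qed
    then have "y = d' \<odot>\<^bsub>M\<^esub> v"
      using M_star_ext[of y p \<rho>] y(1) smult_closed[OF d'(1) v] unfolding M_def by blast
    then show False using yN d'(1) unfolding N_def cyclic_span_def by auto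
  qed
  have "I \<noteq> {}"
  proof
    assume "I = {}"
    then have "v = \<zero>\<^bsub>M\<^esub>" by (auto simp: v_def jump_vector_def sel)
    then have "d \<odot>\<^bsub>M\<^esub> v = \<zero>\<^bsub>M\<^esub>" using smult_r_null[OF d] by simp
    then have "y i = \<zero>\<^bsub>Zp p\<^esub>" if "i \<in> shift_gaps_star \<rho>" for i
      using fun_cong[OF dv, of i] that Zp_torsion_free[OF p yi(1)[OF that], of 1] by (simp add: sel)
    then have "y = \<zero>\<^bsub>M\<^esub>"
      using y(1) M.zero_closed unfolding sel(1) by (intro PiE_ext[of y _ _ "\<zero>\<^bsub>M\<^esub>"]) (auto simp: sel)
    then show False using yN by simp
  qed
  moreover have "j \<le> (\<rho> ^^ (\<beta> i - 1)) i" if i: "i \<in> I" "\<beta> i \<le> k" for i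
  proof (rule ccontr)
    assume "\<not> j \<le> (\<rho> ^^ (\<beta> i - 1)) i"
    then have lt: "(\<rho> ^^ (\<beta> i - 1)) i < j" by simp
    have ii: "i \<in> shift_gaps_star \<rho>" using i I by auto
    have fsub: "filt M j \<subseteq> carrier M"
      unfolding sel using S_filt_iff[OF p0 \<rho> shift_gaps_star_ge1] by (intro PiE_mono) auto
    obtain g' where g': "g' \<in> filt M j" "G = N +>\<^bsub>M\<^esub> g'"
      using G unfolding quotient_filt[OF N fsub] by auto
    obtain h' where h': "h' \<in> carrier M" "H = N +>\<^bsub>M\<^esub> h'" using H by (auto simp: A_RCOSETS_def')
    have cl: "Zp_of_int p (int p ^ k) \<odot>\<^bsub>M\<^esub> h' \<in> carrier M" "g' \<in> carrier M"
      using h' c g' fsub by auto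
    have "C = N +>\<^bsub>M\<^esub> (g' \<oplus>\<^bsub>M\<^esub> Zp_of_int p (int p ^ k) \<odot>\<^bsub>M\<^esub> h')"
      unfolding CGH g'(2) h'(2) quotient_smult[OF N c h'(1)] by (rule N.a_rcos_sum[OF cl(2,1)])
    then obtain d' where d': "y = (d' \<odot>\<^bsub>M\<^esub> v) \<oplus>\<^bsub>M\<^esub> (g' \<oplus>\<^bsub>M\<^esub> Zp_of_int p (int p ^ k) \<odot>\<^bsub>M\<^esub> h')"
      using coset_eq_iff[OF N y(1) M.a_closed[OF cl(2,1)]] y(2) unfolding N_def cyclic_span_def by auto
    have "g' i (Suc (\<beta> i - 1)) = 0"
      using g'(1) ii lt S_filt_iff[OF p0 \<rho> shift_gaps_star_ge1[OF ii]] unfolding sel by blast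
    then have g0: "g' i (\<beta> i) = 0" using \<beta>[OF i(1)] by simp
    have vi: "v i n = int p ^ \<beta> i mod int p ^ n" for n
      using i ii by (simp add: v_def jump_vector_def Zp_of_int_def)
    have "int p ^ k = int p ^ \<beta> i * int p ^ (k - \<beta> i)" using i(2) by (simp flip: power_add)
    then have "y i (\<beta> i) = 0"
      unfolding d' using ii g0 by (simp add: sel Zp_simps vi Zp_of_int_def mod_simps)
    then have "int p ^ \<beta> i dvd y i (Suc (\<beta> i))"
      using Zp_dvd[OF yi(1)[OF ii], of "\<beta> i" 1] by simp
    then have "(int p * y i (Suc (\<beta> i))) mod int p ^ Suc (\<beta> i) = 0" by simp
    moreover have "(int p * y i (Suc (\<beta> i))) mod int p ^ Suc (\<beta> i) = (d (Suc (\<beta> i)) * int p ^ \<beta> i) mod int p ^ Suc (\<beta> i)"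
      using fun_cong[OF dvi[OF ii], of "Suc (\<beta> i)"]
      by (simp add: Zp_simps Zp_of_int_def vi mod_simps del: power_Suc)
    ultimately have "int p * int p ^ \<beta> i dvd d (Suc (\<beta> i)) * int p ^ \<beta> i" by auto
    then have "int p dvd d (Suc (\<beta> i))" using p by simp
    then have "d 1 = 0" using Zp_mod[OF d, of 1 "Suc (\<beta> i)"] by simp
    then show False using d1 by simp
  qed
  ultimately show ?thesis by blast
qed

lemma torsion_profile_jump_targetI:
  assumes p: "p > 1" and \<rho>: "shift \<rho>" and J: "(I, \<beta>) \<in> ext_jump_sets \<rho>" and j: "j \<ge> 1"
    and I0: "I \<noteq> {}" and I\<beta>: "\<forall>i\<in>I. \<beta> i \<le> k \<longrightarrow> j \<le> (\<rho> ^^ (\<beta> i - 1)) i"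
  shows "torsion_profile p (jump_target p \<rho> m (I, \<beta>)) k j"
proof -
  define M where "M = M_star_mod p \<rho>"
  define P where "P = fm_power (M_mod p \<rho>) m"
  define v where "v = jump_vector p \<rho> (I, \<beta>)"
  define N where "N = cyclic_span (Zp p) M v"
  have p0: "p > 0" using p by simp
  interpret module "Zp p" M unfolding M_def by (rule M_star_mod_module[OF p0])
  interpret P: module "Zp p" P
    unfolding P_def M_mod_def fm_power_def by (intro fm_prod_module Zp_cring S_mod_module p0)
  note sel = M_star_mod_sel[of p \<rho>, folded M_def]
  have v: "v \<in> carrier M" unfolding v_def M_def by (rule jump_vector_closed[OF p0])
  have N: "submodule N (Zp p) M" unfolding N_def by (rule cyclic_span_submodule[OF v])
  have c: "Zp_of_int p l \<in> carrier (Zp p)" for l by (rule Zp_of_int_closed[OF p0])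
  have z: "\<zero>\<^bsub>Zp p\<^esub> \<in> carrier (Zp p)" by (rule Zp_zero_closed[OF p0])
  interpret N: abelian_subgroup N M by (rule submodule_abelian_subgroup[OF N])
  have I: "I \<subseteq> shift_gaps_star \<rho>" and \<beta>: "i \<in> I \<Longrightarrow> \<beta> i \<ge> 1" for i
    using J by (auto simp: ext_jump_sets_def)
  \<comment> \<open>The witness is v / p. A coordinate with \<beta>(i) > k still has \<beta>(i) - 1
    \<ge> k, so it is divisible by p^k and goes into \<open>h\<close>; the others lie deep enough in
    the filtration and form \<open>g\<close>.\<close>
  define x where "x = (\<lambda>i\<in>shift_gaps_star \<rho>. if i \<in> I then Zp_of_int p (int p ^ (\<beta> i - 1)) else \<zero>\<^bsub>Zp p\<^esub>)"
  define g where "g = (\<lambda>i\<in>shift_gaps_star \<rho>. if i \<in> I \<and> \<beta> i \<le> k then Zp_of_int p (int p ^ (\<beta> i - 1)) else \<zero>\<^bsub>Zp p\<^esub>)"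
  define h where "h = (\<lambda>i\<in>shift_gaps_star \<rho>. if i \<in> I \<and> \<not> \<beta> i \<le> k then Zp_of_int p (int p ^ (\<beta> i - 1 - k)) else \<zero>\<^bsub>Zp p\<^esub>)"
  have cl: "x \<in> carrier M" "g \<in> carrier M" "h \<in> carrier M"
    by (auto simp: sel x_def g_def h_def c z)
  have gf: "g \<in> filt M j"
    unfolding sel
  proof (rule PiE_I)
    fix i assume i: "i \<in> shift_gaps_star \<rho>"
    have "g i (Suc l) = 0" if l: "(\<rho> ^^ l) i < j" for l
    proof (cases "i \<in> I \<and> \<beta> i \<le> k")
      case True
      then have "(\<rho> ^^ l) i < (\<rho> ^^ (\<beta> i - 1)) i" using l I\<beta> by fastforce
      then have "Suc l \<le> \<beta> i - 1"
        using shift_pow_mono[OF \<rho> shift_gaps_star_ge1[OF i], of "\<beta> i - 1" l] by (meson Suc_leI leD leI)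
      then show ?thesis using i True le_imp_power_dvd[of "Suc l" "\<beta> i - 1" "int p"]
        by (auto simp: g_def Zp_of_int_def)
    qed (use i in \<open>auto simp: g_def Zp_simps\<close>)
    moreover have "g i \<in> carrier (Zp p)" using i c z by (simp add: g_def)
    ultimately show "g i \<in> filt (S_mod p \<rho> i) j"
      using S_filt_iff[OF p0 \<rho> shift_gaps_star_ge1[OF i]] by blast
  qed (simp add: g_def)
  have fsub: "filt M j \<subseteq> carrier M"
    unfolding sel using S_filt_iff[OF p0 \<rho> shift_gaps_star_ge1] by (intro PiE_mono) auto
  have xgh: "x = g \<oplus>\<^bsub>M\<^esub> Zp_of_int p (int p ^ k) \<odot>\<^bsub>M\<^esub> h"
  proof (rule M_star_ext[of _ p \<rho>])
    fix i assume i: "i \<in> shift_gaps_star \<rho>"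
    show "x i = (g \<oplus>\<^bsub>M\<^esub> Zp_of_int p (int p ^ k) \<odot>\<^bsub>M\<^esub> h) i"
    proof (cases "i \<in> I \<and> \<not> \<beta> i \<le> k")
      case True
      then have "int p ^ k * int p ^ (\<beta> i - 1 - k) = int p ^ (\<beta> i - 1)" by (simp flip: power_add)
      then show ?thesis using True i c by (simp add: sel x_def g_def h_def Zp_of_int_mult)
    next
      case False
      then show ?thesis using i c by (auto simp: sel x_def g_def h_def)
    qed
  qed (use cl(1) M.a_closed[OF cl(2) smult_closed[OF c cl(3)]] in \<open>simp_all add: M_def\<close>)
  have xN: "x \<notin> N"
  proof
    assume "x \<in> N"
    then obtain d where d: "x = d \<odot>\<^bsub>M\<^esub> v" unfolding N_def cyclic_span_def by auto
    obtain i where i: "i \<in> I" using I0 by auto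
    then have ii: "i \<in> shift_gaps_star \<rho>" using I by auto
    have "x i (\<beta> i) = 0"
      unfolding d using i ii by (simp add: sel v_def jump_vector_def Zp_simps Zp_of_int_def mod_simps)
    then have "int p ^ \<beta> i dvd int p ^ (\<beta> i - 1)"
      using i ii by (auto simp: x_def Zp_of_int_def)
    then have "p ^ \<beta> i dvd p ^ (\<beta> i - 1)" by (metis of_nat_dvd_iff of_nat_power)
    then have "\<beta> i \<le> \<beta> i - 1" using p by (rule power_dvd_imp_le)
    then show False using \<beta>[OF i] by simp
  qed
  have px: "Zp_of_int p (int p ^ 1) \<odot>\<^bsub>M\<^esub> x = v"
  proof -
    have "int p * int p ^ (\<beta> i - Suc 0) = int p ^ \<beta> i" if "i \<in> I" for i
      using \<beta>[OF that] by (simp flip: power_Suc)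
    then show ?thesis
      using c by (auto simp: sel x_def v_def jump_vector_def Zp_of_int_mult fun_eq_iff)
  qed
  have vN: "v \<in> N" unfolding N_def cyclic_span_def using smult_one[OF v, symmetric] R.one_closed by blast
  have zP: "\<zero>\<^bsub>P\<^esub> \<in> filt P j"
    unfolding P_def fm_power_M_mod_sel using S_filt_iff[OF p0 \<rho>] z
    by (auto simp: shift_gaps_def Zp_simps)
  have "torsion_profile p (P \<oplus>\<^sub>f fm_quotient M N) k j"
    unfolding torsion_profile_def
  proof (intro bexI conjI)
    show "(\<zero>\<^bsub>P\<^esub>, N +>\<^bsub>M\<^esub> x) \<noteq> \<zero>\<^bsub>P \<oplus>\<^sub>f fm_quotient M N\<^esub>"
      unfolding fm_sum_quotient_sel using coset_eq_self_iff[OF N cl(1)] xN by simp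
    show "Zp_of_int p (int p ^ 1) \<odot>\<^bsub>P \<oplus>\<^sub>f fm_quotient M N\<^esub> (\<zero>\<^bsub>P\<^esub>, N +>\<^bsub>M\<^esub> x) = \<zero>\<^bsub>P \<oplus>\<^sub>f fm_quotient M N\<^esub>"
      unfolding fm_sum_quotient_sel quotient_smult[OF N c cl(1)] px
      using P.smult_r_null[OF c] coset_eq_self_iff[OF N v] vN by simp
    show "(\<zero>\<^bsub>P\<^esub>, N +>\<^bsub>M\<^esub> x) = (\<zero>\<^bsub>P\<^esub>, N +>\<^bsub>M\<^esub> g) \<oplus>\<^bsub>P \<oplus>\<^sub>f fm_quotient M N\<^esub>
        (Zp_of_int p (int p ^ k) \<odot>\<^bsub>P \<oplus>\<^sub>f fm_quotient M N\<^esub> (\<zero>\<^bsub>P\<^esub>, N +>\<^bsub>M\<^esub> h))"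
      unfolding fm_sum_quotient_sel quotient_smult[OF N c cl(3)]
        N.a_rcos_sum[OF cl(2) smult_closed[OF c cl(3)]] xgh[symmetric]
      using P.smult_r_null[OF c] by simp
    show "(\<zero>\<^bsub>P\<^esub>, N +>\<^bsub>M\<^esub> g) \<in> filt (P \<oplus>\<^sub>f fm_quotient M N) j"
      unfolding fm_sum_quotient_sel quotient_filt[OF N fsub] using gf zP by simp
  qed (use cl in \<open>simp_all add: fm_sum_quotient_sel A_RCOSETS_def', blast+\<close>)
  then show ?thesis by (simp add: P_def M_def N_def v_def)
qed

text \<open>Since \<beta> decreases and \<open>w\<close> increases on \<open>I\<close>, the profile
  is a staircase with a corner at each (\<beta>(i), w i): for bound \<beta>(i) the threshold is
  exactly \<open>w i\<close>, for bound \<beta>(i) - 1 it is larger. The other jump set must have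
  the same corner, and equal \<beta> and equal \<open>w\<close> give equal \<open>i\<close> because
  iterates of \<rho> are injective.\<close>

lemma jump_set_determined_aux:
  assumes \<rho>: "shift \<rho>" and J: "(I, \<beta>) \<in> ext_jump_sets \<rho>" "(I', \<beta>') \<in> ext_jump_sets \<rho>"
    and eq: "\<And>k j. j \<ge> 1 \<Longrightarrow> (\<forall>i\<in>I. \<beta> i \<le> k \<longrightarrow> j \<le> (\<rho> ^^ (\<beta> i - 1)) i) \<longleftrightarrow>
      (\<forall>i\<in>I'. \<beta>' i \<le> k \<longrightarrow> j \<le> (\<rho> ^^ (\<beta>' i - 1)) i)"
    and i: "i \<in> I"
  shows "i \<in> I' \<and> \<beta>' i = \<beta> i"
proof -
  define w where "w i = (\<rho> ^^ (\<beta> i - 1)) i" for i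
  have ge1: "i \<ge> 1" if "i \<in> I \<or> i \<in> I'" for i
    using J that shift_gaps_star_ge1 by (auto simp: ext_jump_sets_def)
  have \<beta>: "i \<in> I \<Longrightarrow> \<beta> i \<ge> 1" for i using J by (auto simp: ext_jump_sets_def)
  have anti: "\<beta> y < \<beta> x" if "x \<in> I" "y \<in> I" "x < y" for x y
    using J(1) that by (auto simp: ext_jump_sets_def monotone_on_def)
  have mono: "w x < w y" if "x \<in> I" "y \<in> I" "x < y" for x y
  proof -
    have "(\<rho> ^^ \<beta> x) x < (\<rho> ^^ \<beta> y) y"
      using J(1) that by (auto simp: ext_jump_sets_def strict_mono_on_def)
    moreover have "(\<rho> ^^ \<beta> z) z = \<rho> (w z)" if "z \<in> I" for z
      using \<beta>[OF that] funpow_simps_right unfolding w_def by (cases "\<beta> z") auto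
    ultimately show ?thesis
      using that shift_less_iff[OF \<rho>] shift_pow_ge1[OF \<rho>] ge1 unfolding w_def by metis
  qed
  have w1: "w i \<ge> 1" unfolding w_def using shift_pow_ge1[OF \<rho>] ge1 i by simp
  have "\<forall>x\<in>I. \<beta> x \<le> \<beta> i \<longrightarrow> w i \<le> w x"
    using anti mono i by (metis leD less_imp_le linorder_neqE_nat order_refl)
  then have A: "\<forall>x\<in>I'. \<beta>' x \<le> \<beta> i \<longrightarrow> w i \<le> (\<rho> ^^ (\<beta>' x - 1)) x"
    using eq[OF w1, of "\<beta> i"] unfolding w_def by blast
  have s1: "1 \<le> Suc (w i)" by simp
  have "\<not> (\<forall>x\<in>I. \<beta> x \<le> \<beta> i \<longrightarrow> Suc (w i) \<le> w x)" using i by force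
  then have "\<not> (\<forall>x\<in>I'. \<beta>' x \<le> \<beta> i \<longrightarrow> Suc (w i) \<le> (\<rho> ^^ (\<beta>' x - 1)) x)"
    using eq[OF s1, of "\<beta> i"] unfolding w_def by blast
  then obtain x where x: "x \<in> I'" "\<beta>' x \<le> \<beta> i" "(\<rho> ^^ (\<beta>' x - 1)) x = w i"
    using A by force
  have "\<forall>x\<in>I. \<beta> x \<le> \<beta> i - 1 \<longrightarrow> Suc (w i) \<le> w x"
    using anti mono i \<beta>[OF i]
    by (metis Suc_diff_1 Suc_leI leD le_imp_less_Suc linorder_neqE_nat less_le_trans zero_less_one less_asym)
  then have "\<forall>x\<in>I'. \<beta>' x \<le> \<beta> i - 1 \<longrightarrow> Suc (w i) \<le> (\<rho> ^^ (\<beta>' x - 1)) x"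
    using eq[OF s1, of "\<beta> i - 1"] unfolding w_def by blast
  then have bx: "\<beta>' x = \<beta> i" using x by fastforce
  then have "x = i"
    using x(3) shift_pow_inj[OF \<rho> ge1 ge1] x(1) i unfolding w_def by simp
  then show ?thesis using x bx by simp
qed

lemma jump_set_determined:
  assumes p: "p > 1" and \<rho>: "shift \<rho>"
    and J: "J \<in> ext_jump_sets \<rho>" "J' \<in> ext_jump_sets \<rho>"
    and iso: "fm_iso (Zp p) (jump_target p \<rho> m J) (jump_target p \<rho> m J')"
  shows "J = J'"
proof -
  obtain I \<beta> I' \<beta>' where JJ: "J = (I, \<beta>)" "J' = (I', \<beta>')" by fastforce
  note J = J[unfolded JJ] and iso = iso[unfolded JJ]
  have prof: "torsion_profile p (jump_target p \<rho> m (I, \<beta>)) k j \<longleftrightarrow>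
      torsion_profile p (jump_target p \<rho> m (I', \<beta>')) k j" if "j \<ge> 1" for k j
    using torsion_profile_iso[OF _ iso that] torsion_profile_iso[OF _ fm_iso_sym[OF iso] that] p by auto
  have eq: "(I \<noteq> {} \<and> (\<forall>i\<in>I. \<beta> i \<le> k \<longrightarrow> j \<le> (\<rho> ^^ (\<beta> i - 1)) i)) \<longleftrightarrow>
      (I' \<noteq> {} \<and> (\<forall>i\<in>I'. \<beta>' i \<le> k \<longrightarrow> j \<le> (\<rho> ^^ (\<beta>' i - 1)) i))" if "j \<ge> 1" for k j
    using prof[OF that, of k] torsion_profile_jump_targetD[OF p \<rho> J(1) that]
      torsion_profile_jump_targetD[OF p \<rho> J(2) that] torsion_profile_jump_targetI[OF p \<rho> J(1) that]
      torsion_profile_jump_targetI[OF p \<rho> J(2) that] by blast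
  have "\<forall>i\<in>I. \<beta> i \<ge> 1" "\<forall>i\<in>I'. \<beta>' i \<ge> 1"
    using J by (auto simp: ext_jump_sets_def)
  then have pos: "\<forall>i\<in>I. \<not> \<beta> i \<le> 0" "\<forall>i\<in>I'. \<not> \<beta>' i \<le> 0" by auto
  have ext: "\<beta> \<in> extensional I" "\<beta>' \<in> extensional I'"
    using J by (auto simp: ext_jump_sets_def PiE_iff)
  \<comment> \<open>At k = 0 the condition on the elements is vacuous, as all \<beta> are positive;
    the profile then only tells whether there is torsion.\<close>
  have "I = {} \<longleftrightarrow> I' = {}"
    using eq[OF order_refl, of 0] pos by blast
  then have eq': "(\<forall>i\<in>I. \<beta> i \<le> k \<longrightarrow> j \<le> (\<rho> ^^ (\<beta> i - 1)) i) \<longleftrightarrow>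
      (\<forall>i\<in>I'. \<beta>' i \<le> k \<longrightarrow> j \<le> (\<rho> ^^ (\<beta>' i - 1)) i)" if "j \<ge> 1" for k j
    using eq[OF that, of k] by auto
  note A = jump_set_determined_aux[OF \<rho> J eq'] and B = jump_set_determined_aux[OF \<rho> J(2,1) eq'[symmetric]]
  have "I = I'" using A B by blast
  moreover have "\<beta> = \<beta>'"
    using ext A unfolding \<open>I = I'\<close> by (intro extensionalityI[of _ I']) auto
  ultimately show ?thesis using JJ by simp
qed

lemma fm_iso_trans:
  fixes L :: "('a, 'x, 'l) filtered_module_scheme" and M :: "('a, 'y, 'm) filtered_module_scheme"
    and N :: "('a, 'z, 'n) filtered_module_scheme"
  assumes "fm_iso R L M" "fm_iso R M N"
  shows "fm_iso R L N"
proof -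
  obtain a b where ab: "a \<in> fm_hom R L M" "b \<in> fm_hom R M L"
    "\<forall>x\<in>carrier L. b (a x) = x" "\<forall>y\<in>carrier M. a (b y) = y"
    using assms(1) unfolding fm_iso_def by blast
  obtain c d where cd: "c \<in> fm_hom R M N" "d \<in> fm_hom R N M"
    "\<forall>x\<in>carrier M. d (c x) = x" "\<forall>y\<in>carrier N. c (d y) = y"
    using assms(2) unfolding fm_iso_def by blast
  have "c \<circ> a \<in> fm_hom R L N" "b \<circ> d \<in> fm_hom R N L"
    using ab cd unfolding fm_hom_def by (auto simp: Pi_iff image_subset_iff)
  moreover have "\<forall>x\<in>carrier L. (b \<circ> d) ((c \<circ> a) x) = x" "\<forall>y\<in>carrier N. (c \<circ> a) ((b \<circ> d) y) = y"
    using ab cd by (auto simp: fm_hom_def Pi_iff)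
  ultimately show ?thesis using assms unfolding fm_iso_def by blast
qed

section \<open>Local fields\<close>

context nonarchimedean_abs
begin

lemma absv_0 [simp]: "absv 0 = 0" by (simp add: absv_eq_0_iff)

lemma absv_pos: "x \<noteq> 0 \<Longrightarrow> absv x > 0"
  using absv_nonneg[of x] absv_eq_0_iff[of x] by simp

lemma absv_1 [simp]: "absv 1 = 1"
  using absv_mult[of 1 1] absv_eq_0_iff[of 1] by simp

lemma absv_minus [simp]: "absv (- x) = absv x"
proof -
  have "(absv (- 1))\<^sup>2 = 1" using absv_mult[of "-1" "-1"] by (simp add: power2_eq_square)
  then have "absv (- 1) = 1" using absv_nonneg[of "-1"] by (simp add: power2_eq_1_iff)
  then show ?thesis using absv_mult[of "-1" x] by simp
qed

lemma absv_minus_commute: "absv (x - y) = absv (y - x)"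
  using absv_minus[of "x - y"] by simp

lemma absv_power: "absv (x ^ n) = absv x ^ n"
  by (induction n) (auto simp: absv_mult)

lemma absv_inverse: "absv (inverse x) = inverse (absv x)"
proof (cases "x = 0")
  case False
  then have "absv x * absv (inverse x) = 1" using absv_mult[of x "inverse x"] by simp
  then show ?thesis by (metis inverse_unique)
qed simp

lemma absv_divide: "absv (x / y) = absv x / absv y"
  by (simp add: divide_inverse absv_mult absv_inverse)

lemma absv_powi: "absv (x powi n) = absv x powi n"
  by (simp add: power_int_def absv_power absv_inverse)

lemma absv_add_le: "absv x \<le> c \<Longrightarrow> absv y \<le> c \<Longrightarrow> absv (x + y) \<le> c"
  using absv_ultrametric[of x y] by simp

lemma absv_diff_le: "absv x \<le> c \<Longrightarrow> absv y \<le> c \<Longrightarrow> absv (x - y) \<le> c"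
  using absv_add_le[of x c "- y"] by simp

lemma absv_add_less: "absv x < c \<Longrightarrow> absv y < c \<Longrightarrow> absv (x + y) < c"
  using absv_ultrametric[of x y] by simp

lemma absv_diff_less: "absv x < c \<Longrightarrow> absv y < c \<Longrightarrow> absv (x - y) < c"
  using absv_add_less[of x c "- y"] by simp

lemma absv_add_eq:
  assumes "absv x < absv y"
  shows "absv (x + y) = absv y"
proof -
  have "absv y \<le> max (absv (x + y)) (absv x)"
    using absv_ultrametric[of "x + y" "- x"] by simp
  then show ?thesis using assms absv_ultrametric[of x y] by linarith
qed

lemma absv_of_nat_le: "absv (of_nat n) \<le> 1"
  by (induction n) (auto intro: absv_add_le)

lemma absv_sum_le: "(\<And>i. i \<in> A \<Longrightarrow> absv (f i) \<le> c) \<Longrightarrow> 0 \<le> c \<Longrightarrow> absv (sum f A) \<le> c"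
  by (induction A rule: infinite_finite_induct) (auto intro: absv_add_le)

sublocale absv_metric: Metric_space UNIV "\<lambda>x y. absv (x - y)"
proof
  fix x y z :: 'a
  show "absv (x - z) \<le> absv (x - y) + absv (y - z)"
    using absv_ultrametric[of "x - y" "y - z"] absv_nonneg[of "x - y"] absv_nonneg[of "y - z"]
    by (simp add: max_def split: if_splits)
qed (auto simp: absv_eq_0_iff absv_nonneg absv_minus_commute)

lemma limitin_absv_iff:
  "limitin (absv_topology absv) f l sequentially \<longleftrightarrow> (\<lambda>n. absv (f n - l)) \<longlonglongrightarrow> 0"
  unfolding absv_topology_def absv_metric.limitin_metric
  using absv_nonneg by (simp add: tendsto_iff dist_real_def)

section \<open>The residue field as the set of open unit balls\<close>

definition residue :: "'a \<Rightarrow> 'a set" where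
  "residue x = {y. absv (y - x) < 1}"

lemma residue_eq_iff: "residue x = residue y \<longleftrightarrow> absv (x - y) < 1"
proof
  assume "absv (x - y) < 1"
  then have "absv (z - x) < 1 \<longleftrightarrow> absv (z - y) < 1" for z
    using absv_add_less[of "z - x" 1 "x - y"] absv_diff_less[of "z - y" 1 "x - y"] by auto
  then show "residue x = residue y" by (simp add: residue_def)
next
  assume "residue x = residue y"
  moreover have "x \<in> residue x" by (simp add: residue_def)
  ultimately show "absv (x - y) < 1" by (simp add: residue_def)
qed

lemma coset_max_ideal: "max_ideal absv +>\<^bsub>integer_ring absv\<^esub> x = residue x"
  unfolding a_r_coset_def' residue_def max_ideal_def integer_ring_def
  by (auto intro: exI[of _ "_ - x"])

lemma residue_field_sel:
  "carrier (residue_field absv) = residue ` {x. absv x \<le> 1}"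
  "\<zero>\<^bsub>residue_field absv\<^esub> = residue 0"
  "\<one>\<^bsub>residue_field absv\<^esub> = residue 1"
  "residue x \<oplus>\<^bsub>residue_field absv\<^esub> residue y = residue (x + y)"
proof -
  show "carrier (residue_field absv) = residue ` {x. absv x \<le> 1}"
    unfolding residue_field_def FactRing_def A_RCOSETS_def' coset_max_ideal
    by (auto simp: integer_ring_def)
  show "\<zero>\<^bsub>residue_field absv\<^esub> = residue 0"
    by (simp add: residue_field_def FactRing_def residue_def max_ideal_def)
  show "\<one>\<^bsub>residue_field absv\<^esub> = residue 1"
    by (simp add: residue_field_def FactRing_def coset_max_ideal) (simp add: integer_ring_def)
  have "residue x <+>\<^bsub>integer_ring absv\<^esub> residue y = residue (x + y)"
  proof
    show "residue x <+>\<^bsub>integer_ring absv\<^esub> residue y \<subseteq> residue (x + y)"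
    proof
      fix z assume "z \<in> residue x <+>\<^bsub>integer_ring absv\<^esub> residue y"
      then obtain a b where "absv (a - x) < 1" "absv (b - y) < 1" "z = a + b"
        by (auto simp: set_add_def' residue_def integer_ring_def)
      then show "z \<in> residue (x + y)"
        using absv_add_less[of "a - x" 1 "b - y"] by (simp add: residue_def algebra_simps)
    qed
    show "residue (x + y) \<subseteq> residue x <+>\<^bsub>integer_ring absv\<^esub> residue y"
    proof
      fix z assume "z \<in> residue (x + y)"
      then have "z - y \<in> residue x" "y \<in> residue y" "z = (z - y) + y"
        by (simp_all add: residue_def algebra_simps)
      then show "z \<in> residue x <+>\<^bsub>integer_ring absv\<^esub> residue y"
        unfolding set_add_def' integer_ring_def by force
    qed
  qed
  then show "residue x \<oplus>\<^bsub>residue_field absv\<^esub> residue y = residue (x + y)"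
    by (simp add: residue_field_def FactRing_def)
qed

lemma add_pow_residue_one: "[n] \<cdot>\<^bsub>residue_field absv\<^esub> \<one>\<^bsub>residue_field absv\<^esub> = residue (of_nat n)"
proof (induction n)
  case 0
  then show ?case by (simp add: add_pow_def nat_pow_def residue_field_sel)
next
  case (Suc n)
  then show ?case by (simp add: add_pow_def nat_pow_def residue_field_sel add.commute)
qed

lemma residue_characteristic_eq:
  "residue_characteristic absv = (LEAST n. 0 < n \<and> absv (of_nat n) < 1)"
  unfolding residue_characteristic_def add_pow_residue_one by (simp add: residue_field_sel residue_eq_iff)

section \<open>Uniformizers, the valuation and powers of the maximal ideal\<close>

lemma uniformizer_iff:
  assumes "absv \<pi> < 1" "\<forall>x. absv x < 1 \<longrightarrow> absv x \<le> absv \<pi>" "\<pi> \<noteq> 0"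
  shows "uniformizer absv \<tau> \<longleftrightarrow> absv \<tau> = absv \<pi>"
proof
  assume "uniformizer absv \<tau>"
  then have eq: "{x. absv x < 1} = {a * \<tau> | a. absv a \<le> 1}" and \<tau>: "absv \<tau> \<le> 1"
    by (auto simp: uniformizer_def max_ideal_def cgenideal_def integer_ring_def)
  have "\<tau> = 1 * \<tau>" by simp
  then have "\<tau> \<in> {x. absv x < 1}" unfolding eq by (metis (mono_tags, lifting) absv_1 mem_Collect_eq order_refl)
  then have le: "absv \<tau> \<le> absv \<pi>" using assms by simp
  have "\<pi> \<in> {x. absv x < 1}" using assms by simp
  then obtain a where "\<pi> = a * \<tau>" "absv a \<le> 1" unfolding eq by blast
  then have "absv \<pi> \<le> absv \<tau>" using absv_nonneg mult_right_mono[of "absv a" 1 "absv \<tau>"] by (simp add: absv_mult)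
  with le show "absv \<tau> = absv \<pi>" by simp
next
  assume eq: "absv \<tau> = absv \<pi>"
  have nz: "\<tau> \<noteq> 0" "absv \<tau> > 0" using eq assms(3) absv_pos[of \<pi>] by auto
  have "absv x < 1 \<longleftrightarrow> (\<exists>a. x = a * \<tau> \<and> absv a \<le> 1)" for x
  proof
    assume "absv x < 1"
    then have "absv (x / \<tau>) \<le> 1" using assms(2)[rule_format, of x] eq nz by (simp add: absv_divide)
    then show "\<exists>a. x = a * \<tau> \<and> absv a \<le> 1" using nz by (intro exI[of _ "x / \<tau>"]) simp
  next
    assume "\<exists>a. x = a * \<tau> \<and> absv a \<le> 1"
    then obtain a where a: "x = a * \<tau>" "absv a \<le> 1" by blast
    then have "absv x \<le> 1 * absv \<tau>"
      unfolding a(1) absv_mult using absv_nonneg by (intro mult_right_mono) auto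
    then show "absv x < 1" using eq assms(1) by simp
  qed
  then have "{x. absv x < 1} = {a * \<tau> | a. absv a \<le> 1}" by blast
  moreover have "absv \<tau> \<le> 1" using eq assms(1) by simp
  ultimately show "uniformizer absv \<tau>"
    by (simp add: uniformizer_def max_ideal_def cgenideal_def integer_ring_def)
qed

lemma normalized_valuation_absv:
  assumes \<pi>: "absv \<pi> < 1" "\<forall>x. absv x < 1 \<longrightarrow> absv x \<le> absv \<pi>" "\<pi> \<noteq> 0"
    and x: "absv x = absv \<pi> powi n"
  shows "normalized_valuation absv x = n"
proof -
  have pos: "absv \<pi> > 0" using \<pi> absv_pos by auto
  have "(\<exists>\<tau>. uniformizer absv \<tau> \<and> absv x = absv \<tau> powi m) \<longleftrightarrow> m = n" for m
  proof
    assume "\<exists>\<tau>. uniformizer absv \<tau> \<and> absv x = absv \<tau> powi m"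
    then have "absv \<pi> powi m = absv \<pi> powi n" using x uniformizer_iff[OF \<pi>] by auto
    then show "m = n"
      using \<pi>(1) pos power_int_strict_decreasing[of m n "absv \<pi>"] power_int_strict_decreasing[of n m "absv \<pi>"]
      by (metis linorder_neqE less_irrefl)
  qed (use x uniformizer_iff[OF \<pi>] in blast)
  then show ?thesis unfolding normalized_valuation_def by simp
qed

text \<open>Sums of products stay small by the ultrametric inequality; conversely \<open>x\<close>
  is the single product of \<open>x / \<pi>\<close> and \<open>\<pi>\<close>.\<close>

lemma max_ideal_power:
  assumes \<pi>: "absv \<pi> < 1" "\<forall>x. absv x < 1 \<longrightarrow> absv x \<le> absv \<pi>" "\<pi> \<noteq> 0"
  shows "max_ideal absv [^]\<^bsub>ideals_set (integer_ring absv)\<^esub> i = {x. absv x \<le> absv \<pi> ^ i}"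
proof (induction i)
  case 0
  then show ?case by (simp add: nat_pow_def ideals_set_def integer_ring_def)
next
  case (Suc i)
  have pos: "absv \<pi> > 0" using \<pi> absv_pos by auto
  have "max_ideal absv [^]\<^bsub>ideals_set (integer_ring absv)\<^esub> Suc i =
      ideal_prod (integer_ring absv) {x. absv x \<le> absv \<pi> ^ i} (max_ideal absv)"
    using Suc by (simp add: nat_pow_def ideals_set_def)
  also have "\<dots> = {x. absv x \<le> absv \<pi> ^ Suc i}"
  proof
    show "ideal_prod (integer_ring absv) {x. absv x \<le> absv \<pi> ^ i} (max_ideal absv) \<subseteq> {x. absv x \<le> absv \<pi> ^ Suc i}"
    proof
      fix x assume "x \<in> ideal_prod (integer_ring absv) {x. absv x \<le> absv \<pi> ^ i} (max_ideal absv)"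
      then show "x \<in> {x. absv x \<le> absv \<pi> ^ Suc i}"
      proof induction
        case (prod a b)
        then have "absv a * absv b \<le> absv \<pi> ^ i * absv \<pi>"
          using \<pi>(2) absv_nonneg by (intro mult_mono) (auto simp: max_ideal_def)
        then show ?case by (simp add: absv_mult integer_ring_def mult.commute)
      next
        case (sum a b)
        then show ?case by (auto simp: integer_ring_def intro: absv_add_le)
      qed
    qed
    show "{x. absv x \<le> absv \<pi> ^ Suc i} \<subseteq> ideal_prod (integer_ring absv) {x. absv x \<le> absv \<pi> ^ i} (max_ideal absv)"
    proof
      fix x assume "x \<in> {x. absv x \<le> absv \<pi> ^ Suc i}"
      then have "x / \<pi> \<in> {x. absv x \<le> absv \<pi> ^ i}" "\<pi> \<in> max_ideal absv"
        using pos \<pi> by (simp_all add: absv_divide divide_le_eq mult.commute max_ideal_def)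
      from ideal_prod.prod[OF this, of "integer_ring absv"]
      show "x \<in> ideal_prod (integer_ring absv) {x. absv x \<le> absv \<pi> ^ i} (max_ideal absv)"
        using \<pi>(3) by (simp add: integer_ring_def)
    qed
  qed
  finally show ?case .
qed

lemma higher_units_eq:
  assumes \<pi>: "absv \<pi> < 1" "\<forall>x. absv x < 1 \<longrightarrow> absv x \<le> absv \<pi>" "\<pi> \<noteq> 0"
  shows "higher_units absv i = {x. absv (x - 1) \<le> absv \<pi> ^ i}"
  unfolding higher_units_def max_ideal_power[OF \<pi>]
  by (auto intro: exI[of _ "_ - 1"])

end

section \<open>Consequences of local compactness\<close>

context local_field
begin

text \<open>For a trivial absolute value every open ball of radius 1 is a singleton, and the
  topology is discrete.\<close>

lemma exists_small: "\<exists>x. x \<noteq> 0 \<and> absv x < 1"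
proof (rule ccontr)
  assume "\<nexists>x. x \<noteq> 0 \<and> absv x < 1"
  then have "absv_metric.mball x 1 = {x}" for x
    by (auto simp: absv_metric.mball_def) (metis absv_metric.commute right_minus_eq)
  then have "openin (absv_topology absv) {x}" for x
    using absv_metric.openin_mball[of x 1] unfolding absv_topology_def by simp
  then have "discrete_topology UNIV = absv_topology absv"
    unfolding discrete_topology_unique by (simp add: absv_topology_def)
  then show False using non_discrete by simp
qed

text \<open>Multiplication by a small nonzero \<open>a\<close> moves all integers into a compact
  neighbourhood of 0, and dividing the limit found there by \<open>a\<close> moves it back.\<close>

lemma integers_sequentially_compact:
  assumes "\<And>n::nat. absv (\<sigma> n) \<le> 1"
  shows "\<exists>l r. strict_mono r \<and> (\<lambda>n. absv (\<sigma> (r n) - l)) \<longlonglongrightarrow> 0"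
proof -
  have zero_in: "0 \<in> topspace (absv_topology absv)" by (simp add: absv_topology_def)
  obtain U K where UK: "openin (absv_topology absv) U" "compactin (absv_topology absv) K" "0 \<in> U" "U \<subseteq> K"
    using locally_compact zero_in unfolding locally_compact_space_def by meson
  obtain r where r: "r > 0" "absv_metric.mball 0 r \<subseteq> U"
    using UK(1,3) unfolding absv_topology_def absv_metric.openin_mtopology by auto
  obtain x where x: "x \<noteq> 0" "absv x < 1" using exists_small by blast
  obtain k where k: "absv x ^ k < r" using real_arch_pow_inv[OF r(1) x(2)] by blast
  define a where "a = x ^ k"
  have a: "a \<noteq> 0" "absv a < r" "absv a > 0" using x k absv_pos unfolding a_def by (auto simp: absv_power)
  have "a * \<sigma> n \<in> K" for n
  proof -
    have "absv (a * \<sigma> n) \<le> absv a * 1"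
      unfolding absv_mult using assms absv_nonneg by (intro mult_left_mono) auto
    then have "a * \<sigma> n \<in> absv_metric.mball 0 r" using a by (simp add: absv_metric.mball_def)
    then show ?thesis using r UK by blast
  qed
  then have "range (\<lambda>n. a * \<sigma> n) \<subseteq> K" by blast
  then obtain l r where lr: "strict_mono r" "limitin (absv_topology absv) ((\<lambda>n. a * \<sigma> n) \<circ> r) l sequentially"
    using UK(2) unfolding absv_topology_def absv_metric.compactin_sequentially by blast
  have "(\<lambda>n. absv (a * \<sigma> (r n) - l) / absv a) \<longlonglongrightarrow> 0 / absv a"
    using lr(2) a unfolding limitin_absv_iff by (intro tendsto_divide) auto
  moreover have "absv (a * \<sigma> (r n) - l) / absv a = absv (\<sigma> (r n) - l / a)" for n
    using a by (simp add: absv_divide[symmetric] diff_divide_distrib)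
  ultimately show ?thesis using lr(1) by auto
qed

text \<open>The supremum of the absolute values below 1 is approached by a sequence with a
  convergent subsequence. Once its terms are closer to the limit than their own size, the
  ultrametric inequality makes their absolute values constant, so the supremum is attained by an
  element of absolute value below 1.\<close>

lemma exists_uniformizer:
  "\<exists>\<pi>. \<pi> \<noteq> 0 \<and> absv \<pi> < 1 \<and> (\<forall>x. absv x < 1 \<longrightarrow> absv x \<le> absv \<pi>)"
proof -
  define V where "V = absv ` {x. absv x < 1}"
  define s where "s = Sup V"
  have bdd: "bdd_above V" unfolding V_def by (auto intro!: bdd_aboveI[of _ 1])
  obtain x0 where x0: "x0 \<noteq> 0" "absv x0 < 1" using exists_small by blast
  have upper: "absv x \<le> s" if "absv x < 1" for x
    unfolding s_def using that bdd by (intro cSup_upper) (auto simp: V_def)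
  have s0: "s > 0" using upper[OF x0(2)] absv_pos[OF x0(1)] by simp
  have "\<exists>x. absv x < 1 \<and> absv x > s - 1 / real (Suc n)" for n
  proof -
    have "\<exists>y\<in>V. s - 1 / real (Suc n) < y"
      unfolding s_def using bdd x0 by (subst less_cSup_iff[symmetric]) (auto simp: V_def)
    then show ?thesis by (auto simp: V_def)
  qed
  then obtain \<sigma> where \<sigma>: "\<And>n. absv (\<sigma> n) < 1" "\<And>n. absv (\<sigma> n) > s - 1 / real (Suc n)"
    by metis
  have lim: "(\<lambda>n. absv (\<sigma> n)) \<longlonglongrightarrow> s"
  proof (rule tendsto_sandwich[of "\<lambda>n. s - 1 / real (Suc n)" _ _ "\<lambda>n. s"])
    show "(\<lambda>n. s - 1 / real (Suc n)) \<longlonglongrightarrow> s"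
      using tendsto_diff[OF tendsto_const lim_inverse_n', of s] LIMSEQ_Suc by fastforce
    show "eventually (\<lambda>n. s - 1 / real (Suc n) \<le> absv (\<sigma> n)) sequentially"
      using less_imp_le[OF \<sigma>(2)] by (intro always_eventually allI) blast
  qed (use \<sigma> upper in auto)
  obtain l r where lr: "strict_mono r" "(\<lambda>n. absv (\<sigma> (r n) - l)) \<longlonglongrightarrow> 0"
    using integers_sequentially_compact[of \<sigma>] \<sigma>(1) less_imp_le by blast
  have lim': "(\<lambda>n. absv (\<sigma> (r n))) \<longlonglongrightarrow> s"
    using LIMSEQ_subseq_LIMSEQ[OF lim lr(1)] by (simp add: o_def)
  have "eventually (\<lambda>n. absv (\<sigma> (r n) - l) < s / 2) sequentially"
    using order_tendstoD(2)[OF lr(2), of "s / 2"] s0 by simp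
  moreover have "eventually (\<lambda>n. s / 2 < absv (\<sigma> (r n))) sequentially"
    using order_tendstoD(1)[OF lim', of "s / 2"] s0 by simp
  ultimately have ev: "eventually (\<lambda>n. absv (\<sigma> (r n)) = absv l) sequentially"
  proof eventually_elim
    case (elim n)
    then show ?case
      using absv_add_eq[of "l - \<sigma> (r n)" "\<sigma> (r n)"] absv_minus_commute[of l] by simp
  qed
  have "(\<lambda>n. absv l) \<longlonglongrightarrow> s" using lim' tendsto_cong[OF ev] by simp
  then have "absv l = s" by (simp add: LIMSEQ_const_iff)
  moreover obtain n where "absv (\<sigma> (r n)) = absv l" using ev eventually_sequentially by auto
  ultimately show ?thesis using upper \<sigma>(1)[of "r n"] s0 by (intro exI[of _ l]) auto
qed

text \<open>The integer is the floor of the logarithm of |x| to base |\<pi>|. The remaining factor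
  has absolute value in the half-open interval from |\<pi>| to 1, where maximality of |\<pi>| leaves
  only 1.\<close>

lemma absv_eq_powi:
  assumes \<pi>: "absv \<pi> < 1" "\<forall>x. absv x < 1 \<longrightarrow> absv x \<le> absv \<pi>" "\<pi> \<noteq> 0" and x: "x \<noteq> 0"
  shows "\<exists>n::int. absv x = absv \<pi> powi n"
proof -
  have r: "0 < absv \<pi>" "absv x > 0" using \<pi> x absv_pos by auto
  define t where "t = ln (absv x) / ln (absv \<pi>)"
  define n where "n = \<lfloor>t\<rfloor>"
  have lnr: "ln (absv \<pi>) < 0" using r \<pi> by simp
  have "absv x = absv \<pi> powr t" using r lnr by (simp add: t_def powr_def)
  moreover have "real_of_int n \<le> t" "t < real_of_int (n + 1)" unfolding n_def by linarith+
  ultimately have le: "absv x \<le> absv \<pi> powi n" "absv \<pi> powi (n + 1) < absv x"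
    using r \<pi> powr_mono'[of "real_of_int n" t "absv \<pi>"] powr_less_mono'[of "absv \<pi>" t "real_of_int (n + 1)"]
      powr_real_of_int'[of "absv \<pi>" n] powr_real_of_int'[of "absv \<pi>" "n + 1"] by auto
  define y where "y = x / \<pi> powi n"
  have pn: "absv \<pi> powi n > 0" using r by simp
  have "absv y \<le> 1" using le pn by (simp add: y_def absv_divide absv_powi)
  moreover have "absv \<pi> < absv y"
    using le r pn by (simp add: y_def absv_divide absv_powi power_int_add pos_less_divide_eq mult.commute)
  ultimately have "absv y = 1" using \<pi>(2)[rule_format, of y] by force
  then have "absv x = absv \<pi> powi n" using pn by (simp add: y_def absv_divide absv_powi)
  then show ?thesis by blast
qed

text \<open>A convergent subsequence supplies the limit; the ultrametric inequality bounds the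
  distance to \<open>s n\<close> by the size of the first omitted step.\<close>

lemma integers_complete:
  assumes r: "0 \<le> r" "r < 1" and s: "\<And>n. absv (s n) \<le> 1" "\<And>n. absv (s (Suc n) - s n) \<le> r ^ n"
  shows "\<exists>L. \<forall>n. absv (L - s n) \<le> r ^ n"
proof -
  obtain l q where lq: "strict_mono q" "(\<lambda>n. absv (s (q n) - l)) \<longlonglongrightarrow> 0"
    using integers_sequentially_compact[of s] s(1) by blast
  have diff: "absv (s (m + k) - s m) \<le> r ^ m" for m k
  proof (induction k)
    case (Suc k)
    have "absv (s (Suc (m + k)) - s (m + k)) \<le> r ^ m"
      using s(2)[of "m + k"] power_decreasing[of m "m + k" r] r by simp
    then show ?case using absv_add_le[OF Suc, of "s (Suc (m + k)) - s (m + k)"] by simp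
  qed (use r in simp)
  have "absv (l - s n) \<le> r ^ n" for n
  proof (rule LIMSEQ_le_const)
    show "(\<lambda>m. absv (s (q m) - l) + r ^ n) \<longlonglongrightarrow> r ^ n"
      using tendsto_add[OF lq(2) tendsto_const, of "r ^ n"] by simp
    show "\<exists>N. \<forall>m\<ge>N. absv (l - s n) \<le> absv (s (q m) - l) + r ^ n"
    proof (intro exI allI impI)
      fix m assume "n \<le> m"
      then have "q m \<ge> n" using seq_suble[OF lq(1), of m] by simp
      then have "absv (s (q m) - s n) \<le> r ^ n" using diff[of n "q m - n"] by simp
      moreover have "absv (l - s n) \<le> max (absv (l - s (q m))) (absv (s (q m) - s n))"
        using absv_ultrametric[of "l - s (q m)" "s (q m) - s n"] by simp
      ultimately show "absv (l - s n) \<le> absv (s (q m) - l) + r ^ n"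
        using absv_nonneg[of "s (q m) - l"] absv_minus_commute[of l "s (q m)"] r zero_le_power[of r n] by linarith
    qed
  qed
  then show ?thesis by blast
qed

text \<open>Two terms of a convergent subsequence of the natural numbers differ by less than 1, so
  some positive integer is small. The least such integer is prime because integers not divisible by
  it have absolute value 1.\<close>

lemma residue_characteristic_props:
  defines "p \<equiv> residue_characteristic absv"
  shows "Factorial_Ring.prime p" "absv (of_nat p) < 1"
proof -
  have "\<exists>n>0. absv (of_nat n) < 1"
  proof -
    obtain l q where lq: "strict_mono q" "(\<lambda>n. absv (of_nat (q n) - l)) \<longlonglongrightarrow> 0"
      using integers_sequentially_compact[of of_nat] absv_of_nat_le by blast
    obtain N where N: "\<And>n. n \<ge> N \<Longrightarrow> absv (of_nat (q n) - l) < 1"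
      using order_tendstoD(2)[OF lq(2), of 1] by (auto simp: eventually_sequentially)
    have lt: "q N < q (Suc N)" using lq(1) by (simp add: strict_mono_def)
    have "absv (of_nat (q (Suc N)) - of_nat (q N)) < 1"
      using absv_diff_less[OF N[of "Suc N"] N[of N]] by simp
    then have "absv (of_nat (q (Suc N) - q N)) < 1" using lt by (simp add: of_nat_diff)
    then show ?thesis using lt by (intro exI[of _ "q (Suc N) - q N"]) simp
  qed
  then have p: "p > 0" "absv (of_nat p) < 1"
    unfolding p_def residue_characteristic_eq by (metis (mono_tags, lifting) LeastI_ex)+
  have min: "p \<le> n" if "n > 0" "absv (of_nat n) < 1" for n
    unfolding p_def residue_characteristic_eq using that by (intro Least_le) simp
  show "absv (of_nat p) < 1" by (rule p)
  show "Factorial_Ring.prime p"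
  proof (rule prime_natI)
    show "p \<ge> 2" using p by (cases "p = 1") auto
    fix a b assume ab: "p dvd a * b"
    show "p dvd a \<or> p dvd b"
    proof (rule ccontr)
      assume n: "\<not> (p dvd a \<or> p dvd b)"
      \<comment> \<open>The remainder modulo \<open>p\<close> is positive and below
        \<open>p\<close>, so by minimality its absolute value is 1; the multiple of \<open>p\<close>
        is smaller and does not disturb it.\<close>
      have red: "absv (of_nat c) = 1" if c: "\<not> p dvd c" for c
      proof -
        have "absv (of_nat (c mod p)) = 1"
          using min[of "c mod p"] absv_of_nat_le[of "c mod p"] c p(1)
          by (metis dvd_eq_mod_eq_0 leD less_le mod_less_divisor neq0_conv)
        moreover have "absv (of_nat (p * (c div p))) < absv (of_nat (c mod p))"
          using calculation p(2) absv_of_nat_le[of "c div p"] absv_nonneg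
          by (simp add: absv_mult mult_le_one) (metis (no_types, lifting) absv_nonneg le_less_trans mult_left_le)
        moreover have "of_nat c = (of_nat (p * (c div p)) + of_nat (c mod p) :: 'a)"
          by (metis mult_div_mod_eq of_nat_add)
        ultimately show ?thesis using absv_add_eq by metis
      qed
      obtain c where "a * b = p * c" using ab by blast
      then have "absv (of_nat a) * absv (of_nat b) = absv (of_nat p) * absv (of_nat c)"
        by (metis absv_mult of_nat_mult)
      then have "1 = absv (of_nat p) * absv (of_nat c)" using red n by simp
      then show False using p(2) absv_of_nat_le[of c] absv_nonneg
        by (metis less_irrefl mult_left_le order.strict_trans1)
    qed
  qed
qed

end

section \<open>The filtration of the principal units\<close>

text \<open>The middle binomial coefficients are divisible by \<open>p\<close>; \<open>h\<close>
  collects their quotients. If |y| < 1, the factor \<open>1 + y * h\<close> is a unit, so only the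
  sizes of \<open>p * y\<close> and \<open>y ^ p\<close> matter.\<close>

lemma (in nonarchimedean_abs) power_prime_expansion:
  assumes p_prime: "Factorial_Ring.prime p" and "absv y \<le> 1"
  shows "\<exists>h. absv h \<le> 1 \<and> (1 + y) ^ p = 1 + of_nat p * y * (1 + y * h) + y ^ p"
proof -
  have p2: "p \<ge> 2" using p_prime prime_ge_2_nat by blast
  define h where "h = (\<Sum>k\<in>{2..<p}. of_nat ((p choose k) div p) * y ^ (k - 2))"
  have "absv (of_nat c * y ^ k) \<le> 1" for c k
    using absv_of_nat_le[of c] assms(2) absv_nonneg by (simp add: absv_mult absv_power mult_le_one power_le_one)
  then have "absv h \<le> 1" unfolding h_def by (intro absv_sum_le) auto
  moreover have "(1 + y) ^ p = 1 + of_nat p * y * (1 + y * h) + y ^ p"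
  proof -
    have "(1 + y) ^ p = (\<Sum>k\<le>p. of_nat (p choose k) * y ^ k)"
      using binomial_ring[of y 1 p] by (simp add: add.commute)
    also have "{..p} = {0, 1, p} \<union> {2..<p}" using p2 by auto
    also have "(\<Sum>k\<in>{0, 1, p} \<union> {2..<p}. of_nat (p choose k) * y ^ k) =
        (\<Sum>k\<in>{0, 1, p}. of_nat (p choose k) * y ^ k) + (\<Sum>k\<in>{2..<p}. of_nat (p choose k) * y ^ k)"
      using p2 by (intro sum.union_disjoint) auto
    also have "(\<Sum>k\<in>{0, 1, p}. of_nat (p choose k) * y ^ k) = 1 + of_nat p * y + y ^ p"
      using p2 by simp
    also have "(\<Sum>k\<in>{2..<p}. of_nat (p choose k) * y ^ k) = of_nat p * y * (y * h)"
      unfolding h_def sum_distrib_left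
    proof (rule sum.cong[OF refl])
      fix k assume k: "k \<in> {2..<p}"
      then have "p dvd (p choose k)" using p_prime by (intro dvd_choose_prime) auto
      then have "(of_nat (p choose k) :: 'a) = of_nat p * of_nat ((p choose k) div p)"
        by (metis dvd_mult_div_cancel of_nat_mult)
      moreover have "y ^ k = y * (y * y ^ (k - 2))"
        using k by (metis atLeastLessThan_iff le_add_diff_inverse power_add power2_eq_square mult.assoc)
      ultimately show "of_nat (p choose k) * y ^ k = of_nat p * y * (y * (of_nat ((p choose k) div p) * y ^ (k - 2)))"
        by (simp add: mult_ac)
    qed
    finally show ?thesis by (simp add: algebra_simps)
  qed
  ultimately show ?thesis by blast
qed

text \<open>Fixes a uniformizer, the number \<open>e\<close> with |p| = |\<pi>|^e and a nontrivial
  root of unity, and retains of local compactness only a discrete value group, completeness with a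
  geometric rate and a finite residue field.\<close>

locale unit_filtration = nonarchimedean_abs absv for absv :: "'a::field \<Rightarrow> real" +
  fixes \<pi> :: 'a and p e f :: nat and \<zeta> :: 'a
  assumes pi_nonzero: "\<pi> \<noteq> 0" and pi_less: "absv \<pi> < 1"
    and pi_max: "\<forall>x. absv x < 1 \<longrightarrow> absv x \<le> absv \<pi>"
    and value_group: "x \<noteq> 0 \<Longrightarrow> \<exists>n::int. absv x = absv \<pi> powi n"
    and complete: "\<lbrakk>\<And>n. absv (s n) \<le> 1; \<And>n. absv (s (Suc n) - s n) \<le> absv \<pi> ^ n\<rbrakk>
      \<Longrightarrow> \<exists>L. \<forall>n. absv (L - s n) \<le> absv \<pi> ^ n"
    and p_prime: "Factorial_Ring.prime p" and e_pos: "e \<ge> 1"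
    and absv_p: "absv (of_nat p) = absv \<pi> ^ e"
    and card_residue: "card (residue ` {x. absv x \<le> 1}) = p ^ f"
    and zeta_power: "\<zeta> ^ p = 1" and zeta_neq: "\<zeta> \<noteq> 1"
begin

abbreviation r where "r \<equiv> absv \<pi>"

lemma p2: "p \<ge> 2" using p_prime prime_ge_2_nat by blast

lemma p_pos: "p > 0" using p2 by simp

lemma r_pos: "r > 0" using pi_nonzero by (rule absv_pos)

lemma r_pow_mono: "i \<le> j \<Longrightarrow> r ^ j \<le> r ^ i"
  using r_pos pi_less by (intro power_decreasing) auto

lemma r_pow_less: "i < j \<Longrightarrow> r ^ j < r ^ i"
  using r_pos pi_less by (intro power_strict_decreasing) auto

lemma r_pow_eq_iff: "r ^ i = r ^ j \<longleftrightarrow> i = j"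
  using r_pow_less[of i j] r_pow_less[of j i] by (metis less_irrefl linorder_neqE_nat)

text \<open>At \<open>i = 0\<close> this is the whole ring of integers rather than a group, which
  explains the hypotheses \<open>i \<ge> 1\<close> below.\<close>

definition U :: "nat \<Rightarrow> 'a set" where
  "U i = {x. absv (x - 1) \<le> r ^ i}"

lemma U_antimono: "i \<le> j \<Longrightarrow> x \<in> U j \<Longrightarrow> x \<in> U i"
  using r_pow_mono[of i j] by (auto simp: U_def)

lemma U_absv: assumes "x \<in> U i" "i \<ge> 1" shows "absv x = 1"
proof -
  have "absv (x - 1) < absv 1"
    using assms r_pow_less[of 0 i] by (simp add: U_def)
  from absv_add_eq[OF this] show ?thesis by simp
qed

lemma U_nonzero: "x \<in> U i \<Longrightarrow> i \<ge> 1 \<Longrightarrow> x \<noteq> 0"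
  using U_absv by fastforce

lemma U_one [simp]: "1 \<in> U i"
  using r_pos by (simp add: U_def)

lemma U_divide_iff:
  assumes "y \<in> U i" "i \<ge> 1"
  shows "x / y \<in> U n \<longleftrightarrow> absv (x - y) \<le> r ^ n"
proof -
  have "x / y - 1 = (x - y) / y" using U_nonzero[OF assms] by (simp add: field_simps)
  then show ?thesis using U_absv[OF assms] by (simp add: U_def absv_divide)
qed

lemma U_mult: "x \<in> U i \<Longrightarrow> y \<in> U i \<Longrightarrow> i \<ge> 1 \<Longrightarrow> x * y \<in> U i"
proof -
  assume h: "x \<in> U i" "y \<in> U i" "i \<ge> 1"
  have eq: "x * y - 1 = x * (y - 1) + (x - 1)" by (simp add: algebra_simps)
  show ?thesis
    unfolding U_def mem_Collect_eq eq
    using h U_absv[OF h(1,3)] by (intro absv_add_le) (simp_all add: U_def absv_mult)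
qed

lemma U_inverse: "x \<in> U i \<Longrightarrow> i \<ge> 1 \<Longrightarrow> inverse x \<in> U i"
  using U_divide_iff[of x i 1 i] absv_minus_commute[of 1 x] by (simp add: U_def inverse_eq_divide)

lemma U_divide: "x \<in> U i \<Longrightarrow> y \<in> U i \<Longrightarrow> i \<ge> 1 \<Longrightarrow> x / y \<in> U i"
  using U_mult[of x i "inverse y"] U_inverse by (simp add: divide_inverse)

lemma U_power: "x \<in> U i \<Longrightarrow> i \<ge> 1 \<Longrightarrow> x ^ n \<in> U i"
  by (induction n) (auto intro: U_mult)

lemma U_prod: "(\<And>b. b \<in> B \<Longrightarrow> g b \<in> U i) \<Longrightarrow> i \<ge> 1 \<Longrightarrow> prod g B \<in> U i"
  by (induction B rule: infinite_finite_induct) (auto intro: U_mult)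

lemma U_mult_cancel:
  assumes "x \<in> U i" "i \<ge> 1"
  shows "x * y \<in> U i \<longleftrightarrow> y \<in> U i"
proof
  assume "x * y \<in> U i"
  from U_divide[OF this assms(1,2)] show "y \<in> U i" using U_nonzero[OF assms] by simp
qed (use assms U_mult in auto)

lemma U_eq_1: "(\<And>i. x \<in> U i) \<Longrightarrow> x = 1"
proof (rule ccontr)
  assume h: "\<And>i. x \<in> U i" and "x \<noteq> 1"
  then have "absv (x - 1) > 0" by (simp add: absv_pos)
  then obtain n where "r ^ n < absv (x - 1)" using real_arch_pow_inv[OF _ pi_less] by blast
  then show False using h[of n] by (simp add: U_def)
qed

lemma U_eq:
  assumes "y \<in> U i" "i \<ge> 1" "\<And>n. x / y \<in> U (Suc n)"
  shows "x = y"
proof -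
  have "x / y \<in> U n" for n using assms(3)[of n] U_antimono[of n "Suc n"] by simp
  then have "x / y = 1" by (rule U_eq_1)
  then show ?thesis using U_nonzero[OF assms(1,2)] by simp
qed

text \<open>Discreteness of the value group: after division by \<pi>^i this is the maximality of
  |\<pi>| below 1.\<close>

lemma absv_less_pow: "absv y < r ^ i \<longleftrightarrow> absv y \<le> r ^ Suc i"
proof
  assume "absv y < r ^ i"
  then have "absv (y / \<pi> ^ i) < 1" using r_pos by (simp add: absv_divide absv_power)
  then have "absv (y / \<pi> ^ i) \<le> r" using pi_max by blast
  then show "absv y \<le> r ^ Suc i" using r_pos by (simp add: absv_divide absv_power divide_le_eq mult.commute)
next
  assume "absv y \<le> r ^ Suc i"
  then show "absv y < r ^ i" using r_pow_less[of i "Suc i"] by simp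
qed

lemma U_Suc_iff: "x \<in> U (Suc i) \<longleftrightarrow> absv (x - 1) < r ^ i"
  by (simp add: U_def absv_less_pow del: power_Suc)

lemma U_complete:
  assumes i: "i \<ge> 1" and s: "\<And>n. s n \<in> U i" "\<And>n. s (Suc n) / s n \<in> U (Suc n)"
  shows "\<exists>L\<in>U i. \<forall>n. L / s n \<in> U (Suc n)"
proof -
  have d: "absv (s (Suc n) - s n) \<le> r ^ Suc n" for n
    using s(2)[of n] U_divide_iff[OF s(1) i] by blast
  have "\<exists>L. \<forall>n. absv (L - s n) \<le> r ^ n"
  proof (rule complete)
    show "absv (s n) \<le> 1" for n using U_absv[OF s(1) i] by simp
    show "absv (s (Suc n) - s n) \<le> r ^ n" for n
      using d[of n] r_pow_mono[of n "Suc n"] by simp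
  qed
  then obtain L where L: "\<And>n. absv (L - s n) \<le> r ^ n" by blast
  \<comment> \<open>The assumed completeness gives only r^n at \<open>n\<close>; going through
    \<open>s (Suc n)\<close> gains one level.\<close>
  have "absv (L - s n) \<le> r ^ Suc n" for n
    using absv_add_le[OF L[of "Suc n"] d[of n]] by simp
  then have *: "L / s n \<in> U (Suc n)" for n using U_divide_iff[OF s(1) i] by blast
  have "L / s i * s i \<in> U i" using *[of i] U_antimono[of i "Suc i"] s(1) i by (intro U_mult) auto
  then have "L \<in> U i" using U_nonzero[OF s(1) i] by simp
  then show ?thesis using * by blast
qed

subsection \<open>The p-power map\<close>

definition i0 :: nat where "i0 = e div (p - 1)"

text \<open>For y = \<zeta> - 1 the expansion of \<open>\<zeta> ^ p = 1\<close> reads y^p = - p y (1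
  + y h). First this forces |y| < 1; then 1 + y h is a unit, and cancelling y leaves |y|^(p - 1) =
  |p|. In particular the division in \<open>i0\<close> is exact.\<close>

lemma zeta_absv: "(p - 1) * i0 = e" "absv (\<zeta> - 1) = r ^ i0" "i0 \<ge> 1"
proof -
  define y where "y = \<zeta> - 1"
  have "absv \<zeta> ^ p = 1" using zeta_power absv_power[of \<zeta> p] by simp
  then have "absv \<zeta> = 1" using absv_nonneg p_pos by (metis power_eq_1_iff abs_of_nonneg real_norm_def less_irrefl)
  then have y1: "absv y \<le> 1" unfolding y_def by (intro absv_diff_le) auto
  obtain h where h: "absv h \<le> 1" "(1 + y) ^ p = 1 + of_nat p * y * (1 + y * h) + y ^ p"
    using power_prime_expansion[OF p_prime y1] by blast
  have "y ^ p = - (of_nat p * y * (1 + y * h))"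
    using h(2) zeta_power by (simp add: y_def add_eq_0_iff)
  then have eq: "absv y ^ p = r ^ e * absv y * absv (1 + y * h)"
    by (metis absv_p absv_minus absv_mult absv_power)
  have yh: "absv (y * h) \<le> absv y"
    using h(1) absv_nonneg[of y] by (simp add: absv_mult mult_left_le)
  have "absv (1 + y * h) \<le> 1" using yh y1 by (intro absv_add_le) auto
  then have "r ^ e * absv y * absv (1 + y * h) \<le> r ^ e * 1 * 1"
    using y1 absv_nonneg r_pos by (intro mult_mono) auto
  also have "\<dots> < 1" using r_pow_less[of 0 e] e_pos by simp
  finally have "absv y ^ p < 1" using eq by simp
  then have ylt: "absv y < 1" using y1 by (metis less_irrefl less_le power_one)
  then have "absv (1 + y * h) = 1"
    using absv_add_eq[of "y * h" 1] yh by (simp add: add.commute)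
  then have eq: "absv y ^ p = r ^ e * absv y" using eq by simp
  have y0: "y \<noteq> 0" "absv y > 0" using zeta_neq absv_pos by (auto simp: y_def)
  have "absv y ^ p = absv y ^ (p - 1) * absv y" using p2 by (simp flip: power_Suc2)
  then have eq: "absv y ^ (p - 1) = r ^ e" using eq y0 by simp
  obtain n :: int where n: "absv y = r powi n" using value_group[OF y0(1)] by blast
  have "n > 0"
  proof (rule ccontr)
    assume "\<not> n > 0"
    then have "r powi n \<ge> r powi 0" using r_pos pi_less by (intro power_int_decreasing) auto
    then show False using n ylt by simp
  qed
  then have n': "absv y = r ^ nat n" using n by (simp add: power_int_def)
  then have "r ^ (nat n * (p - 1)) = r ^ e" using eq by (simp add: power_mult)
  then have ne: "nat n * (p - 1) = e" using r_pow_eq_iff by blast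
  then have "i0 = nat n" using p2 unfolding i0_def by (metis nonzero_mult_div_cancel_right diff_is_0_eq not_less_eq_eq numeral_2_eq_2 One_nat_def)
  then show "(p - 1) * i0 = e" "absv (\<zeta> - 1) = r ^ i0" "i0 \<ge> 1"
    using ne n' \<open>n > 0\<close> by (auto simp: y_def mult.commute)
qed

abbreviation \<rho> where "\<rho> \<equiv> field_shift e p"

lemma rho_shift: "shift \<rho>" using shift_field_shift e_pos p2 by simp

lemma p_mult_eq: "p * i = (p - 1) * i + i"
  using p2 by (simp add: diff_mult_distrib)

text \<open>The branches \<open>p * i\<close> and \<open>i + e\<close> of \<rho> cross where (p - 1)
  i = e, which is \<open>i0\<close>; below it multiplication by \<open>p\<close> is the smaller
  one.\<close>

lemma rho_low: assumes "i \<le> i0" shows "\<rho> i = p * i"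
proof -
  have "(p - 1) * i \<le> e" using mult_le_mono2[OF assms, of "p - 1"] unfolding zeta_absv(1) .
  then show ?thesis unfolding field_shift_def p_mult_eq[of i] by simp
qed

lemma rho_high: assumes "i0 \<le> i" shows "\<rho> i = i + e"
proof -
  have "e \<le> (p - 1) * i" using mult_le_mono2[OF assms, of "p - 1"] unfolding zeta_absv(1) .
  then show ?thesis unfolding field_shift_def p_mult_eq[of i] by simp
qed

lemma rho_low_less: assumes "i < i0" shows "p * i < i + e"
proof -
  have "(p - 1) * i < e" using mult_less_mono2[OF assms, of "p - 1"] p2 unfolding zeta_absv(1) by simp
  then show ?thesis unfolding p_mult_eq[of i] by simp
qed

lemma rho_high_less: assumes "i0 < i" shows "i + e < p * i"
proof -
  have "e < (p - 1) * i" using mult_less_mono2[OF assms, of "p - 1"] p2 unfolding zeta_absv(1) by simp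
  then show ?thesis unfolding p_mult_eq[of i] by simp
qed

lemma rho_Suc_high: "i0 \<le> i \<Longrightarrow> \<rho> (Suc i) = Suc (\<rho> i)"
  by (simp add: rho_high)

lemma rho_gt: "i \<ge> 1 \<Longrightarrow> i < \<rho> i"
  using shift_increasing[OF rho_shift] .

lemma U_expand:
  assumes "x \<in> U i" "i \<ge> 1"
  obtains h where "absv h \<le> 1" "absv (1 + (x - 1) * h) = 1"
    "x ^ p - 1 = of_nat p * (x - 1) * (1 + (x - 1) * h) + (x - 1) ^ p"
proof -
  have y: "absv (x - 1) < 1" using assms r_pow_less[of 0 i] by (simp add: U_def)
  then obtain h where h: "absv h \<le> 1" "(1 + (x - 1)) ^ p = 1 + of_nat p * (x - 1) * (1 + (x - 1) * h) + (x - 1) ^ p"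
    using power_prime_expansion[OF p_prime, of "x - 1"] by auto
  have "absv ((x - 1) * h) < 1"
    using h(1) y absv_nonneg[of "x - 1"] by (metis absv_mult mult_left_le le_less_trans)
  then have "absv (1 + (x - 1) * h) = 1"
    using absv_add_eq[of "(x - 1) * h" 1] by (simp add: add.commute)
  then show ?thesis using h by (intro that[of h]) auto
qed

lemma U_p_power:
  assumes "x \<in> U i" "i \<ge> 1"
  shows "x ^ p \<in> U (\<rho> i)"
proof -
  obtain h where h: "absv h \<le> 1" "absv (1 + (x - 1) * h) = 1"
    "x ^ p - 1 = of_nat p * (x - 1) * (1 + (x - 1) * h) + (x - 1) ^ p"
    using U_expand[OF assms] by blast
  have "absv (of_nat p * (x - 1) * (1 + (x - 1) * h)) = r ^ e * absv (x - 1)"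
    using h(2) by (simp add: absv_mult absv_p)
  also have "\<dots> \<le> r ^ e * r ^ i" using assms r_pos by (simp add: U_def)
  also have "\<dots> \<le> r ^ \<rho> i"
    unfolding power_add[symmetric] by (rule r_pow_mono) (simp add: field_shift_def)
  finally have 1: "absv (of_nat p * (x - 1) * (1 + (x - 1) * h)) \<le> r ^ \<rho> i" .
  have "absv ((x - 1) ^ p) \<le> (r ^ i) ^ p"
    unfolding absv_power using assms absv_nonneg by (intro power_mono) (auto simp: U_def)
  also have "\<dots> \<le> r ^ \<rho> i"
    unfolding power_mult[symmetric] by (rule r_pow_mono) (simp add: field_shift_def mult.commute)
  finally show ?thesis unfolding U_def using h(3) absv_add_le[OF 1] by simp
qed

text \<open>If |x - 1| is exactly r^i, the two terms of the expansion have the sizes r^(i + e) and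
  r^(p i). These differ for i \<noteq> i0, so the larger one survives and x^p - 1 has size exactly
  r^\<rho>(i).\<close>

lemma U_p_power_inj:
  assumes "x \<in> U i" "i \<ge> 1" "i \<noteq> i0" "x ^ p \<in> U (Suc (\<rho> i))"
  shows "x \<in> U (Suc i)"
proof (rule ccontr)
  assume "x \<notin> U (Suc i)"
  then have "\<not> absv (x - 1) < r ^ i" using U_Suc_iff by blast
  then have y: "absv (x - 1) = r ^ i" using assms(1) by (simp add: U_def)
  obtain h where h: "absv h \<le> 1" "absv (1 + (x - 1) * h) = 1"
    "x ^ p - 1 = of_nat p * (x - 1) * (1 + (x - 1) * h) + (x - 1) ^ p"
    using U_expand[OF assms(1,2)] by blast
  have 1: "absv (of_nat p * (x - 1) * (1 + (x - 1) * h)) = r ^ (i + e)"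
    using h(2) y by (simp add: absv_mult absv_p power_add mult.commute)
  have 2: "absv ((x - 1) ^ p) = r ^ (p * i)"
    using y by (simp add: absv_power mult.commute flip: power_mult)
  have "absv (x ^ p - 1) = r ^ \<rho> i"
  proof (cases "i < i0")
    case True
    then show ?thesis unfolding h(3) rho_low[OF less_imp_le[OF True]] 2[symmetric]
      using r_pow_less[OF rho_low_less[OF True]] by (intro absv_add_eq) (simp only: 1 2)
  next
    case False
    then have "i0 < i" using assms(3) by simp
    then show ?thesis unfolding h(3) rho_high[OF less_imp_le[OF \<open>i0 < i\<close>]] 1[symmetric]
      using r_pow_less[OF rho_high_less[OF \<open>i0 < i\<close>]]
      by (subst add.commute, intro absv_add_eq) (simp only: 1 2)
  qed
  then show False using assms(4) by (simp add: U_Suc_iff)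
qed

text \<open>Above \<open>i0\<close> the linear term dominates, so 1 + (z - 1) / p is a p-th root of
  \<open>z\<close> to first order.\<close>

lemma U_p_power_surj_high:
  assumes "z \<in> U (\<rho> i)" "i0 < i"
  shows "\<exists>y\<in>U i. z / y ^ p \<in> U (Suc (\<rho> i))"
proof -
  have i: "i \<ge> 1" using assms by simp
  have rho: "\<rho> i = i + e" using rho_high assms by simp
  have pnz: "(of_nat p :: 'a) \<noteq> 0" using absv_p r_pos absv_0 by (metis power_not_zero less_irrefl)
  define y where "y = 1 + (z - 1) / of_nat p"
  have "absv (z - 1) \<le> r ^ i * r ^ e" using assms(1) rho by (simp add: U_def power_add)
  then have y: "y \<in> U i" using r_pos by (simp add: U_def y_def absv_divide absv_p divide_le_eq)
  obtain h where h: "absv h \<le> 1" "y ^ p - 1 = of_nat p * (y - 1) * (1 + (y - 1) * h) + (y - 1) ^ p"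
    using U_expand[OF y i] by metis
  have pz: "of_nat p * (y - 1) = z - 1" using pnz by (simp add: y_def)
  have eq: "y ^ p - z = (z - 1) * ((y - 1) * h) + (y - 1) ^ p"
    using h(2) unfolding pz by (simp add: algebra_simps)
  have y1: "absv (y - 1) \<le> r ^ i" using y by (simp add: U_def)
  have "absv (z - 1) * (absv (y - 1) * absv h) \<le> r ^ \<rho> i * (r ^ 1 * 1)"
    using assms(1) y1 h(1) absv_nonneg r_pow_mono[OF i] r_pos by (intro mult_mono) (auto simp: U_def)
  then have 1: "absv ((z - 1) * ((y - 1) * h)) \<le> r ^ Suc (\<rho> i)"
    by (simp add: absv_mult mult.commute)
  have "absv ((y - 1) ^ p) \<le> (r ^ i) ^ p"
    unfolding absv_power using y1 absv_nonneg by (intro power_mono) auto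
  also have "\<dots> \<le> r ^ Suc (\<rho> i)"
    unfolding power_mult[symmetric] using rho_high_less[OF assms(2)] rho
    by (intro r_pow_mono) (simp add: mult.commute)
  finally have "absv (y ^ p - z) \<le> r ^ Suc (\<rho> i)" unfolding eq using 1 absv_add_le by blast
  then have "absv (z - y ^ p) \<le> r ^ Suc (\<rho> i)" by (simp only: absv_minus_commute)
  then show ?thesis using U_divide_iff[OF U_power[OF y i] i] y by blast
qed

text \<open>Successive approximation: above \<open>i0\<close> the shift moves in steps of one, so
  each correction factor, taken one level deeper than the last, improves the error by one
  level.\<close>

lemma U_p_root:
  assumes z: "z \<in> U (\<rho> i)" and i: "i0 < i"
  shows "\<exists>y\<in>U i. y ^ p = z"
proof -
  have i1: "i \<ge> 1" using i by simp
  have "\<exists>s. \<forall>n. (s n \<in> U i \<and> z / s n ^ p \<in> U (\<rho> (i + n))) \<and> s (Suc n) / s n \<in> U (i + n)"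
  proof (rule dependent_nat_choice)
    show "\<exists>x. x \<in> U i \<and> z / x ^ p \<in> U (\<rho> (i + 0))" using z by (intro exI[of _ 1]) simp
  next
    fix x n assume x: "x \<in> U i \<and> z / x ^ p \<in> U (\<rho> (i + n))"
    then obtain y where y: "y \<in> U (i + n)" "(z / x ^ p) / y ^ p \<in> U (Suc (\<rho> (i + n)))"
      using U_p_power_surj_high[of "z / x ^ p" "i + n"] i by auto
    have "x * y \<in> U i" using x y U_antimono[of i "i + n"] i1 by (intro U_mult) auto
    moreover have "z / (x * y) ^ p \<in> U (\<rho> (i + Suc n))"
      using y(2) rho_Suc_high[of "i + n"] i by (simp add: power_mult_distrib)
    moreover have "x * y / x \<in> U (i + n)" using y U_nonzero[of x i] x i1 by simp
    ultimately show "\<exists>y. (y \<in> U i \<and> z / y ^ p \<in> U (\<rho> (i + Suc n))) \<and> y / x \<in> U (i + n)" by blast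
  qed
  then obtain s where s: "\<And>n. s n \<in> U i" "\<And>n. z / s n ^ p \<in> U (\<rho> (i + n))" "\<And>n. s (Suc n) / s n \<in> U (i + n)"
    by blast
  have "s (Suc n) / s n \<in> U (Suc n)" for n using s(3) U_antimono[of "Suc n" "i + n"] i1 by simp
  then obtain L where L: "L \<in> U i" "\<And>n. L / s n \<in> U (Suc n)" using U_complete[OF i1, of s] s(1) by blast
  have "L ^ p / z \<in> U (Suc n)" for n
  proof -
    have "Suc n \<le> \<rho> (i + n)" using rho_gt[of "i + n"] i1 by simp
    then have 1: "z / s n ^ p \<in> U (Suc n)" using s(2) U_antimono by blast
    have 2: "L ^ p / s n ^ p \<in> U (Suc n)"
      unfolding power_divide[symmetric] using L(2) by (intro U_power) auto
    have "s n ^ p \<noteq> 0" using U_nonzero[OF s(1) i1] by simp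
    then show ?thesis using U_divide[OF 2 1] by simp
  qed
  moreover have "\<rho> i \<ge> 1" using rho_gt[OF i1] by simp
  ultimately have "L ^ p = z" using U_eq[OF z] by blast
  then show ?thesis using L by blast
qed

section \<open>Roots of unity and the kernel of the p-power map at \<open>i0\<close>\<close>

lemma zeta_power_eq_1: assumes "\<zeta> ^ n = 1" shows "p dvd n"
proof (rule ccontr)
  assume "\<not> p dvd n"
  then have "coprime n p" using p_prime by (metis coprime_commute prime_imp_coprime)
  then obtain a b where "a * n = b * p + 1"
    using bezout_nat[of n p] p_pos by (metis coprime_iff_gcd_eq_1 \<open>\<not> p dvd n\<close> dvd_0_right mult.commute)
  then have "\<zeta> ^ (a * n) = (\<zeta> ^ p) ^ b * \<zeta>" by (simp add: power_mult[symmetric] mult.commute)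
  moreover have "\<zeta> ^ (a * n) = (\<zeta> ^ n) ^ a" by (simp add: power_mult[symmetric] mult.commute)
  ultimately have "\<zeta> = 1" using assms zeta_power by simp
  then show False using zeta_neq by simp
qed

text \<open>The powers of \<zeta> already give \<open>p\<close> distinct roots of X^p - 1.\<close>

lemma root_of_unity:
  assumes "w ^ p = 1"
  shows "\<exists>d<p. w = \<zeta> ^ d"
proof -
  have z0: "\<zeta> \<noteq> 0" using zeta_power p_pos by (metis power_0_left less_irrefl zero_neq_one)
  define P :: "'a poly" where "P = Polynomial.monom 1 p - 1"
  have Pz: "poly P x = 0 \<longleftrightarrow> x ^ p = 1" for x by (simp add: P_def poly_monom)
  have "P \<noteq> 0"
  proof
    assume "P = 0"
    then have "Polynomial.coeff P p = 0" by simp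
    then show False using p_pos by (simp add: P_def)
  qed
  have "Polynomial.degree P \<le> p" unfolding P_def by (intro degree_diff_le) (auto simp: Polynomial.degree_monom_le)
  then have card: "card {x::'a. x ^ p = 1} \<le> p"
    using card_poly_roots_bound[OF \<open>P \<noteq> 0\<close>] unfolding Pz by linarith
  have fin: "finite {x::'a. x ^ p = 1}" using poly_roots_finite[OF \<open>P \<noteq> 0\<close>] unfolding Pz .
  have aux: "d = d'" if "d \<le> d'" "d' < p" "\<zeta> ^ d = \<zeta> ^ d'" for d d'
  proof -
    have "\<zeta> ^ (d' - d) = 1" using that z0 by (simp add: power_diff)
    then have "p dvd d' - d" by (rule zeta_power_eq_1)
    then show ?thesis using that by (metis diff_is_0_eq' dvd_imp_le gr0I less_imp_diff_less linorder_not_less le_antisym diff_is_0_eq)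
  qed
  have "inj_on (\<lambda>d. \<zeta> ^ d) {..<p}"
    by (rule inj_onI) (metis aux lessThan_iff nle_le)
  then have "card ((\<lambda>d. \<zeta> ^ d) ` {..<p}) = p" by (simp add: card_image)
  moreover have "(\<lambda>d. \<zeta> ^ d) ` {..<p} \<subseteq> {x::'a. x ^ p = 1}"
    using zeta_power by auto (metis mult.commute power_mult power_one)
  ultimately have "(\<lambda>d. \<zeta> ^ d) ` {..<p} = {x::'a. x ^ p = 1}" using card_subset_eq[OF fin] card
    by (metis card_mono fin le_antisym)
  then show ?thesis using assms by auto
qed

text \<open>Such an \<open>x ^ p\<close> lies in the range of \<open>U_p_root\<close> and so has a
  second p-th root \<open>y\<close> one level deeper; x / y is then a power of \<zeta>.\<close>

lemma U_p_power_kernel: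
  assumes "x \<in> U i0" "x ^ p \<in> U (Suc (\<rho> i0))"
  shows "\<exists>d<p. x / \<zeta> ^ d \<in> U (Suc i0)"
proof -
  obtain y where y: "y \<in> U (Suc i0)" "y ^ p = x ^ p"
    using U_p_root[of "x ^ p" "Suc i0"] assms(2) rho_Suc_high[of i0] by auto
  have y0: "y \<noteq> 0" using U_nonzero[OF y(1)] by simp
  have x0: "x \<noteq> 0" using U_nonzero[OF assms(1)] zeta_absv(3) by simp
  have "(x / y) ^ p = 1" using x0 by (simp add: power_divide y(2))
  then obtain d where d: "d < p" "x / y = \<zeta> ^ d" using root_of_unity by blast
  have "\<zeta> ^ d \<noteq> 0" unfolding d(2)[symmetric] using x0 y0 by simp
  moreover have "x = \<zeta> ^ d * y" unfolding d(2)[symmetric] using y0 by simp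
  ultimately have "x / \<zeta> ^ d = y" by simp
  then show ?thesis using d y by auto
qed

lemma zeta_U: "\<zeta> \<in> U i0" "\<zeta> \<notin> U (Suc i0)" "\<zeta> \<in> U 1"
proof -
  show "\<zeta> \<in> U i0" by (simp add: U_def zeta_absv(2))
  then show "\<zeta> \<in> U 1" using U_antimono zeta_absv(3) by blast
  show "\<zeta> \<notin> U (Suc i0)" by (simp add: U_Suc_iff zeta_absv(2))
qed

lemma U_p_pow_pow:
  assumes "x \<in> U i" "i \<ge> 1"
  shows "x ^ (p ^ n) \<in> U ((\<rho> ^^ n) i)"
proof (induction n)
  case (Suc n)
  have "x ^ p ^ Suc n = (x ^ p ^ n) ^ p" by (simp add: power_mult[symmetric] mult.commute)
  then show ?case using U_p_power[OF Suc] shift_pow_ge1[OF rho_shift assms(2)] by simp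
qed (use assms in simp)

lemma U_p_pow_Suc:
  assumes "x \<in> U i" "i \<ge> 1"
  shows "x ^ (p ^ n) \<in> U (Suc n)"
  using U_p_pow_pow[OF assms, of n] shift_pow_ge[OF rho_shift assms(2), of n] U_antimono
  by (meson Suc_leI)

subsection \<open>p-adic powers\<close>

abbreviation pw where "pw \<equiv> padic_power absv"

lemma Zp_approx_eq:
  assumes "a \<in> carrier (Zp p)" "int c mod int p ^ n = a n"
  shows "c = nat (a n) + p ^ n * (c div p ^ n)"
proof -
  have "a n = int (c mod p ^ n)" using assms(2) by (simp add: zmod_int)
  then show ?thesis by simp
qed

text \<open>Consecutive exponents \<open>a n\<close> and \<open>a (Suc n)\<close> differ by a
  multiple of p^n, and p^n-th powers lie in \<open>U (Suc n)\<close>; hence the powers converge at a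
  known rate.\<close>

lemma pw_exists:
  assumes "u \<in> U i" "i \<ge> 1" "a \<in> carrier (Zp p)"
  shows "\<exists>L\<in>U i. (\<forall>n. L / u ^ nat (a n) \<in> U (Suc n)) \<and> pw a u = L"
proof -
  have "u ^ nat (a (Suc n)) / u ^ nat (a n) \<in> U (Suc n)" for n
  proof -
    have "int (nat (a (Suc n))) mod int p ^ n = a n"
      using Zp_mod[OF assms(3), of n "Suc n"] Zp_nonneg[OF assms(3)] by simp
    then have "nat (a (Suc n)) = nat (a n) + p ^ n * (nat (a (Suc n)) div p ^ n)"
      using Zp_approx_eq[OF assms(3)] by blast
    then have "u ^ nat (a (Suc n)) / u ^ nat (a n) = (u ^ (p ^ n)) ^ (nat (a (Suc n)) div p ^ n)"
      using U_nonzero[OF assms(1,2)] by (metis nonzero_mult_div_cancel_left power_add power_mult power_not_zero)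
    then show ?thesis using U_p_pow_Suc[OF assms(1,2)] by (auto intro: U_power)
  qed
  then obtain L where L: "L \<in> U i" "\<And>n. L / u ^ nat (a n) \<in> U (Suc n)"
    using U_complete[OF assms(2), of "\<lambda>n. u ^ nat (a n)"] U_power[OF assms(1,2)] by blast
  have "(\<lambda>n. absv (u ^ nat (a n) - L)) \<longlonglongrightarrow> 0"
  proof (rule tendsto_sandwich[of "\<lambda>n. 0" _ _ "\<lambda>n. r ^ Suc n"])
    show "(\<lambda>n. r ^ Suc n) \<longlonglongrightarrow> 0"
      using r_pos pi_less by (intro LIMSEQ_Suc LIMSEQ_power_zero) auto
    have "absv (u ^ nat (a n) - L) \<le> r ^ Suc n" for n
      using L(2)[of n] U_divide_iff[OF U_power[OF assms(1,2)] assms(2)] absv_minus_commute by metis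
    then show "eventually (\<lambda>n. absv (u ^ nat (a n) - L) \<le> r ^ Suc n) sequentially" by simp
  qed (auto simp: absv_nonneg)
  then have lim: "limitin (absv_topology absv) (\<lambda>n. u ^ nat (a n)) L sequentially"
    by (simp add: limitin_absv_iff)
  have "pw a u = L"
    unfolding padic_power_def
  proof (rule the_equality)
    show "limitin (absv_topology absv) (\<lambda>n. u ^ nat (a n)) L sequentially" by (rule lim)
    fix l assume "limitin (absv_topology absv) (\<lambda>n. u ^ nat (a n)) l sequentially"
    from absv_metric.limitin_metric_unique[OF this[unfolded absv_topology_def] lim[unfolded absv_topology_def]]
    show "l = L" by simp
  qed
  then show ?thesis using L by blast
qed

lemma pw_U:
  assumes "u \<in> U i" "i \<ge> 1" "a \<in> carrier (Zp p)"
  shows "pw a u \<in> U i"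
  using pw_exists[OF assms] by blast

lemma pw_approx:
  assumes "u \<in> U 1" "a \<in> carrier (Zp p)" "int c mod int p ^ n = a n"
  shows "pw a u / u ^ c \<in> U (Suc n)"
proof -
  have 1: "pw a u / u ^ nat (a n) \<in> U (Suc n)" using pw_exists[OF assms(1) _ assms(2)] by auto
  have "u ^ c = u ^ nat (a n) * (u ^ (p ^ n)) ^ (c div p ^ n)"
    using Zp_approx_eq[OF assms(2,3)] by (metis power_add power_mult)
  moreover have "(u ^ (p ^ n)) ^ (c div p ^ n) \<in> U (Suc n)"
    using U_p_pow_Suc[OF assms(1)] by (auto intro: U_power)
  ultimately show ?thesis using U_divide[OF 1] by simp
qed

text \<open>A p-adic power is determined by its approximations, and at each level any natural
  exponent with the right residue may be used. The laws of p-adic powers thereby reduce to those of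
  ordinary powers.\<close>

lemma pw_eqI:
  assumes "u \<in> U 1" "a \<in> carrier (Zp p)" "\<And>n. \<exists>c. int c mod int p ^ n = a n \<and> L / u ^ c \<in> U (Suc n)"
  shows "L = pw a u"
proof (rule U_eq)
  show "pw a u \<in> U 1" using pw_U assms by simp
  fix n
  obtain c where c: "int c mod int p ^ n = a n" "L / u ^ c \<in> U (Suc n)" using assms(3) by blast
  have "(L / u ^ c) / (pw a u / u ^ c) \<in> U (Suc n)"
    by (rule U_divide[OF c(2) pw_approx[OF assms(1,2) c(1)]]) simp
  then show "L / pw a u \<in> U (Suc n)" using U_nonzero[OF assms(1)] by simp
qed simp

lemma Zp_nat_approx: "a \<in> carrier (Zp p) \<Longrightarrow> int (nat (a n)) mod int p ^ n = a n"
  by (simp add: Zp_nonneg Zp_self_mod)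

lemma pw_of_nat: "u \<in> U 1 \<Longrightarrow> pw (Zp_of_int p (int k)) u = u ^ k"
  using U_nonzero[of u 1]
  by (intro pw_eqI[symmetric] Zp_of_int_closed p_pos) (auto simp: Zp_of_int_def intro!: exI[of _ k])

lemma pw_add:
  assumes u: "u \<in> U 1" and a: "a \<in> carrier (Zp p)" and b: "b \<in> carrier (Zp p)"
  shows "pw (a \<oplus>\<^bsub>Zp p\<^esub> b) u = pw a u * pw b u"
proof (rule pw_eqI[symmetric, OF u Zp_add_closed[OF p_pos a b]])
  fix n
  have "int (nat (a n) + nat (b n)) mod int p ^ n = (a \<oplus>\<^bsub>Zp p\<^esub> b) n"
    using Zp_nonneg[OF a] Zp_nonneg[OF b] by (simp add: Zp_add)
  moreover have "pw a u * pw b u / u ^ (nat (a n) + nat (b n)) \<in> U (Suc n)"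
    using U_mult[OF pw_approx[OF u a Zp_nat_approx[OF a]] pw_approx[OF u b Zp_nat_approx[OF b]], of n]
    by (simp add: power_add)
  ultimately show "\<exists>c. int c mod int p ^ n = (a \<oplus>\<^bsub>Zp p\<^esub> b) n \<and> pw a u * pw b u / u ^ c \<in> U (Suc n)" by blast
qed

lemma pw_mult_base:
  assumes u: "u \<in> U 1" and v: "v \<in> U 1" and a: "a \<in> carrier (Zp p)"
  shows "pw a (u * v) = pw a u * pw a v"
proof (rule pw_eqI[symmetric, OF _ a])
  show "u * v \<in> U 1" using u v by (intro U_mult) auto
  fix n
  have "pw a u * pw a v / (u * v) ^ nat (a n) \<in> U (Suc n)"
    using U_mult[OF pw_approx[OF u a Zp_nat_approx[OF a]] pw_approx[OF v a Zp_nat_approx[OF a]], of n]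
    by (simp add: power_mult_distrib)
  then show "\<exists>c. int c mod int p ^ n = a n \<and> pw a u * pw a v / (u * v) ^ c \<in> U (Suc n)"
    using Zp_nat_approx[OF a] by blast
qed

lemma pw_mult:
  assumes u: "u \<in> U 1" and a: "a \<in> carrier (Zp p)" and b: "b \<in> carrier (Zp p)"
  shows "pw (a \<otimes>\<^bsub>Zp p\<^esub> b) u = pw a (pw b u)"
proof (rule pw_eqI[symmetric, OF u Zp_mult_closed[OF p_pos a b]])
  fix n
  have "int (nat (a n) * nat (b n)) mod int p ^ n = (a \<otimes>\<^bsub>Zp p\<^esub> b) n"
    using Zp_nonneg[OF a] Zp_nonneg[OF b] by (simp add: Zp_mult)
  moreover have "pw a (pw b u) / u ^ (nat (a n) * nat (b n)) \<in> U (Suc n)"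
  proof -
    have bu: "pw b u \<in> U 1" using pw_U[OF u _ b] by simp
    have 1: "pw a (pw b u) / pw b u ^ nat (a n) \<in> U (Suc n)"
      by (rule pw_approx[OF bu a Zp_nat_approx[OF a]])
    have 2: "(pw b u / u ^ nat (b n)) ^ nat (a n) \<in> U (Suc n)"
      by (intro U_power pw_approx[OF u b Zp_nat_approx[OF b]]) simp
    have "pw b u \<noteq> 0" using U_nonzero[OF bu] by simp
    moreover have "pw a (pw b u) / u ^ (nat (a n) * nat (b n)) =
        (pw a (pw b u) / pw b u ^ nat (a n)) * (pw b u / u ^ nat (b n)) ^ nat (a n)"
      using calculation by (simp add: power_divide power_mult[symmetric] mult.commute)
    ultimately show ?thesis using U_mult[OF 1 2] by simp
  qed
  ultimately show "\<exists>c. int c mod int p ^ n = (a \<otimes>\<^bsub>Zp p\<^esub> b) n \<and> pw a (pw b u) / u ^ c \<in> U (Suc n)" by blast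
qed

lemma pw_one_base: "a \<in> carrier (Zp p) \<Longrightarrow> pw a 1 = 1"
  by (intro pw_eqI[symmetric]) (auto intro: Zp_nat_approx)

lemma pw_prod:
  assumes "a \<in> carrier (Zp p)" "\<And>b. b \<in> B \<Longrightarrow> g b \<in> U 1"
  shows "pw a (prod g B) = (\<Prod>b\<in>B. pw a (g b))"
  using assms(2)
proof (induction B rule: infinite_finite_induct)
  case (insert b B)
  then have "pw a (g b * prod g B) = pw a (g b) * pw a (prod g B)"
    using assms(1) by (intro pw_mult_base U_prod) auto
  then show ?case using insert by simp
qed (auto simp: pw_one_base assms(1))

section \<open>The principal units as a filtered module\<close>

lemma higher_units_U: "higher_units absv i = U i"
  unfolding U_def by (rule higher_units_eq[OF pi_less pi_max pi_nonzero])

lemma principal_units_filtered_module: "filtered_module (Zp p) (principal_units absv)"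
proof -
  interpret Z: cring "Zp p" by (rule Zp_cring[OF p_pos])
  note sel = principal_units_def higher_units_U
  have grp: "abelian_group (principal_units absv)"
  proof (rule abelian_groupI)
    fix x assume "x \<in> carrier (principal_units absv)"
    then have "inverse x \<in> carrier (principal_units absv)" "inverse x \<oplus>\<^bsub>principal_units absv\<^esub> x = \<zero>\<^bsub>principal_units absv\<^esub>"
      using U_inverse U_nonzero by (auto simp: sel)
    then show "\<exists>y\<in>carrier (principal_units absv). y \<oplus>\<^bsub>principal_units absv\<^esub> x = \<zero>\<^bsub>principal_units absv\<^esub>" by blast
  qed (auto simp: sel U_mult mult_ac)
  have one: "\<one>\<^bsub>Zp p\<^esub> = Zp_of_int p (int 1)" by (simp add: Zp_one Zp_of_int_def)
  have mod: "module (Zp p) (principal_units absv)"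
  proof (rule moduleI[OF Z.cring_axioms grp])
    fix x assume "x \<in> carrier (principal_units absv)"
    then show "\<one>\<^bsub>Zp p\<^esub> \<odot>\<^bsub>principal_units absv\<^esub> x = x"
      unfolding one using pw_of_nat[of x 1] by (simp add: sel)
  qed (auto simp: sel pw_U pw_add pw_mult_base pw_mult)
  interpret M: module "Zp p" "principal_units absv" by (rule mod)
  show ?thesis
  proof (intro filtered_module.intro filtered_module_axioms.intro mod)
    show "filt (principal_units absv) 1 = carrier (principal_units absv)" by (simp add: sel)
    show "(\<Inter>i\<in>{1..}. filt (principal_units absv) i) = {\<zero>\<^bsub>principal_units absv\<^esub>}"
    proof -
      have "x = 1" if "\<forall>i\<ge>1. x \<in> U i" for x
        using that U_antimono by (intro U_eq_1) (meson nat_le_linear)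
      then show ?thesis by (auto simp: sel)
    qed
    fix i :: nat assume i: "1 \<le> i"
    have neg: "\<ominus>\<^bsub>principal_units absv\<^esub> x = inverse x" if "x \<in> U 1" for x
      by (rule M.minus_equality) (use that U_inverse U_nonzero in \<open>auto simp: sel\<close>)
    show "submodule (filt (principal_units absv) i) (Zp p) (principal_units absv)"
    proof (rule M.submoduleI)
      fix x assume "x \<in> filt (principal_units absv) i"
      then have "x \<in> U i" "x \<in> U 1" using U_antimono[OF i] by (auto simp: sel)
      then show "\<ominus>\<^bsub>principal_units absv\<^esub> x \<in> filt (principal_units absv) i"
        using neg U_inverse[OF _ i] by (simp add: sel)
    qed (use i U_antimono[OF i] U_mult pw_U in \<open>auto simp: sel\<close>)
    show "filt (principal_units absv) (Suc i) \<subseteq> filt (principal_units absv) i"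
      using U_antimono[of i "Suc i"] by (auto simp: sel)
  qed
qed


subsection \<open>Bases of the graded pieces\<close>

text \<open>The class of \<open>x\<close> in the graded piece U n / U (n + 1), identified with the
  residue field through (x - 1) / \<pi>^n.\<close>

definition lead_residue :: "nat \<Rightarrow> 'a \<Rightarrow> 'a set" where
  "lead_residue n x = residue ((x - 1) / \<pi> ^ n)"

lemma lead_residue_eq_iff:
  assumes "y \<in> U n" "n \<ge> 1"
  shows "lead_residue n x = lead_residue n y \<longleftrightarrow> x / y \<in> U (Suc n)"
proof -
  have "(x - 1) / \<pi> ^ n - (y - 1) / \<pi> ^ n = (x - y) / \<pi> ^ n"
    by (simp add: diff_divide_distrib)
  then have "lead_residue n x = lead_residue n y \<longleftrightarrow> absv (x - y) < r ^ n"
    using r_pos unfolding lead_residue_def residue_eq_iff by (simp add: absv_divide absv_power)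
  then show ?thesis unfolding absv_less_pow U_divide_iff[OF assms] .
qed

lemma card_lead_residue: "card (lead_residue n ` U n) = p ^ f"
proof -
  have "(\<lambda>x. (x - 1) / \<pi> ^ n) ` U n = {x. absv x \<le> 1}"
  proof (intro equalityI subsetI)
    fix y assume "y \<in> {x. absv x \<le> 1}"
    then have "1 + y * \<pi> ^ n \<in> U n" "y = ((1 + y * \<pi> ^ n) - 1) / \<pi> ^ n"
      using r_pos pi_nonzero by (simp_all add: U_def absv_mult absv_power)
    then show "y \<in> (\<lambda>x. (x - 1) / \<pi> ^ n) ` U n" by blast
  qed (use r_pos in \<open>auto simp: U_def absv_divide absv_power\<close>)
  then have "lead_residue n ` U n = residue ` {x. absv x \<le> 1}"
    unfolding lead_residue_def by (metis image_image)
  then show ?thesis using card_residue by simp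
qed

lemma finite_lead_residue: "finite (lead_residue n ` U n)"
  using card_lead_residue[of n] p_pos by (metis card.infinite power_not_zero less_irrefl)

lemma f_pos: "f \<ge> 1"
proof (rule ccontr)
  assume "\<not> f \<ge> 1"
  then have "card (residue ` {x. absv x \<le> 1}) = 1" using card_residue by simp
  then obtain A where "residue ` {x. absv x \<le> 1} = {A}" by (rule card_1_singletonE)
  moreover have "residue 0 \<in> residue ` {x. absv x \<le> 1}" "residue 1 \<in> residue ` {x. absv x \<le> 1}" by auto
  ultimately have "residue 0 = residue 1" by simp
  then show False unfolding residue_eq_iff by simp
qed

lemma U_p_power_Suc: "x \<in> U n \<Longrightarrow> n \<ge> 1 \<Longrightarrow> x ^ p \<in> U (Suc n)"
  using U_p_power[of x n] rho_gt[of n] U_antimono[of "Suc n" "\<rho> n"] by simp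

lemma U_power_mod:
  assumes "x \<in> U n" "n \<ge> 1" "c mod p = d mod p"
  shows "x ^ c / x ^ d \<in> U (Suc n)"
proof -
  have 1: "x ^ c / x ^ (c mod p) \<in> U (Suc n)" for c
  proof -
    have "x ^ c = x ^ (c mod p) * (x ^ p) ^ (c div p)"
      by (metis mod_mult_div_eq power_add power_mult)
    then show ?thesis using U_power[OF U_p_power_Suc[OF assms(1,2)]] U_nonzero[OF assms(1,2)] by simp
  qed
  have "(x ^ c / x ^ (c mod p)) / (x ^ d / x ^ (d mod p)) \<in> U (Suc n)"
    by (rule U_divide[OF 1[of c] 1[of d]]) simp
  then show ?thesis using assms(3) U_nonzero[OF assms(1,2)] by simp
qed

lemma U_prod_power_mod:
  assumes "\<And>b. b \<in> B \<Longrightarrow> u b \<in> U n" "n \<ge> 1" "\<And>b. b \<in> B \<Longrightarrow> c b mod p = d b mod p"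
  shows "(\<Prod>b\<in>B. u b ^ c b) / (\<Prod>b\<in>B. u b ^ d b) \<in> U (Suc n)"
  unfolding prod_dividef[symmetric] using assms by (intro U_prod U_power_mod) auto

text \<open>Linear independence over the field with \<open>p\<close> elements in the graded piece at
  \<open>n\<close>, written multiplicatively with natural exponents.\<close>

definition indep :: "nat \<Rightarrow> nat \<Rightarrow> (nat \<Rightarrow> 'a) \<Rightarrow> bool" where
  "indep k n u \<longleftrightarrow> (\<forall>j<k. u j \<in> U n) \<and>
     (\<forall>c::nat \<Rightarrow> nat. (\<Prod>j<k. u j ^ c j) \<in> U (Suc n) \<longrightarrow> (\<forall>j<k. p dvd c j))"

lemma indepD:
  assumes "indep k n u" "(\<Prod>j<k. u j ^ c j) \<in> U (Suc n)" "j < k"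
  shows "p dvd c j"
  using assms(1)[unfolded indep_def, THEN conjunct2, rule_format, OF assms(2,3)] .

lemma indep_prod_U: "indep k n u \<Longrightarrow> n \<ge> 1 \<Longrightarrow> (\<Prod>j<k. u j ^ c j) \<in> U n"
  unfolding indep_def by (intro U_prod U_power) auto

lemma indep_inj:
  assumes u: "indep k n u" and n: "n \<ge> 1"
  shows "inj_on (\<lambda>c. lead_residue n (\<Prod>j<k. u j ^ c j)) ({..<k} \<rightarrow>\<^sub>E {..<p})"
proof (rule inj_onI)
  fix c d assume c: "c \<in> {..<k} \<rightarrow>\<^sub>E {..<p}" and d: "d \<in> {..<k} \<rightarrow>\<^sub>E {..<p}"
    and eq: "lead_residue n (\<Prod>j<k. u j ^ c j) = lead_residue n (\<Prod>j<k. u j ^ d j)"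
  have cd: "(\<Prod>j<k. u j ^ c j) / (\<Prod>j<k. u j ^ d j) \<in> U (Suc n)"
    using eq lead_residue_eq_iff[OF indep_prod_U[OF u n] n] by blast
  \<comment> \<open>The exponent p - 1 plays the role of -1 modulo \<open>p\<close>, so that the
    quotient of the two products becomes a product with natural exponents.\<close>
  have "(\<Prod>j<k. u j ^ (c j + (p - 1) * d j)) = (\<Prod>j<k. u j ^ c j) * (\<Prod>j<k. u j ^ d j) ^ (p - 1)"
    unfolding power_add prod.distrib
    by (simp add: prod_power_distrib power_mult[symmetric] mult.commute[of "p - Suc 0"])
  also have "\<dots> = (\<Prod>j<k. u j ^ c j) / (\<Prod>j<k. u j ^ d j) * (\<Prod>j<k. u j ^ d j) ^ p"
    using U_nonzero[OF indep_prod_U[OF u n] n, of d] p2 by (simp add: power_eq_if)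
  also have "\<dots> \<in> U (Suc n)"
    using cd U_p_power_Suc[OF indep_prod_U[OF u n] n] by (intro U_mult) auto
  finally have fin: "(\<Prod>j<k. u j ^ (c j + (p - 1) * d j)) \<in> U (Suc n)" .
  have dv: "p dvd c j + (p - 1) * d j" if "j < k" for j
    using indepD[OF u, of "\<lambda>j. c j + (p - 1) * d j"] fin that by simp
  show "c = d"
  proof (rule PiE_ext[OF c d])
    fix j assume "j \<in> {..<k}"
    then have j: "j < k" "c j < p" "d j < p" using c d by auto
    have "int p dvd int (c j + (p - 1) * d j)" using dv[OF j(1)] by (simp only: of_nat_dvd_iff)
    moreover have "int (c j + (p - 1) * d j) = (int (c j) - int (d j)) + int p * int (d j)"
    proof -
      have "c j + (p - 1) * d j + d j = c j + p * d j" using p2 by (cases p) auto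
      then have "int (c j + (p - 1) * d j) + int (d j) = int (c j) + int p * int (d j)"
        by (metis of_nat_add of_nat_mult)
      then show ?thesis by simp
    qed
    ultimately have "int p dvd (int (c j) - int (d j)) + int p * int (d j)" by (simp only:)
    then have "int p dvd int (c j) - int (d j)" by (simp add: dvd_add_left_iff)
    moreover have "\<bar>int (c j) - int (d j)\<bar> < int p" using j by auto
    ultimately show "c j = d j" by (metis dvd_imp_le_int eq_iff_diff_eq_0 leD of_nat_eq_iff abs_of_nat)
  qed
qed

lemma card_indep_image:
  assumes u: "indep k n u" and n: "n \<ge> 1"
  shows "card ((\<lambda>c. lead_residue n (\<Prod>j<k. u j ^ c j)) ` ({..<k} \<rightarrow>\<^sub>E {..<p})) = p ^ k"
  using card_image[OF indep_inj[OF u n]] by (simp add: card_PiE)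

text \<open>The p^f combinations with exponents below \<open>p\<close> have distinct classes and
  therefore exhaust the graded piece.\<close>

lemma indep_span:
  assumes u: "indep f n u" and n: "n \<ge> 1" and x: "x \<in> U n"
  shows "\<exists>c::nat \<Rightarrow> nat. x / (\<Prod>j<f. u j ^ c j) \<in> U (Suc n)"
proof -
  let ?I = "(\<lambda>c. lead_residue n (\<Prod>j<f. u j ^ c j)) ` ({..<f} \<rightarrow>\<^sub>E {..<p})"
  have "?I \<subseteq> lead_residue n ` U n" using indep_prod_U[OF u n] by auto
  then have "?I = lead_residue n ` U n"
    using card_indep_image[OF u n] card_lead_residue finite_lead_residue by (intro card_subset_eq) auto
  then have "lead_residue n x \<in> ?I" using x by simp
  then obtain c where "lead_residue n x = lead_residue n (\<Prod>j<f. u j ^ c j)" by blast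
  then show ?thesis using lead_residue_eq_iff[OF indep_prod_U[OF u n] n] by blast
qed

lemma inverse_mod_p:
  assumes "\<not> p dvd c"
  obtains d where "(c * d) mod p = 1"
proof -
  have "coprime c p" using p_prime assms by (metis coprime_commute prime_imp_coprime)
  then obtain d where "[c * d = Suc 0] (mod p)" using cong_solve_coprime_nat by blast
  then show ?thesis using that[of d] p2 by (simp add: cong_def)
qed

text \<open>In the graded piece the relation says x^c = 1 / P. Raising it to the inverse
  \<open>d\<close> of \<open>c\<close> modulo \<open>p\<close> isolates \<open>x\<close> as P^(-d),
  and -d is written as d (p - 1).\<close>

lemma not_dvd_solve:
  assumes n: "n \<ge> 1" and x: "x \<in> U n" and P: "P \<in> U n" and c: "P * x ^ c \<in> U (Suc n)" and pc: "\<not> p dvd c"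
  obtains d where "x / P ^ (d * (p - 1)) \<in> U (Suc n)"
proof -
  obtain d where d: "(c * d) mod p = 1" using inverse_mod_p[OF pc] by blast
  have nz: "x \<noteq> 0" "P \<noteq> 0" using U_nonzero x P n by auto
  have 1: "P ^ d * x ^ (c * d) \<in> U (Suc n)"
    using U_power[OF c, of d] by (simp add: power_mult_distrib power_mult)
  have 2: "x ^ (c * d) / x ^ 1 \<in> U (Suc n)"
    using d p2 by (intro U_power_mod[OF x n]) simp
  have 3: "(P ^ d) ^ p \<in> U (Suc n)" by (intro U_p_power_Suc U_power P n)
  have "P ^ (d * p) = P ^ (d * (p - 1)) * P ^ d"
    using p2 by (metis power_add diff_mult_distrib2 mult.right_neutral le_add_diff_inverse2 mult_le_mono2 One_nat_def Suc_1 Suc_leD)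
  then have "x / P ^ (d * (p - 1)) = (P ^ d * x ^ (c * d)) / (x ^ (c * d) / x ^ 1) / (P ^ d) ^ p"
    using nz by (simp add: power_mult[symmetric])
  also have "\<dots> \<in> U (Suc n)" by (rule U_divide[OF U_divide[OF 1 2] 3]) simp_all
  finally show ?thesis by (rule that)
qed

text \<open>By counting, some class \<open>x\<close> lies outside the span of fewer than
  \<open>f\<close> vectors. A relation whose exponent at \<open>x\<close> is prime to
  \<open>p\<close> would put it back into that span.\<close>

lemma indep_extend:
  assumes u: "indep k n u" and n: "n \<ge> 1" and k: "k < f"
  shows "\<exists>x. indep (Suc k) n (u(k := x))"
proof -
  let ?I = "(\<lambda>c. lead_residue n (\<Prod>j<k. u j ^ c j)) ` ({..<k} \<rightarrow>\<^sub>E {..<p})"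
  have "card ?I < card (lead_residue n ` U n)"
    unfolding card_indep_image[OF u n] card_lead_residue using k p2 by simp
  then have "\<not> lead_residue n ` U n \<subseteq> ?I"
    using card_mono[of ?I "lead_residue n ` U n"] by (auto simp: finite_PiE)
  then obtain x where x: "x \<in> U n" "lead_residue n x \<notin> ?I" by auto
  have "indep (Suc k) n (u(k := x))"
    unfolding indep_def
  proof (intro conjI allI impI)
    fix j assume "j < Suc k"
    then show "(u(k := x)) j \<in> U n" using x u by (auto simp: indep_def less_Suc_eq)
  next
    fix c :: "nat \<Rightarrow> nat" and j
    assume c: "(\<Prod>j<Suc k. (u(k := x)) j ^ c j) \<in> U (Suc n)" and j: "j < Suc k"
    define P where "P = (\<Prod>j<k. u j ^ c j)"
    have P: "P \<in> U n" unfolding P_def by (rule indep_prod_U[OF u n])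
    have c': "P * x ^ c k \<in> U (Suc n)" using c by (simp add: P_def)
    have pck: "p dvd c k"
    proof (rule ccontr)
      assume "\<not> p dvd c k"
      then obtain d where d: "x / P ^ (d * (p - 1)) \<in> U (Suc n)"
        using not_dvd_solve[OF n x(1) P c'] by blast
      define e where "e = (\<lambda>j\<in>{..<k}. (c j * (d * (p - 1))) mod p)"
      have e: "e \<in> {..<k} \<rightarrow>\<^sub>E {..<p}" using p_pos by (auto simp: e_def)
      have "(\<Prod>j<k. u j ^ (c j * (d * (p - 1)))) / (\<Prod>j<k. u j ^ e j) \<in> U (Suc n)"
        using u by (intro U_prod_power_mod n) (auto simp: indep_def e_def)
      moreover have "(\<Prod>j<k. u j ^ (c j * (d * (p - 1)))) = P ^ (d * (p - 1))"
        unfolding P_def by (simp add: power_mult prod_power_distrib)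
      ultimately have "(x / P ^ (d * (p - 1))) * (P ^ (d * (p - 1)) / (\<Prod>j<k. u j ^ e j)) \<in> U (Suc n)"
        using d by (intro U_mult) auto
      then have "x / (\<Prod>j<k. u j ^ e j) \<in> U (Suc n)" using U_nonzero[OF P n] by simp
      then have "lead_residue n x = lead_residue n (\<Prod>j<k. u j ^ e j)"
        using lead_residue_eq_iff[OF indep_prod_U[OF u n] n] by blast
      then show False using x(2) e by blast
    qed
    then obtain q where "c k = p * q" by blast
    then have "x ^ c k \<in> U (Suc n)" using U_power[OF U_p_power_Suc[OF x(1) n]] by (simp add: power_mult)
    then have "P \<in> U (Suc n)" using c' U_mult_cancel[of "x ^ c k" "Suc n" P] by (simp add: mult.commute)
    then show "p dvd c j" using indepD[OF u] pck j unfolding P_def by (auto simp: less_Suc_eq)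
  qed
  then show ?thesis by blast
qed

text \<open>The first vector is prescribed so that \<zeta> can start a basis at \<open>i0\<close>,
  and so that selected factors of \<zeta> can later become members of a filtered basis.\<close>

lemma indep_exists:
  assumes y: "y \<in> U n" "y \<notin> U (Suc n)" and n: "n \<ge> 1"
  shows "\<exists>u. indep f n u \<and> u 0 = y"
proof -
  have "\<exists>u. indep k n u \<and> u 0 = y" if "1 \<le> k" "k \<le> f" for k
    using that
  proof (induction k rule: dec_induct)
    case base
    have "p dvd c" if "y ^ c \<in> U (Suc n)" for c
    proof (rule ccontr)
      assume "\<not> p dvd c"
      moreover have "1 * y ^ c \<in> U (Suc n)" using that by simp
      ultimately obtain d where "y / 1 ^ (d * (p - 1)) \<in> U (Suc n)"
        using not_dvd_solve[OF n y(1) U_one] by blast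
      then show False using y(2) by simp
    qed
    then show ?case using y(1) by (intro exI[of _ "\<lambda>_. y"]) (simp add: indep_def)
  next
    case (step k)
    then obtain u where u: "indep k n u" "u 0 = y" by auto
    then obtain x where "indep (Suc k) n (u(k := x))" using indep_extend[OF u(1) n] step by auto
    moreover have "(u(k := x)) 0 = y" using u(2) step by simp
    ultimately show ?case by blast
  qed
  then show ?thesis using f_pos by blast
qed

lemma U_proper: "1 + \<pi> ^ n \<in> U n" "1 + \<pi> ^ n \<notin> U (Suc n)"
proof -
  show "1 + \<pi> ^ n \<in> U n" by (simp add: U_def absv_power)
  show "1 + \<pi> ^ n \<notin> U (Suc n)" unfolding U_Suc_iff by (simp add: absv_power)
qed

lemma indep_p_power:
  assumes u: "indep f l u" and l: "l \<ge> 1" "l \<noteq> i0"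
  shows "indep f (\<rho> l) (\<lambda>j. u j ^ p)"
  unfolding indep_def
proof (intro conjI allI impI)
  fix j assume "j < f"
  then show "u j ^ p \<in> U (\<rho> l)" using u l U_p_power by (simp add: indep_def)
next
  fix c :: "nat \<Rightarrow> nat" and j assume c: "(\<Prod>j<f. (u j ^ p) ^ c j) \<in> U (Suc (\<rho> l))" and j: "j < f"
  have "(\<Prod>j<f. (u j ^ p) ^ c j) = (\<Prod>j<f. u j ^ c j) ^ p"
    by (simp add: prod_power_distrib power_mult[symmetric] mult.commute)
  then have "(\<Prod>j<f. u j ^ c j) \<in> U (Suc l)"
    using U_p_power_inj[OF indep_prod_U[OF u l(1)] l] c by simp
  then show "p dvd c j" using indepD[OF u _ j] by blast
qed

subsection \<open>The critical level\<close>

text \<open>The number e* of the shift, as \<open>e_star_eq\<close> shows. Among the levels in the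
  image of \<rho>, it is the one where the p-power map fails to be onto.\<close>

definition es :: nat where "es = \<rho> i0"

lemma es_props: "es = p * i0" "es = i0 + e" "i0 < es" "1 \<le> es"
  using rho_low[of i0] rho_high[of i0] rho_gt[OF zeta_absv(3)] by (auto simp: es_def)

text \<open>The elements of \<open>U es\<close> whose class in the graded piece is a p-th power
  coming from level \<open>i0\<close>.\<close>

definition crit :: "'a set" where
  "crit = {x ^ p * g | x g. x \<in> U i0 \<and> g \<in> U (Suc es)}"

text \<open>The kernel at \<open>i0\<close> consists of the classes of the powers of \<zeta>, so
  after dividing by such a power independence forces the exponents of the remaining basis vectors to
  vanish modulo \<open>p\<close>.\<close>

lemma crit_kernel:
  assumes w: "indep f i0 w" "w 0 = \<zeta>" and y: "(\<Prod>j<f. w j ^ c j) ^ p \<in> U (Suc es)" and j: "0 < j" "j < f"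
  shows "p dvd c j"
proof -
  define P where "P = (\<Prod>j<f. w j ^ c j)"
  have P: "P \<in> U i0" unfolding P_def by (rule indep_prod_U[OF w(1) zeta_absv(3)])
  obtain d where d: "P / \<zeta> ^ d \<in> U (Suc i0)"
    using U_p_power_kernel[OF P] y unfolding P_def es_def by blast
  have z0: "\<zeta> \<noteq> 0" using U_nonzero[OF zeta_U(3)] by simp
  have "P * \<zeta> ^ (d * (p - 1)) = (P / \<zeta> ^ d) * (\<zeta> ^ p) ^ d"
    using z0 p2 by (simp add: power_mult[symmetric] field_simps power_add[symmetric] flip: mult_Suc_right)
  then have "P * \<zeta> ^ (d * (p - 1)) \<in> U (Suc i0)" using d zeta_power by simp
  moreover have "P * \<zeta> ^ (d * (p - 1)) = (\<Prod>j<f. w j ^ (if j = 0 then c j + d * (p - 1) else c j))"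
  proof -
    have "(\<Prod>j<f. w j ^ (if j = 0 then c j + d * (p - 1) else c j)) =
        (\<Prod>j<f. w j ^ c j * (if j = 0 then \<zeta> ^ (d * (p - 1)) else 1))"
      by (intro prod.cong) (auto simp: power_add w(2))
    also have "\<dots> = P * \<zeta> ^ (d * (p - 1))"
      unfolding prod.distrib P_def using f_pos by (simp add: prod.delta)
    finally show ?thesis by simp
  qed
  ultimately have "(\<Prod>j<f. w j ^ (if j = 0 then c j + d * (p - 1) else c j)) \<in> U (Suc i0)" by simp
  then have "p dvd (if j = 0 then c j + d * (p - 1) else c j)"
    by (rule indepD[OF w(1) _ j(2)])
  then show ?thesis using j by simp
qed

lemma zeta_basis: "\<exists>w. indep f i0 w \<and> w 0 = \<zeta>"
  using indep_exists[OF zeta_U(1,2) zeta_absv(3)] .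

text \<open>Otherwise \<open>c\<close> could be inverted modulo \<open>p\<close>, and
  \<open>u\<close> itself would be a p-th power modulo the next level.\<close>

lemma crit_exponent:
  assumes u: "u \<in> U es" "u \<notin> crit" and x: "x \<in> U i0" and c: "u ^ c * x ^ p \<in> U (Suc es)"
  shows "p dvd c"
proof (rule ccontr)
  assume "\<not> p dvd c"
  have xp: "x ^ p \<in> U es" unfolding es_def using U_p_power[OF x zeta_absv(3)] .
  then obtain d where d: "u / (x ^ p) ^ (d * (p - 1)) \<in> U (Suc es)"
    using not_dvd_solve[OF es_props(4) u(1) xp, of c] c \<open>\<not> p dvd c\<close> by (auto simp: mult.commute)
  have "(x ^ p) ^ (d * (p - 1)) \<noteq> 0" using U_nonzero[OF xp es_props(4)] by simp
  then have "u = (x ^ (d * (p - 1))) ^ p * (u / (x ^ p) ^ (d * (p - 1)))"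
    by (simp add: power_mult[symmetric] mult.commute)
  then have "u \<in> crit" unfolding crit_def using d U_power[OF x zeta_absv(3)] by blast
  then show False using u(2) by simp
qed

text \<open>In a basis at \<open>i0\<close> beginning with \<zeta>, the p-th powers of the other f -
  1 vectors are independent and span the image of the p-power map. The vector completing them to a
  basis at \<open>es\<close> lies outside this image.\<close>

lemma crit_exists: "\<exists>u\<in>U es. u \<notin> crit"
proof -
  obtain w where w: "indep f i0 w" "w 0 = \<zeta>" using zeta_basis by blast
  have f1: "Suc (f - 1) = f" using f_pos by simp
  define v where "v j = w (Suc j) ^ p" for j
  have shift: "(\<Prod>j<f. w j ^ c j) = \<zeta> ^ c 0 * (\<Prod>j<f - 1. w (Suc j) ^ c (Suc j))" for c
    using prod.lessThan_Suc_shift[of "\<lambda>j. w j ^ c j" "f - 1"] f1 w(2) by simp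
  have pshift: "(\<Prod>j<f. w j ^ c j) ^ p = (\<Prod>j<f - 1. v j ^ c (Suc j))" for c
    unfolding shift v_def using zeta_power
    by (simp add: power_mult_distrib prod_power_distrib power_mult[symmetric] mult.commute)
      (simp add: power_mult)
  have v: "indep (f - 1) es v"
    unfolding indep_def
  proof (intro conjI allI impI)
    fix j assume "j < f - 1"
    then show "v j \<in> U es" using w U_p_power[OF _ zeta_absv(3)] by (auto simp: v_def es_def indep_def)
  next
    fix c :: "nat \<Rightarrow> nat" and j assume c: "(\<Prod>j<f - 1. v j ^ c j) \<in> U (Suc es)" and j: "j < f - 1"
    \<comment> \<open>At j = 0 truncated subtraction assigns the exponent \<open>c 0\<close> to
      \<zeta>; this is harmless because \<zeta> disappears in the p-th power.\<close>
    then have "(\<Prod>j<f. w j ^ (c (j - 1))) ^ p \<in> U (Suc es)" unfolding pshift by simp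
    from crit_kernel[OF w this, of "Suc j"] j show "p dvd c j" by simp
  qed
  then obtain x where "indep (Suc (f - 1)) es (v(f - 1 := x))"
    using indep_extend[OF v es_props(4)] f_pos by auto
  then have x: "indep f es (v(f - 1 := x))" using f1 by simp
  then have xU: "x \<in> U es" using f_pos by (auto simp: indep_def dest: spec[of _ "f - 1"])
  moreover have "x \<notin> crit"
  proof
    assume "x \<in> crit"
    then obtain y g where y: "y \<in> U i0" "g \<in> U (Suc es)" "x = y ^ p * g" by (auto simp: crit_def)
    obtain c where c: "y / (\<Prod>j<f. w j ^ c j) \<in> U (Suc i0)"
      using indep_span[OF w(1) zeta_absv(3) y(1)] by blast
    define P where "P = (\<Prod>j<f - 1. v j ^ c (Suc j))"
    have P: "P \<in> U es" unfolding P_def by (rule indep_prod_U[OF v es_props(4)])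
    have "(y / (\<Prod>j<f. w j ^ c j)) ^ p \<in> U (\<rho> (Suc i0))" using U_p_power[OF c] by simp
    then have "y ^ p / P \<in> U (Suc es)"
      unfolding power_divide pshift P_def es_def rho_Suc_high[OF order_refl] .
    \<comment> \<open>The factor P^p is trivial at this level and turns 1 / P into P^(p - 1),
      producing a relation with natural exponents and exponent 1 at \<open>x\<close>.\<close>
    then have 1: "y ^ p / P * g * P ^ p \<in> U (Suc es)"
      using y(2) U_p_power_Suc[OF P es_props(4)] by (intro U_mult) auto
    have fm: "f - 1 < f" using f_pos by simp
    have "y ^ p / P * g * P ^ p = P ^ (p - 1) * x"
      using U_nonzero[OF P es_props(4)] p2 y(3) by (simp add: power_eq_if)
    also have "\<dots> = (\<Prod>j<Suc (f - 1). (v(f - 1 := x)) j ^ (if j < f - 1 then c (Suc j) * (p - 1) else 1))"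
      by (simp add: P_def prod_power_distrib power_mult)
    finally have "(\<Prod>j<f. (v(f - 1 := x)) j ^ (if j < f - 1 then c (Suc j) * (p - 1) else 1)) \<in> U (Suc es)"
      using 1 f1 by simp
    then have "p dvd (if f - 1 < f - 1 then c (Suc (f - 1)) * (p - 1) else 1)"
      by (rule indepD[OF x _ fm])
    then show False using p2 by simp
  qed
  ultimately show ?thesis by blast
qed

text \<open>Replacing the useless p-th power of \<zeta> by \<open>u\<close> gives a full independent
  family at \<open>es\<close>, which therefore spans.\<close>

lemma crit_span:
  assumes u: "u \<in> U es" "u \<notin> crit" and z: "z \<in> U es"
  shows "\<exists>c. \<exists>x\<in>U i0. z / (u ^ c * x ^ p) \<in> U (Suc es)"
proof -
  obtain w where w: "indep f i0 w" "w 0 = \<zeta>" using zeta_basis by blast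
  define v where "v j = (if j = 0 then u else w j ^ p)" for j
  have split: "(\<Prod>j<f. v j ^ c j) = u ^ c 0 * (\<Prod>j<f. w j ^ (if j = 0 then 0 else c j)) ^ p" for c
  proof -
    have "(\<Prod>j<f. v j ^ c j) = (\<Prod>j<f. (if j = 0 then u ^ c j else 1) * (w j ^ (if j = 0 then 0 else c j)) ^ p)"
      by (intro prod.cong) (auto simp: v_def power_mult[symmetric] mult.commute)
    also have "\<dots> = u ^ c 0 * (\<Prod>j<f. w j ^ (if j = 0 then 0 else c j)) ^ p"
      unfolding prod.distrib prod_power_distrib using f_pos by (simp add: prod.delta)
    finally show ?thesis .
  qed
  have wU: "(\<Prod>j<f. w j ^ c j) \<in> U i0" for c by (rule indep_prod_U[OF w(1) zeta_absv(3)])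
  have v: "indep f es v"
    unfolding indep_def
  proof (intro conjI allI impI)
    fix j assume "j < f"
    then show "v j \<in> U es" using w u U_p_power[OF _ zeta_absv(3)] by (auto simp: v_def es_def indep_def)
  next
    fix c :: "nat \<Rightarrow> nat" and j assume c: "(\<Prod>j<f. v j ^ c j) \<in> U (Suc es)" and j: "j < f"
    have c0: "p dvd c 0" by (rule crit_exponent[OF u wU c[unfolded split]])
    then obtain q where "c 0 = p * q" by blast
    then have "u ^ c 0 \<in> U (Suc es)" using U_power[OF U_p_power_Suc[OF u(1) es_props(4)]] by (simp add: power_mult)
    then have "(\<Prod>j<f. w j ^ (if j = 0 then 0 else c j)) ^ p \<in> U (Suc es)"
      using c U_mult_cancel[of "u ^ c 0" "Suc es"] unfolding split by simp
    from crit_kernel[OF w this, of j] c0 j show "p dvd c j" by (cases "j = 0") auto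
  qed
  obtain c where "z / (\<Prod>j<f. v j ^ c j) \<in> U (Suc es)" using indep_span[OF v es_props(4) z] by blast
  then show ?thesis unfolding split using wU[of "\<lambda>j. if j = 0 then 0 else c j"] by blast
qed


subsection \<open>The gaps of the shift\<close>

abbreviation T where "T \<equiv> shift_gaps \<rho>"

lemma rho_preimage_high:
  assumes "es \<le> n"
  shows "n = \<rho> (n - e)" "n - e \<ge> i0"
  using assms es_props rho_high[of "n - e"] by auto

lemma T_iff: "n \<in> T \<longleftrightarrow> n \<ge> 1 \<and> (\<forall>l\<ge>1. n \<noteq> \<rho> l)"
  by (auto simp: shift_gaps_def)

lemma T_less: "n \<in> T \<Longrightarrow> n < es"
proof (rule ccontr)
  assume n: "n \<in> T" "\<not> n < es"
  then have "n = \<rho> (n - e)" "n - e \<ge> 1" using rho_preimage_high[of n] zeta_absv(3) by auto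
  then show False using n(1) T_iff by blast
qed

lemma finite_T: "finite T"
  using T_less by (intro finite_subset[of T "{..<es}"]) auto

lemma es_not_T: "es \<notin> T"
  using T_less by blast

text \<open>A preimage of es - 1 would lie below \<open>i0\<close>, where \<rho> multiplies by
  \<open>p\<close>; but es - 1 = p i0 - 1 is not divisible by \<open>p\<close>. Together with
  \<open>T_less\<close> this identifies \<open>es\<close> with e*.\<close>

lemma pred_es_T: "es - 1 \<in> T"
  unfolding T_iff
proof (intro conjI allI impI notI)
  show "1 \<le> es - 1" using es_props(3) zeta_absv(3) by simp
  fix l assume l: "1 \<le> l" "es - 1 = \<rho> l"
  then have "\<rho> l < \<rho> i0" using es_props(4) by (simp add: es_def)
  then have "l < i0" using shift_less_iff[OF rho_shift l(1) zeta_absv(3)] by simp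
  then have "es - 1 = p * l" using l rho_low[of l] by simp
  then have "es = p * l + 1" using es_props(4) by simp
  then have "p * i0 = p * l + 1" using es_props(1) by simp
  then have "p dvd p * l + 1" by (metis dvd_triv_left)
  then have "p dvd 1" by (metis dvd_add_right_iff dvd_triv_left)
  then show False using p2 by simp
qed

lemma e_star_eq: "e_star \<rho> = es"
proof -
  have "Max T = es - 1"
    using finite_T pred_es_T T_less by (intro Max_eqI) fastforce+
  then show ?thesis using es_props(4) by (simp add: e_star_def)
qed

lemma gaps_star_eq: "shift_gaps_star \<rho> = insert es T"
  by (simp add: shift_gaps_star_def e_star_eq)

lemma T_pow:
  assumes "n \<in> T" "i \<ge> 1" "(\<rho> ^^ k) i = n"
  shows "k = 0 \<and> i = n"
proof (cases k)
  case (Suc m)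
  then have "n = \<rho> ((\<rho> ^^ m) i)" "(\<rho> ^^ m) i \<ge> 1" using assms shift_pow_ge1[OF rho_shift] by auto
  then show ?thesis using assms(1) T_iff by blast
qed (use assms in simp)

subsection \<open>Filtered bases\<close>

text \<open>A pair is a level and the number of a vector at this level. Number 0, together with the
  vector at \<open>es\<close>, accounts for the summand built from M*; the other numbers give the f
  - 1 free copies.\<close>

definition idx :: "(nat \<times> nat) set" where
  "idx = insert (es, 0) (T \<times> {..<f})"

lemma finite_idx: "finite idx"
  by (simp add: idx_def finite_T)

lemma idx_ge1: "b \<in> idx \<Longrightarrow> fst b \<ge> 1"
  using es_props(4) by (auto simp: idx_def T_iff)

definition basis :: "(nat \<times> nat \<Rightarrow> 'a) \<Rightarrow> bool" where
  "basis u \<longleftrightarrow> (\<forall>i\<in>T. indep f i (\<lambda>j. u (i, j))) \<and> u (es, 0) \<in> U es \<and> u (es, 0) \<notin> crit"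

lemma basis_U: "basis u \<Longrightarrow> b \<in> idx \<Longrightarrow> u b \<in> U (fst b)"
  by (auto simp: basis_def idx_def indep_def)

lemma basis_U1: "basis u \<Longrightarrow> b \<in> idx \<Longrightarrow> u b \<in> U 1"
  using basis_U U_antimono idx_ge1 by blast

text \<open>Each exponent \<open>c b\<close>, viewed as an element of the module S attached to the
  level \<open>fst b\<close>, has weight at least \<open>n\<close>; compare
  \<open>S_filt_iff\<close>.\<close>

definition wt_nat :: "(nat \<times> nat \<Rightarrow> nat) \<Rightarrow> nat \<Rightarrow> bool" where
  "wt_nat c n \<longleftrightarrow> (\<forall>b\<in>idx. \<forall>k. (\<rho> ^^ k) (fst b) < n \<longrightarrow> p ^ Suc k dvd c b)"

definition comb_nat :: "(nat \<times> nat \<Rightarrow> 'a) \<Rightarrow> (nat \<times> nat \<Rightarrow> nat) \<Rightarrow> 'a" where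
  "comb_nat u c = (\<Prod>b\<in>idx. u b ^ c b)"

lemma comb_nat_add: "comb_nat u (\<lambda>b. c b + d b) = comb_nat u c * comb_nat u d"
  by (simp add: comb_nat_def power_add prod.distrib)

lemma comb_nat_mult: "comb_nat u (\<lambda>b. m * c b) = comb_nat u c ^ m"
  by (simp add: comb_nat_def prod_power_distrib power_mult[symmetric] mult.commute)

lemma wt_natD: "wt_nat c n \<Longrightarrow> b \<in> idx \<Longrightarrow> (\<rho> ^^ k) (fst b) < n \<Longrightarrow> p ^ Suc k dvd c b"
  unfolding wt_nat_def by blast

lemma comb_nat_U:
  assumes u: "basis u" and c: "wt_nat c n" and n: "n \<ge> 1"
  shows "comb_nat u c \<in> U n"
  unfolding comb_nat_def
proof (rule U_prod[OF _ n])
  fix b assume b: "b \<in> idx"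
  \<comment> \<open>The least number of p-th powers that carry level \<open>fst b\<close> up to
    \<open>n\<close>; the weight condition at k - 1 supplies exactly the divisibility by
    p^k.\<close>
  define k where "k = (LEAST k. n \<le> (\<rho> ^^ k) (fst b))"
  have "\<exists>k. n \<le> (\<rho> ^^ k) (fst b)"
    using shift_pow_ge[OF rho_shift idx_ge1[OF b], of n] less_imp_le by blast
  then have k: "n \<le> (\<rho> ^^ k) (fst b)" unfolding k_def by (rule LeastI_ex)
  have "p ^ k dvd c b"
  proof (cases k)
    case (Suc m)
    then have "(\<rho> ^^ m) (fst b) < n" using not_less_Least[of m "\<lambda>k. n \<le> (\<rho> ^^ k) (fst b)"] by (simp add: k_def)
    then show ?thesis using wt_natD[OF c b] Suc by blast
  qed simp
  then obtain q where q: "c b = p ^ k * q" by blast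
  have "u b ^ (p ^ k) \<in> U n"
    using U_p_pow_pow[OF basis_U[OF u b] idx_ge1[OF b], of k] U_antimono[OF k] by blast
  then show "u b ^ c b \<in> U n" unfolding q power_mult using U_power n by blast
qed

lemma comb_nat_level:
  assumes "n \<in> T"
  shows "comb_nat u (\<lambda>b. if fst b = n then c (snd b) else 0) = (\<Prod>j<f. u (n, j) ^ c j)"
proof -
  have "comb_nat u (\<lambda>b. if fst b = n then c (snd b) else 0) = (\<Prod>b\<in>{n} \<times> {..<f}. u b ^ c (snd b))"
    unfolding comb_nat_def using assms T_less[OF assms] finite_idx
    by (intro prod.mono_neutral_cong_right) (auto simp: idx_def)
  also have "\<dots> = (\<Prod>j<f. u (n, j) ^ c j)"
    by (rule prod.reindex_bij_witness[of _ "\<lambda>j. (n, j)" snd]) auto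
  finally show ?thesis .
qed

lemma comb_nat_es: "comb_nat u (\<lambda>b. if b = (es, 0) then c else 0) = u (es, 0) ^ c"
proof -
  have "comb_nat u (\<lambda>b. if b = (es, 0) then c else 0) = (\<Prod>b\<in>idx. if b = (es, 0) then u (es, 0) ^ c else 1)"
    unfolding comb_nat_def by (intro prod.cong) auto
  also have "\<dots> = u (es, 0) ^ c" using finite_idx by (subst prod.delta) (auto simp: idx_def)
  finally show ?thesis .
qed

lemma wt_nat_p_mult:
  assumes "wt_nat c l" "l \<ge> 1"
  shows "wt_nat (\<lambda>b. p * c b) (\<rho> l)"
  unfolding wt_nat_def
proof (intro ballI allI impI)
  fix b k assume b: "b \<in> idx" and k: "(\<rho> ^^ k) (fst b) < \<rho> l"
  show "p ^ Suc k dvd p * c b"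
  proof (cases k)
    case (Suc m)
    then have "(\<rho> ^^ m) (fst b) < l"
      using k shift_less_iff[OF rho_shift shift_pow_ge1[OF rho_shift idx_ge1[OF b]] assms(2), of m] by simp
    then show ?thesis using wt_natD[OF assms(1) b] Suc by (simp add: mult_dvd_mono)
  qed simp
qed

text \<open>Induction on the level. At a gap the basis spans. At n = \<rho>(l) with l \<noteq> i0,
  \<open>y\<close> is a p-th power from level \<open>l\<close> modulo the next level, and the
  exponents found at \<open>l\<close> are multiplied by \<open>p\<close>. At \<open>es\<close> the
  extra basis vector makes up for what the p-th powers miss.\<close>

lemma comb_nat_step:
  assumes u: "basis u" and n: "n \<ge> 1" and y: "y \<in> U n"
  shows "\<exists>c. wt_nat c n \<and> y / comb_nat u c \<in> U (Suc n)"
  using n y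
proof (induction n arbitrary: y rule: less_induct)
  case (less n)
  show ?case
  proof (cases "n \<in> T")
    case True
    then have "indep f n (\<lambda>j. u (n, j))" using u by (simp add: basis_def)
    then obtain c where c: "y / (\<Prod>j<f. u (n, j) ^ c j) \<in> U (Suc n)"
      using indep_span[OF _ less.prems] by blast
    have "wt_nat (\<lambda>b. if fst b = n then c (snd b) else 0) n"
      unfolding wt_nat_def using shift_pow_mono[OF rho_shift, of n 0] less.prems by (auto simp: not_less)
        (metis leD)
    then show ?thesis using c comb_nat_level[OF True, of u c] by (intro exI) auto
  next
    case False
    then obtain l where l: "l \<ge> 1" "n = \<rho> l" using less.prems T_iff by blast
    have ln: "l < n" using rho_gt l by simp
    show ?thesis
    proof (cases "l = i0")
      case False
      obtain w where w: "indep f l w" using indep_exists[OF U_proper l(1)] by blast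
      obtain c where "y / (\<Prod>j<f. (w j ^ p) ^ c j) \<in> U (Suc n)"
        using indep_span[OF indep_p_power[OF w l(1) False]] less.prems l(2) by blast
      moreover define z where "z = (\<Prod>j<f. w j ^ c j)"
      moreover have "(\<Prod>j<f. (w j ^ p) ^ c j) = z ^ p"
        unfolding z_def by (simp add: prod_power_distrib power_mult[symmetric] mult.commute)
      ultimately have yz: "y / z ^ p \<in> U (Suc n)" by simp
      have z: "z \<in> U l" unfolding z_def by (rule indep_prod_U[OF w l(1)])
      then obtain d where d: "wt_nat d l" "z / comb_nat u d \<in> U (Suc l)" using less.IH[OF ln l(1)] by blast
      have "Suc n \<le> \<rho> (Suc l)" using shiftD(2)[OF rho_shift l(1), of "Suc l"] l(2) by simp
      then have "(z / comb_nat u d) ^ p \<in> U (Suc n)" using U_p_power[OF d(2)] U_antimono by simp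
      then have "y / z ^ p * (z ^ p / comb_nat u d ^ p) \<in> U (Suc n)"
        using yz by (intro U_mult) (auto simp: power_divide)
      then have "y / comb_nat u (\<lambda>b. p * d b) \<in> U (Suc n)"
        using U_nonzero[OF z l(1)] by (simp add: comb_nat_mult)
      then show ?thesis using wt_nat_p_mult[OF d(1) l(1)] l(2) by blast
    next
      case True
      then have n: "n = es" using l by (simp add: es_def)
      obtain c z where cz: "z \<in> U i0" "y / (u (es, 0) ^ c * z ^ p) \<in> U (Suc es)"
        using crit_span[of "u (es, 0)" y] u less.prems n by (auto simp: basis_def)
      obtain d where d: "wt_nat d i0" "z / comb_nat u d \<in> U (Suc i0)"
        using less.IH[OF ln l(1)] cz(1) True by blast
      have "(z / comb_nat u d) ^ p \<in> U (Suc n)"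
        using U_p_power[OF d(2)] rho_Suc_high[of i0] by (simp add: n es_def)
      then have "y / (u (es, 0) ^ c * z ^ p) * (z ^ p / comb_nat u d ^ p) \<in> U (Suc n)"
        using cz(2) n by (intro U_mult) (auto simp: power_divide)
      moreover define c' where "c' b = p * d b + (if b = (es, 0) then c else 0)" for b
      moreover have "comb_nat u c' = comb_nat u d ^ p * u (es, 0) ^ c"
        unfolding c'_def comb_nat_add comb_nat_mult comb_nat_es ..
      ultimately have "y / comb_nat u c' \<in> U (Suc n)"
        using U_nonzero[OF cz(1) zeta_absv(3)] by (simp add: mult.commute)
      moreover have "wt_nat c' n"
        unfolding wt_nat_def
      proof (intro ballI allI impI)
        fix b k assume b: "b \<in> idx" and k: "(\<rho> ^^ k) (fst b) < n"
        have "b \<noteq> (es, 0)"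
          using k shift_pow_mono[OF rho_shift es_props(4), of 0 k] n by auto
        then show "p ^ Suc k dvd c' b"
          using wt_natD[OF wt_nat_p_mult[OF d(1) zeta_absv(3)] b, of k] k n by (simp add: c'_def es_def)
      qed
      ultimately show ?thesis by blast
    qed
  qed
qed

text \<open>At \<open>b0\<close> the expression of \<open>\<zeta>\<close> attains its weight \<open>i0\<close>. Therefore no relation between the
  basis elements vanishes at \<open>b0\<close>, and coefficients can be compared there.\<close>

definition zeta_expr :: "(nat \<times> nat \<Rightarrow> 'a) \<Rightarrow> (nat \<times> nat \<Rightarrow> nat) \<Rightarrow> nat \<times> nat \<Rightarrow> nat \<Rightarrow> bool" where
  "zeta_expr u z b0 a \<longleftrightarrow> comb_nat u z = \<zeta> \<and> wt_nat z i0 \<and> b0 \<in> idx \<and> z b0 = p ^ a \<and>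
     (\<rho> ^^ a) (fst b0) = i0"

text \<open>The weight of the exponents rises whenever the level of the product does. The induction
  takes p-th roots of the part of the product that lies below level \<open>n\<close>; this is
  unambiguous except at \<open>es\<close>, where a power of \<zeta> may intervene and the coordinate
  \<open>b0\<close> decides.\<close>

lemma comb_nat_strict:
  assumes u: "basis u" and n: "n \<ge> 1" and c: "wt_nat c n" "comb_nat u c \<in> U (Suc n)"
    and z: "es \<le> n \<Longrightarrow> zeta_expr u z b0 a \<and> c b0 = 0"
  shows "wt_nat c (Suc n)"
  using n c z
proof (induction n arbitrary: c rule: less_induct)
  case (less n)
  show ?case
  proof (cases "n \<in> T")
    case True
    \<comment> \<open>No p-power of a vector from another level lands on a gap, so only the vectors
      at level \<open>n\<close> itself can obstruct the larger weight.\<close>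
    define c1 where "c1 b = (if fst b = n then c (n, snd b) else 0)" for b :: "nat \<times> nat"
    define c2 where "c2 b = (if fst b = n then 0 else c b)" for b :: "nat \<times> nat"
    have split: "comb_nat u c = comb_nat u c1 * comb_nat u c2"
      unfolding comb_nat_add[symmetric] by (rule arg_cong[of _ _ "comb_nat u"]) (auto simp: c1_def c2_def)
    have key: "k = 0 \<and> fst b = n" if "b \<in> idx" "(\<rho> ^^ k) (fst b) < Suc n" "\<not> (\<rho> ^^ k) (fst b) < n" for b k
      using T_pow[OF True idx_ge1[OF that(1)], of k] that by simp
    have "wt_nat c2 (Suc n)"
      unfolding wt_nat_def
    proof (intro ballI allI impI)
      fix b k assume b: "b \<in> idx" and k: "(\<rho> ^^ k) (fst b) < Suc n"
      show "p ^ Suc k dvd c2 b"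
        using wt_natD[OF less.prems(2) b, of k] key[OF b k] by (auto simp: c2_def)
    qed
    then have "comb_nat u c2 \<in> U (Suc n)" using comb_nat_U[OF u] by simp
    then have "comb_nat u c1 \<in> U (Suc n)"
      using less.prems(3) U_mult_cancel[of "comb_nat u c2" "Suc n" "comb_nat u c1"] unfolding split by (simp add: mult.commute)
    then have "(\<Prod>j<f. u (n, j) ^ c (n, j)) \<in> U (Suc n)"
      using comb_nat_level[OF True, of u "\<lambda>j. c (n, j)"] unfolding c1_def by simp
    then have dv: "p dvd c (n, j)" if "j < f" for j
      using indepD[of f n "\<lambda>j. u (n, j)" "\<lambda>j. c (n, j)"] that True u by (simp add: basis_def)
    show ?thesis
      unfolding wt_nat_def
    proof (intro ballI allI impI)
      fix b k assume b: "b \<in> idx" and k: "(\<rho> ^^ k) (fst b) < Suc n"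
      show "p ^ Suc k dvd c b"
      proof (cases "(\<rho> ^^ k) (fst b) < n")
        case False
        from key[OF b k False] have "k = 0" "fst b = n" by auto
        then show ?thesis using dv[of "snd b"] b True es_not_T by (cases b) (auto simp: idx_def)
      qed (use wt_natD[OF less.prems(2) b] in blast)
    qed
  next
    case False
    then obtain l where l: "l \<ge> 1" "n = \<rho> l" using less.prems T_iff by blast
    have ln: "l < n" using rho_gt l by simp
    \<comment> \<open>Vectors below level \<open>n\<close> have exponents divisible by
      \<open>p\<close> by the weight condition at k = 0, which gives \<open>p * c1\<close>. Level
      \<open>n\<close> is not a gap, so only the vector at \<open>es\<close> can sit there, which
      gives \<open>c0\<close>. Vectors above \<open>n\<close> give \<open>c2\<close>, of weight
      beyond \<open>n\<close>.\<close>
    define c0 where "c0 b = (if b = (es, 0) then (if n = es then c (es, 0) else 0) else 0)" for b :: "nat \<times> nat"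
    define c1 where "c1 b = (if fst b < n then c b div p else 0)" for b :: "nat \<times> nat"
    define c2 where "c2 b = (if fst b > n then c b else 0)" for b :: "nat \<times> nat"
    have pc1: "p * c1 b = c b" if "b \<in> idx" "fst b < n" for b
      using wt_natD[OF less.prems(2) that(1), of 0] that(2) by (simp add: c1_def)
    have n_es: "b = (es, 0) \<and> n = es" if "b \<in> idx" "fst b = n" for b
      using that False by (auto simp: idx_def)
    have split: "c b = p * c1 b + c0 b + c2 b" if "b \<in> idx" for b
      using pc1[OF that] n_es[OF that] by (cases "fst b" n rule: linorder_cases) (auto simp: c0_def c1_def c2_def)
    have "comb_nat u c = comb_nat u (\<lambda>b. p * c1 b + c0 b + c2 b)"
      unfolding comb_nat_def using split by (intro prod.cong) auto
    then have cu: "comb_nat u c = comb_nat u c1 ^ p * comb_nat u c0 * comb_nat u c2"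
      unfolding comb_nat_add comb_nat_mult .
    have "wt_nat c2 (Suc n)"
      unfolding wt_nat_def
    proof (intro ballI allI impI)
      fix b k assume b: "b \<in> idx" and k: "(\<rho> ^^ k) (fst b) < Suc n"
      then have "fst b \<le> n" using shift_pow_mono[OF rho_shift idx_ge1[OF b], of 0 k] by simp
      then show "p ^ Suc k dvd c2 b" by (simp add: c2_def)
    qed
    then have c2U: "comb_nat u c2 \<in> U (Suc n)" using comb_nat_U[OF u] by simp
    have c10: "comb_nat u c1 ^ p * comb_nat u c0 \<in> U (Suc n)"
      using less.prems(3) U_mult_cancel[OF c2U, of "comb_nat u c1 ^ p * comb_nat u c0"]
      unfolding cu by (simp add: mult.commute)
    have wt1: "wt_nat c1 l"
      unfolding wt_nat_def
    proof (intro ballI allI impI)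
      fix b k assume b: "b \<in> idx" and k: "(\<rho> ^^ k) (fst b) < l"
      have fb: "fst b < n" using shift_pow_mono[OF rho_shift idx_ge1[OF b], of 0 k] k ln by simp
      have "(\<rho> ^^ Suc k) (fst b) < n"
        using shiftD(2)[OF rho_shift shift_pow_ge1[OF rho_shift idx_ge1[OF b]] k] l(2) by simp
      then have "p * p ^ Suc k dvd p * c1 b"
        using wt_natD[OF less.prems(2) b, of "Suc k"] pc1[OF b fb] by simp
      then show "p ^ Suc k dvd c1 b" using p_pos by simp
    qed
    have c1U: "comb_nat u c1 \<in> U l" using comb_nat_U[OF u wt1 l(1)] .
    have finish: "wt_nat c (Suc n)" if w: "wt_nat c1 (Suc l)" and pes: "n = es \<Longrightarrow> p dvd c (es, 0)"
      unfolding wt_nat_def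
    proof (intro ballI allI impI)
      fix b k assume b: "b \<in> idx" and k: "(\<rho> ^^ k) (fst b) < Suc n"
      have le: "fst b \<le> (\<rho> ^^ k) (fst b)" using shift_pow_mono[OF rho_shift idx_ge1[OF b], of 0 k] by simp
      show "p ^ Suc k dvd c b"
      proof (cases "fst b < n")
        case True
        show ?thesis
        proof (cases k)
          case 0
          then show ?thesis using pc1[OF b True] by (metis dvd_triv_left power_Suc0_right)
        next
          case (Suc m)
          have "\<rho> ((\<rho> ^^ m) (fst b)) < \<rho> (Suc l)"
            using k Suc l(2) shiftD(2)[OF rho_shift l(1), of "Suc l"] by simp
          then have "(\<rho> ^^ m) (fst b) < Suc l"
            using shift_less_iff[OF rho_shift shift_pow_ge1[OF rho_shift idx_ge1[OF b]]] by simp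
          then have "p ^ Suc m dvd c1 b" using wt_natD[OF w b] by blast
          then show ?thesis using pc1[OF b True] Suc by (metis mult_dvd_mono dvd_refl power_Suc)
        qed
      next
        case False
        then have "fst b = n" "k = 0"
          using le k shift_pow_increasing[OF rho_shift idx_ge1[OF b], of 0 k] by (auto intro: ccontr)
        then show ?thesis using n_es[OF b] pes by simp
      qed
    qed
    show ?thesis
    proof (cases "n = es")
      case False
      then have "l \<noteq> i0" using l by (auto simp: es_def)
      have "comb_nat u c0 = 1" using False by (simp add: comb_nat_def c0_def)
      then have "comb_nat u c1 ^ p \<in> U (Suc (\<rho> l))" using c10 l(2) by simp
      then have c1U': "comb_nat u c1 \<in> U (Suc l)" by (rule U_p_power_inj[OF c1U l(1) \<open>l \<noteq> i0\<close>])
      have "wt_nat c1 (Suc l)"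
        using less.prems(4) ln by (intro less.IH[OF ln l(1) wt1 c1U']) (auto simp: c1_def)
      then show ?thesis using finish False by blast
    next
      case True
      have li: "l = i0"
        using l True shift_less_iff[OF rho_shift l(1) zeta_absv(3)] shift_less_iff[OF rho_shift zeta_absv(3) l(1)]
        unfolding es_def by (metis less_irrefl linorder_neqE_nat)
      have z: "zeta_expr u z b0 a" "c b0 = 0" using less.prems(4) True by auto
      have c0: "comb_nat u c0 = u (es, 0) ^ c (es, 0)"
        unfolding c0_def comb_nat_es using True by simp
      have u_es: "u (es, 0) \<in> U es" "u (es, 0) \<notin> crit" using u by (auto simp: basis_def)
      have pes: "p dvd c (es, 0)"
        using crit_exponent[OF u_es, of "comb_nat u c1"] c1U c10 unfolding c0 li True by (simp add: mult.commute)
      then obtain q where "c (es, 0) = p * q" by blast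
      then have "comb_nat u c0 \<in> U (Suc es)"
        unfolding c0 using U_power[OF U_p_power_Suc[OF u_es(1) es_props(4)]] by (simp add: power_mult)
      then have "comb_nat u c1 ^ p \<in> U (Suc (\<rho> i0))"
        using c10 U_mult_cancel[of "comb_nat u c0" "Suc es" "comb_nat u c1 ^ p"] True by (simp add: mult.commute es_def)
      then obtain d where d: "d < p" "comb_nat u c1 / \<zeta> ^ d \<in> U (Suc i0)"
        using U_p_power_kernel c1U li by blast
      \<comment> \<open>Exponents of the product divided by \<zeta>^d, with p - d in place of -d.
        The induction hypothesis applies to them at level \<open>i0\<close> < \<open>es\<close>,
        where the condition on \<open>b0\<close> is vacuous.\<close>
      define c3 where "c3 b = c1 b + (p - d) * z b" for b
      have "comb_nat u c3 = comb_nat u c1 * \<zeta> ^ (p - d)"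
        using z(1) unfolding c3_def comb_nat_add comb_nat_mult by (simp add: zeta_expr_def)
      also have "\<dots> = comb_nat u c1 / \<zeta> ^ d"
        using zeta_power U_nonzero[OF zeta_U(3)] d(1) by (simp add: power_diff)
      finally have c3U: "comb_nat u c3 \<in> U (Suc i0)" using d(2) by simp
      have wt3: "wt_nat c3 i0"
        using wt1 z(1) li unfolding wt_nat_def zeta_expr_def c3_def by (simp add: dvd_add)
      have "wt_nat c3 (Suc i0)"
        using ln li True by (intro less.IH[OF _ zeta_absv(3) wt3 c3U]) auto
      moreover have b0: "b0 \<in> idx" "z b0 = p ^ a" "(\<rho> ^^ a) (fst b0) = i0" using z(1) by (auto simp: zeta_expr_def)
      moreover have "c1 b0 = 0" using z(2) by (simp add: c1_def)
      \<comment> \<open>At \<open>b0\<close> only the expression of \<zeta> contributes. Its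
        exponent p^a has weight exactly \<open>i0\<close>, so a larger weight forces
        \<open>p\<close> to divide p - d, that is d = 0.\<close>
      ultimately have "p ^ Suc a dvd (p - d) * p ^ a"
        using wt_natD[of c3 "Suc i0" b0 a] by (simp add: c3_def)
      then have "p dvd p - d" using p_pos by simp
      then have "d = 0" using d(1) by (metis diff_le_self dvd_imp_le le_antisym diff_is_0_eq diff_diff_cancel less_imp_le not_less zero_less_diff diff_self_eq_0)
      then have "comb_nat u c1 \<in> U (Suc i0)" using d(2) by simp
      then have "wt_nat c1 (Suc i0)"
        using ln li True wt1 by (intro less.IH[OF _ zeta_absv(3)]) auto
      then show ?thesis using finish pes li by blast
    qed
  qed
qed

subsection \<open>Parametrization by p-adic exponents\<close>

definition exps :: "(nat \<times> nat \<Rightarrow> nat \<Rightarrow> int) set" where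
  "exps = {x. \<forall>b\<in>idx. x b \<in> carrier (Zp p)}"

definition wt :: "(nat \<times> nat \<Rightarrow> nat \<Rightarrow> int) \<Rightarrow> nat \<Rightarrow> bool" where
  "wt x n \<longleftrightarrow> (\<forall>b\<in>idx. \<forall>k. (\<rho> ^^ k) (fst b) < n \<longrightarrow> x b (Suc k) = 0)"

definition comb :: "(nat \<times> nat \<Rightarrow> 'a) \<Rightarrow> (nat \<times> nat \<Rightarrow> nat \<Rightarrow> int) \<Rightarrow> 'a" where
  "comb u x = (\<Prod>b\<in>idx. pw (x b) (u b))"

lemma comb_U1: "basis u \<Longrightarrow> x \<in> exps \<Longrightarrow> comb u x \<in> U 1"
  unfolding comb_def using basis_U1 by (intro U_prod pw_U) (auto simp: exps_def)

lemma comb_approx: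
  assumes u: "basis u" and x: "x \<in> exps" and c: "\<And>b. b \<in> idx \<Longrightarrow> int (c b) mod int p ^ n = x b n"
  shows "comb u x / comb_nat u c \<in> U (Suc n)"
  unfolding comb_def comb_nat_def prod_dividef[symmetric]
  using basis_U1[OF u] x c by (intro U_prod pw_approx) (auto simp: exps_def)

text \<open>Since \<rho>^k(i) > k, weight \<open>n\<close> involves residues at indices up to
  \<open>n\<close> only, and an approximation modulo p^N with N \<ge> n decides it.\<close>

lemma wt_nat_iff:
  assumes x: "x \<in> exps" and N: "n \<le> N" and c: "\<And>b. b \<in> idx \<Longrightarrow> int (c b) mod int p ^ N = x b N"
  shows "wt_nat c n \<longleftrightarrow> wt x n"
proof -
  have "p ^ Suc k dvd c b \<longleftrightarrow> x b (Suc k) = 0" if b: "b \<in> idx" and k: "(\<rho> ^^ k) (fst b) < n" for b k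
  proof -
    have "k < n" using shift_pow_ge[OF rho_shift idx_ge1[OF b], of k] k by simp
    then have kN: "Suc k \<le> N" using N by simp
    have "x b (Suc k) = int (c b) mod int p ^ N mod int p ^ Suc k"
      using Zp_mod[of "x b" p "Suc k" N] x b kN c[OF b] by (simp add: exps_def)
    also have "\<dots> = int (c b) mod int p ^ Suc k" by (rule mod_power_mod[OF kN])
    finally have "x b (Suc k) = 0 \<longleftrightarrow> int (p ^ Suc k) dvd int (c b)" by (simp add: mod_eq_0_iff_dvd)
    then show ?thesis by (simp only: of_nat_dvd_iff)
  qed
  then show ?thesis unfolding wt_nat_def wt_def by blast
qed

lemma comb_U:
  assumes u: "basis u" and x: "x \<in> exps" and n: "n \<ge> 1" and w: "wt x n"
  shows "comb u x \<in> U n"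
proof -
  define c where "c b = nat (x b n)" for b
  have c: "int (c b) mod int p ^ n = x b n" if "b \<in> idx" for b
    using x that Zp_nat_approx by (simp add: exps_def c_def)
  have "wt_nat c n" using wt_nat_iff[OF x order_refl c] w by simp
  then have 1: "comb_nat u c \<in> U n" by (rule comb_nat_U[OF u _ n])
  have "comb u x / comb_nat u c \<in> U n" using comb_approx[OF u x c] U_antimono[of n "Suc n"] by simp
  from U_mult[OF this 1 n] show ?thesis using U_nonzero[OF 1 n] by simp
qed

lemma comb_strict:
  assumes u: "basis u" and x: "x \<in> exps" and n: "n \<ge> 1" and w: "wt x n" "comb u x \<in> U (Suc n)"
    and z: "es \<le> n \<Longrightarrow> zeta_expr u z b0 a \<and> x b0 = \<zero>\<^bsub>Zp p\<^esub>"
  shows "wt x (Suc n)"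
proof -
  define N where "N = Suc n"
  define c where "c b = nat (x b N)" for b
  have c: "int (c b) mod int p ^ N = x b N" if "b \<in> idx" for b
    using x that Zp_nat_approx by (simp add: exps_def c_def)
  have "comb u x / comb_nat u c \<in> U (Suc N)" by (rule comb_approx[OF u x c])
  then have "comb u x / comb_nat u c \<in> U (Suc n)" using U_antimono[of "Suc n" "Suc N"] by (simp add: N_def)
  from U_divide[OF w(2) this] have cU: "comb_nat u c \<in> U (Suc n)"
    using U_nonzero[OF comb_U1[OF u x]] by simp
  have wc: "wt_nat c n" using wt_nat_iff[OF x _ c, of n] w(1) by (simp add: N_def)
  have "wt_nat c (Suc n)"
    using z by (intro comb_nat_strict[OF u n wc cU]) (auto simp: c_def Zp_zero)
  then show ?thesis using wt_nat_iff[OF x _ c, of "Suc n"] by (simp add: N_def)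
qed

text \<open>The corrections from \<open>comb_nat_step\<close> have growing weight, so at each basis
  vector the accumulated natural exponents converge p-adically. Every correction has weight at least
  \<open>m\<close>, which makes the surjection strict for the filtrations.\<close>

lemma comb_surj:
  assumes u: "basis u" and m: "m \<ge> 1" and y: "y \<in> U m"
  shows "\<exists>x\<in>exps. wt x m \<and> comb u x = y"
proof -
  have y0: "y \<noteq> 0" using U_nonzero[OF y m] .
  have step: "\<exists>d. wt_nat d n \<and> y / comb_nat u (\<lambda>b. c b + d b) \<in> U (Suc n)"
    if c: "y / comb_nat u c \<in> U n" "n \<ge> 1" for n c
  proof -
    obtain d where "wt_nat d n" "(y / comb_nat u c) / comb_nat u d \<in> U (Suc n)"
      using comb_nat_step[OF u c(2,1)] by blast
    then show ?thesis unfolding comb_nat_add by (intro exI[of _ d]) simp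
  qed
  have "\<exists>C. \<forall>n. (y / comb_nat u (C n) \<in> U (m + n) \<and> wt_nat (C n) m) \<and>
      (\<exists>d. wt_nat d (m + n) \<and> C (Suc n) = (\<lambda>b. C n b + d b))"
  proof (rule dependent_nat_choice)
    show "\<exists>c. y / comb_nat u c \<in> U (m + 0) \<and> wt_nat c m"
      using y by (intro exI[of _ "\<lambda>_. 0"]) (simp add: comb_nat_def wt_nat_def)
  next
    fix c n assume c: "y / comb_nat u c \<in> U (m + n) \<and> wt_nat c m"
    then obtain d where d: "wt_nat d (m + n)" "y / comb_nat u (\<lambda>b. c b + d b) \<in> U (Suc (m + n))"
      using step[of c "m + n"] m by auto
    have "wt_nat (\<lambda>b. c b + d b) m"
      using c d(1) unfolding wt_nat_def by (simp add: dvd_add)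
    then show "\<exists>c'. (y / comb_nat u c' \<in> U (m + Suc n) \<and> wt_nat c' m) \<and>
        (\<exists>d. wt_nat d (m + n) \<and> c' = (\<lambda>b. c b + d b))" using d by auto
  qed
  then obtain C where C: "\<And>n. y / comb_nat u (C n) \<in> U (m + n)" "\<And>n. wt_nat (C n) m"
    "\<And>n. \<exists>d. wt_nat d (m + n) \<and> C (Suc n) = (\<lambda>b. C n b + d b)" by blast
  have C_step: "C (Suc n) b mod p ^ k = C n b mod p ^ k"
    if b: "b \<in> idx" and n: "(\<rho> ^^ k) (fst b) \<le> n" for n b k
  proof (cases k)
    case (Suc l)
    obtain d where d: "wt_nat d (m + n)" "C (Suc n) = (\<lambda>b. C n b + d b)" using C(3) by blast
    have "(\<rho> ^^ l) (fst b) < m + n"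
      using shift_pow_increasing[OF rho_shift idx_ge1[OF b], of l k] n Suc by simp
    then have "p ^ k dvd d b" using wt_natD[OF d(1) b] Suc by blast
    then show ?thesis unfolding d(2) by auto
  qed simp
  \<comment> \<open>From step \<open>K b k\<close> on, all further corrections at \<open>b\<close>
    are divisible by p^k, so the residue modulo p^k is final.\<close>
  define K where "K b k = (\<rho> ^^ k) (fst b)" for b :: "nat \<times> nat" and k
  have C_stable: "C n b mod p ^ k = C (K b k) b mod p ^ k" if b: "b \<in> idx" and n: "K b k \<le> n" for n b k
    using n
  proof (induction n rule: dec_induct)
    case (step j)
    then show ?case using C_step[OF b, of k j] by (simp add: K_def)
  qed simp
  define x where "x b k = int (C (K b k) b) mod int p ^ k" for b k
  have x_eq: "x b k = int (C n b) mod int p ^ k" if "b \<in> idx" "K b k \<le> n" for b k n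
    using arg_cong[OF C_stable[OF that], of int] by (simp add: x_def zmod_int)
  have x: "x \<in> exps"
    unfolding exps_def
  proof (intro CollectI ballI Zp_carrierI[OF p_pos])
    fix b k assume b: "b \<in> idx"
    show "x b k mod int p ^ k = x b k" by (simp add: x_def)
    define n where "n = max (K b k) (K b (Suc k))"
    have "x b (Suc k) = int (C n b) mod int p ^ Suc k" by (intro x_eq b) (simp add: n_def)
    then have "x b (Suc k) mod int p ^ k = int (C n b) mod int p ^ k"
      by (simp only: mod_power_mod[OF le_SucI[OF order_refl]])
    also have "\<dots> = x b k" by (intro x_eq[symmetric] b) (simp add: n_def)
    finally show "x b (Suc k) mod int p ^ k = x b k" .
  qed
  have "wt x m"
    unfolding wt_def
  proof (intro ballI allI impI)
    fix b k assume b: "b \<in> idx" and k: "(\<rho> ^^ k) (fst b) < m"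
    have "p ^ Suc k dvd C (K b (Suc k)) b" using wt_natD[OF C(2) b k] .
    then have "int (p ^ Suc k) dvd int (C (K b (Suc k)) b)" by (simp only: of_nat_dvd_iff)
    then show "x b (Suc k) = 0" by (simp add: x_def)
  qed
  moreover have "comb u x = y"
  proof (rule U_eq[OF y m])
    fix k
    define n where "n = Max (insert (Suc k) ((\<lambda>b. K b k) ` idx))"
    have n: "Suc k \<le> n" "\<And>b. b \<in> idx \<Longrightarrow> K b k \<le> n"
      unfolding n_def using finite_idx by (auto intro: Max_ge)
    have "comb u x / comb_nat u (C n) \<in> U (Suc k)"
      by (intro comb_approx[OF u x] x_eq[symmetric] n(2))
    moreover have "y / comb_nat u (C n) \<in> U (Suc k)"
      using C(1)[of n] U_antimono[of "Suc k" "m + n"] n(1) by simp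
    ultimately have "(comb u x / comb_nat u (C n)) / (y / comb_nat u (C n)) \<in> U (Suc k)"
      by (rule U_divide) simp
    moreover have "comb_nat u (C n) \<noteq> 0" using U_nonzero[OF C(1)[of n]] m y0 by (auto simp: divide_eq_0_iff)
    ultimately show "comb u x / y \<in> U (Suc k)" by simp
  qed
  ultimately show ?thesis using x by blast
qed

text \<open>By \<open>comb_strict\<close> the weight rises through all levels, so every residue
  vanishes. The zero at \<open>b0\<close> excludes the nontrivial multiples of the relation.\<close>

lemma comb_eq_1:
  assumes u: "basis u" and z: "zeta_expr u z b0 a" and x: "x \<in> exps" "comb u x = 1" "x b0 = \<zero>\<^bsub>Zp p\<^esub>"
    and b: "b \<in> idx"
  shows "x b = \<zero>\<^bsub>Zp p\<^esub>"
proof -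
  have w: "wt x (Suc n)" for n
  proof (induction n)
    case 0
    have False if "b \<in> idx" "(\<rho> ^^ k) (fst b) < 1" for b k
      using shift_pow_ge1[OF rho_shift idx_ge1[OF that(1)], of k] that(2) by simp
    then show ?case by (auto simp: wt_def)
  next
    case (Suc n)
    show ?case using z x by (intro comb_strict[OF u x(1) _ Suc]) auto
  qed
  have "x b n = 0" for n
  proof (cases n)
    case 0
    then show ?thesis using x(1) b Zp_0 by (auto simp: exps_def)
  next
    case (Suc k)
    then show ?thesis using w[of "(\<rho> ^^ k) (fst b)"] b by (auto simp: wt_def)
  qed
  then show ?thesis by (auto simp: Zp_zero)
qed

text \<open>Below \<open>es\<close> the condition on \<open>b0\<close> in \<open>comb_strict\<close>
  is vacuous. Consequently every relation has weight \<open>es\<close> and every expression of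
  \<zeta> has weight \<open>i0\<close>.\<close>

lemma wt_es:
  assumes u: "basis u" and x: "x \<in> exps" and n: "comb u x \<in> U n" "1 \<le> n" "n \<le> es"
  shows "wt x n"
  using n(2) n(1,3)
proof (induction n rule: dec_induct)
  case base
  have False if "b \<in> idx" "(\<rho> ^^ k) (fst b) < 1" for b k
    using shift_pow_ge1[OF rho_shift idx_ge1[OF that(1)], of k] that(2) by simp
  then show ?case by (auto simp: wt_def)
next
  case (step n)
  then have "wt x n" using U_antimono[of n "Suc n"] by simp
  then show ?case using step by (intro comb_strict[OF u x]) auto
qed


subsection \<open>A basis adapted to \<open>\<zeta>\<close>\<close>

text \<open>What counts as zero for a basis vector at level \<open>i\<close>: the next filtration
  step at a gap, the p-th powers modulo the next step at \<open>es\<close>. Elements of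
  \<open>U i\<close> outside it, called \<open>prim\<close>, are those that extend to a filtered
  basis by \<open>basis_extend\<close>.\<close>

definition null :: "nat \<Rightarrow> 'a set" where
  "null i = (if i = es then crit else U (Suc i))"

definition prim :: "nat \<Rightarrow> 'a \<Rightarrow> bool" where
  "prim i y \<longleftrightarrow> y \<in> U i \<and> y \<notin> null i"

lemma crit_mult: "x \<in> crit \<Longrightarrow> y \<in> crit \<Longrightarrow> x * y \<in> crit"
proof -
  assume "x \<in> crit" "y \<in> crit"
  then obtain a g b h where "a \<in> U i0" "g \<in> U (Suc es)" "x = a ^ p * g" "b \<in> U i0" "h \<in> U (Suc es)" "y = b ^ p * h"
    unfolding crit_def by blast
  moreover from this have "x * y = (a * b) ^ p * (g * h)" by (simp add: power_mult_distrib)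
  moreover have "a * b \<in> U i0" "g * h \<in> U (Suc es)" using calculation zeta_absv(3) by (auto intro: U_mult)
  ultimately show ?thesis unfolding crit_def by blast
qed

lemma crit_inverse: "x \<in> crit \<Longrightarrow> inverse x \<in> crit"
proof -
  assume "x \<in> crit"
  then obtain a g where "a \<in> U i0" "g \<in> U (Suc es)" "x = a ^ p * g"
    unfolding crit_def by blast
  moreover from this have "inverse x = (inverse a) ^ p * inverse g" by (simp add: power_inverse)
  moreover have "inverse a \<in> U i0" "inverse g \<in> U (Suc es)" using calculation zeta_absv(3) by (auto intro: U_inverse)
  ultimately show ?thesis unfolding crit_def by blast
qed

lemma U_Suc_null: "x \<in> U (Suc i) \<Longrightarrow> x \<in> null i"
proof -
  assume x: "x \<in> U (Suc i)"
  have "x = 1 ^ p * x" by simp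
  then have "x \<in> crit" if "i = es" using x that U_one[of i0] unfolding crit_def by blast
  then show ?thesis using x by (simp add: null_def)
qed

lemma null_mult: "x \<in> null i \<Longrightarrow> y \<in> null i \<Longrightarrow> x * y \<in> null i"
  by (auto simp: null_def intro: crit_mult U_mult split: if_splits)

lemma null_inverse: "x \<in> null i \<Longrightarrow> inverse x \<in> null i"
  by (auto simp: null_def intro: crit_inverse U_inverse split: if_splits)

lemma null_prod: "(\<And>b. b \<in> B \<Longrightarrow> g b \<in> null i) \<Longrightarrow> prod g B \<in> null i"
  by (induction B rule: infinite_finite_induct) (auto intro: null_mult U_Suc_null)

lemma basis_extend:
  assumes "\<And>i. i \<in> insert es T \<Longrightarrow> prim i (y i)"
  shows "\<exists>u. basis u \<and> (\<forall>i\<in>insert es T. u (i, 0) = y i)"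
proof -
  have "\<forall>i\<in>T. \<exists>w. indep f i w \<and> w 0 = y i"
  proof
    fix i assume i: "i \<in> T"
    then have "prim i (y i)" "i \<noteq> es" "i \<ge> 1" using assms es_not_T T_iff by auto
    then show "\<exists>w. indep f i w \<and> w 0 = y i" by (intro indep_exists) (auto simp: prim_def null_def)
  qed
  then obtain w where w: "\<forall>i\<in>T. indep f i (w i) \<and> w i 0 = y i" by metis
  define u where "u b = (if fst b = es then y es else w (fst b) (snd b))" for b
  have "indep f i (\<lambda>j. u (i, j))" if "i \<in> T" for i
  proof -
    have "(\<lambda>j. u (i, j)) = w i" using that es_not_T by (auto simp: u_def fun_eq_iff)
    then show ?thesis using w that by simp
  qed
  moreover have "prim es (y es)" using assms by simp
  ultimately have "basis u" unfolding basis_def by (simp add: u_def prim_def null_def)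
  moreover have "\<forall>i\<in>insert es T. u (i, 0) = y i" using w by (simp add: u_def)
  ultimately show ?thesis by blast
qed

lemma prim_exists: "i \<in> insert es T \<Longrightarrow> \<exists>y. prim i y"
proof (cases "i = es")
  case True
  then show ?thesis using crit_exists by (auto simp: prim_def null_def)
next
  case False
  then show ?thesis using U_proper by (auto simp: prim_def null_def)
qed

definition J :: "nat \<Rightarrow> nat set" where
  "J i = (if i = es then {0} else {..<f})"

lemma idx_Sigma: "idx = Sigma (insert es T) J"
  using es_not_T by (auto simp: idx_def J_def split: if_splits)

lemma pw_zero: "u \<in> U 1 \<Longrightarrow> pw \<zero>\<^bsub>Zp p\<^esub> u = 1"
  using pw_of_nat[of u 0] by (simp add: Zp_of_int_def Zp_zero)

lemma pw_shift:
  assumes "u \<in> U 1" "a \<in> carrier (Zp p)" "a k = 0"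
  shows "pw (Zp_shift p k a) u ^ (p ^ k) = pw a u"
proof -
  have s: "Zp_shift p k a \<in> carrier (Zp p)" using Zp_shift_closed[OF p_pos assms(2,3)] .
  have "pw (Zp_shift p k a) u ^ (p ^ k) = pw (Zp_of_int p (int (p ^ k))) (pw (Zp_shift p k a) u)"
    using pw_U[OF assms(1) _ s] by (intro pw_of_nat[symmetric]) simp
  also have "\<dots> = pw (Zp_of_int p (int (p ^ k)) \<otimes>\<^bsub>Zp p\<^esub> Zp_shift p k a) u"
    by (rule pw_mult[OF assms(1) Zp_of_int_closed[OF p_pos] s, symmetric])
  also have "\<dots> = pw a u" using Zp_shift_mult[OF p_pos assms(2,3)] by simp
  finally show ?thesis .
qed

text \<open>Modulo the next level the p-adic exponents may be replaced by natural ones, of which the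
  one at \<open>j\<close> is prime to \<open>p\<close>; independence, or
  \<open>crit_exponent\<close> at \<open>es\<close>, forbids this for a product in
  \<open>null i\<close>.\<close>

lemma prim_factor:
  assumes u: "basis u" and i: "i \<in> insert es T"
    and x: "\<And>j. j \<in> J i \<Longrightarrow> x j \<in> carrier (Zp p)" and j: "j \<in> J i" "x j 1 \<noteq> 0"
  shows "prim i (\<Prod>j\<in>J i. pw (x j) (u (i, j)))"
proof -
  define y where "y = (\<Prod>j\<in>J i. pw (x j) (u (i, j)))"
  define c where "c j = nat (x j i)" for j
  have i1: "i \<ge> 1" using i es_props(4) T_iff by auto
  have uU: "u (i, j) \<in> U i" "u (i, j) \<in> U 1" if "j \<in> J i" for j
    using basis_U[OF u, of "(i, j)"] basis_U1[OF u, of "(i, j)"] that i unfolding idx_Sigma by auto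
  have yU: "y \<in> U i" unfolding y_def using uU x i1 by (intro U_prod pw_U) auto
  have "y / (\<Prod>j\<in>J i. u (i, j) ^ c j) \<in> U (Suc i)"
    unfolding y_def prod_dividef[symmetric] c_def
    using uU x by (intro U_prod pw_approx Zp_nat_approx) auto
  then have inv: "(\<Prod>j\<in>J i. u (i, j) ^ c j) / y \<in> U (Suc i)"
    using U_inverse by fastforce
  have "\<not> p dvd c j"
  proof
    assume "p dvd c j"
    then have "int p dvd x j i" using Zp_nonneg[OF x[OF j(1)]] by (metis c_def int_dvd_int_iff int_nat_eq)
    then show False using Zp_mod[OF x[OF j(1)] i1] j(2) by simp
  qed
  moreover have "p dvd c j" if yn: "y \<in> null i"
  proof (cases "i = es")
    case True
    then have j0: "j = 0" "J i = {0}" using j by (auto simp: J_def)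
    obtain a g where ag: "a \<in> U i0" "g \<in> U (Suc es)" "y = a ^ p * g"
      using yn True unfolding null_def crit_def by auto
    have "u (es, 0) ^ c 0 / y * g \<in> U (Suc es)" using inv True j0(2) ag(2) by (intro U_mult) auto
    moreover have "u (es, 0) ^ c 0 / y * g = u (es, 0) ^ c 0 * inverse a ^ p"
      using ag U_nonzero[OF ag(2)] by (simp add: field_simps)
    ultimately have "u (es, 0) ^ c 0 * inverse a ^ p \<in> U (Suc es)" by simp
    then show ?thesis
      using crit_exponent[of "u (es, 0)" "inverse a" "c 0"] u U_inverse[OF ag(1) zeta_absv(3)] j0
      by (simp add: basis_def)
  next
    case False
    then have "y \<in> U (Suc i)" using that by (simp add: null_def)
    then have "(\<Prod>j\<in>J i. u (i, j) ^ c j) / y * y \<in> U (Suc i)" using inv by (intro U_mult) auto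
    then have "(\<Prod>j<f. u (i, j) ^ c j) \<in> U (Suc i)"
      using U_nonzero[OF yU i1] False by (simp add: J_def)
    then show ?thesis
      using indepD[of f i "\<lambda>j. u (i, j)" c j] u i j False by (auto simp: basis_def J_def)
  qed
  ultimately show ?thesis using yU unfolding prim_def y_def by blast
qed

lemma zeta_factorization:
  "\<exists>S y b. S \<subseteq> insert es T \<and> (\<forall>i\<in>S. prim i (y i)) \<and> \<zeta> = (\<Prod>i\<in>S. y i ^ (p ^ b i))"
proof -
  obtain y0 where "\<And>i. i \<in> insert es T \<Longrightarrow> prim i (y0 i)" using prim_exists by metis
  then obtain u where u: "basis u" using basis_extend[of y0] by blast
  obtain x where x: "x \<in> exps" "comb u x = \<zeta>" using comb_surj[OF u _ zeta_U(3)] by auto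
  have xc: "x (i, j) \<in> carrier (Zp p)" if "i \<in> insert es T" "j \<in> J i" for i j
    using x(1) that unfolding exps_def idx_Sigma by auto
  have uU: "u (i, j) \<in> U 1" if "i \<in> insert es T" "j \<in> J i" for i j
    using basis_U1[OF u, of "(i, j)"] that unfolding idx_Sigma by auto
  define S where "S = {i \<in> insert es T. \<exists>j\<in>J i. x (i, j) \<noteq> \<zero>\<^bsub>Zp p\<^esub>}"
  \<comment> \<open>The least p-adic order among the exponents at level \<open>i\<close>. Pulling
    out this power of \<open>p\<close> leaves a unit exponent, so the remaining product at that
    level is \<open>prim\<close>.\<close>
  define b where "b i = (LEAST k. \<exists>j\<in>J i. x (i, j) (Suc k) \<noteq> 0)" for i
  have ex: "\<exists>k. \<exists>j\<in>J i. x (i, j) (Suc k) \<noteq> 0" if iS: "i \<in> S" for i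
  proof -
    obtain j where j: "j \<in> J i" "x (i, j) \<noteq> \<zero>\<^bsub>Zp p\<^esub>" "i \<in> insert es T" using iS unfolding S_def by blast
    then obtain k where k: "x (i, j) k \<noteq> 0" by (auto simp: Zp_zero)
    then have "k \<noteq> 0" using Zp_0[OF xc[OF j(3,1)]] by metis
    then show ?thesis using k j by (metis not0_implies_Suc)
  qed
  have b_ex: "\<exists>j\<in>J i. x (i, j) (Suc (b i)) \<noteq> 0" if "i \<in> S" for i
    unfolding b_def using ex[OF that] by (rule LeastI_ex)
  have b_0: "x (i, j) (b i) = 0" if "i \<in> S" "j \<in> J i" for i j
  proof (cases "b i")
    case 0
    then show ?thesis using Zp_0[OF xc] that by (auto simp: S_def)
  next
    case (Suc m)
    then have "m < b i" by simp
    then show ?thesis using not_less_Least[of m "\<lambda>k. \<exists>j\<in>J i. x (i, j) (Suc k) \<noteq> 0"] that Suc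
      by (auto simp: b_def)
  qed
  define y where "y i = (\<Prod>j\<in>J i. pw (Zp_shift p (b i) (x (i, j))) (u (i, j)))" for i
  have "prim i (y i)" if i: "i \<in> S" for i
  proof -
    have iT: "i \<in> insert es T" using i by (simp add: S_def)
    obtain j where j: "j \<in> J i" "x (i, j) (Suc (b i)) \<noteq> 0" using b_ex[OF i] by blast
    have "int p ^ b i dvd x (i, j) (Suc (b i))"
      using Zp_dvd[OF xc[OF iT j(1)] b_0[OF i j(1)], of 1] by simp
    then have "Zp_shift p (b i) (x (i, j)) 1 \<noteq> 0"
      using j(2) by (simp add: Zp_shift_def dvd_div_eq_0_iff)
    then show ?thesis
      unfolding y_def using Zp_shift_closed[OF p_pos xc[OF iT] b_0[OF i]] j(1) by (intro prim_factor[OF u iT]) auto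
  qed
  moreover have "\<zeta> = (\<Prod>i\<in>S. y i ^ (p ^ b i))"
  proof -
    have fJ: "finite (J i)" for i by (simp add: J_def)
    have "\<zeta> = (\<Prod>i\<in>insert es T. \<Prod>j\<in>J i. pw (x (i, j)) (u (i, j)))"
      using x(2) finite_T fJ unfolding comb_def idx_Sigma by (subst prod.Sigma) auto
    also have "\<dots> = (\<Prod>i\<in>S. \<Prod>j\<in>J i. pw (x (i, j)) (u (i, j)))"
    proof (rule prod.mono_neutral_right)
      show "\<forall>i\<in>insert es T - S. (\<Prod>j\<in>J i. pw (x (i, j)) (u (i, j))) = 1"
        using uU by (intro ballI prod.neutral) (auto simp: S_def pw_zero)
    qed (auto simp: S_def finite_T)
    also have "\<dots> = (\<Prod>i\<in>S. y i ^ (p ^ b i))"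
    proof (rule prod.cong[OF refl])
      fix i assume i: "i \<in> S"
      then have iT: "i \<in> insert es T" by (simp add: S_def)
      show "(\<Prod>j\<in>J i. pw (x (i, j)) (u (i, j))) = y i ^ (p ^ b i)"
        unfolding y_def prod_power_distrib
        using pw_shift[OF uU[OF iT] xc[OF iT] b_0[OF i]] by (intro prod.cong) auto
    qed
    finally show ?thesis .
  qed
  moreover have "S \<subseteq> insert es T" by (auto simp: S_def)
  ultimately show ?thesis by blast
qed

text \<open>Domination by a different element strictly lowers the sum of the two compared
  quantities: were both equal, injectivity of the iterates of \<rho> would make the elements
  equal.\<close>

lemma minimal_dominating:
  fixes b :: "nat \<Rightarrow> nat" and S :: "nat set"
  assumes "\<And>i. i \<in> S \<Longrightarrow> 1 \<le> i"
  defines "dominates \<equiv> \<lambda>i j. b i \<le> b j \<and> (\<rho> ^^ b i) i \<le> (\<rho> ^^ b j) j"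
  defines "I \<equiv> {j \<in> S. \<forall>i\<in>S. dominates i j \<longrightarrow> i = j}"
  assumes "j \<in> S"
  shows "\<exists>i\<in>I. dominates i j"
  using assms(4)
proof (induction "b j + (\<rho> ^^ b j) j" arbitrary: j rule: less_induct)
  case less
  show ?case
  proof (cases "j \<in> I")
    case True
    then show ?thesis by (auto simp: dominates_def)
  next
    case False
    then obtain i where i: "i \<in> S" "dominates i j" "i \<noteq> j" using less.prems by (auto simp: I_def)
    have "b i + (\<rho> ^^ b i) i \<noteq> b j + (\<rho> ^^ b j) j"
    proof
      assume "b i + (\<rho> ^^ b i) i = b j + (\<rho> ^^ b j) j"
      then have "b i = b j" "(\<rho> ^^ b i) i = (\<rho> ^^ b j) j" using i(2) by (auto simp: dominates_def)
      then show False using i less.prems shift_pow_inj[OF rho_shift assms(1) assms(1)] by simp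
    qed
    then have "b i + (\<rho> ^^ b i) i < b j + (\<rho> ^^ b j) j" using i(2) by (auto simp: dominates_def)
    from less.hyps[OF this i(1)] obtain k where "k \<in> I" "dominates k i" by blast
    then show ?thesis using i(2) by (auto simp: dominates_def intro: order_trans)
  qed
qed

text \<open>If \<rho>^d(j) exceeds \<open>i\<close>, the power lies in the next step. If it equals
  \<open>i\<close>, then d > 0 because i \<noteq> j, so \<open>i\<close> is not a gap; it is
  \<open>es\<close>, and the power is a p-th power from level \<open>i0\<close>.\<close>

lemma dominated_null:
  assumes i: "i \<in> insert es T" and j: "1 \<le> j" "y \<in> U j" "i \<noteq> j" and d: "i \<le> (\<rho> ^^ d) j"
  shows "y ^ (p ^ d) \<in> null i"
proof -
  have i1: "1 \<le> i" using i es_props(4) T_iff by auto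
  have yU: "y ^ (p ^ d) \<in> U ((\<rho> ^^ d) j)" by (rule U_p_pow_pow[OF j(2,1)])
  show ?thesis
  proof (cases "(\<rho> ^^ d) j = i")
    case False
    then have "Suc i \<le> (\<rho> ^^ d) j" using d by simp
    then show ?thesis using yU U_antimono U_Suc_null by blast
  next
    case True
    then have "i \<notin> T" using T_pow[of i j d] j by auto
    then have ies: "i = es" using i by simp
    obtain m where m: "d = Suc m" using True j(3) by (cases d) auto
    have mi: "(\<rho> ^^ m) j = i0"
      using True ies m shift_pow_inj[OF rho_shift shift_pow_ge1[OF rho_shift j(1)] zeta_absv(3), of 1 m]
      by (simp add: es_def)
    have "y ^ (p ^ d) = (y ^ (p ^ m)) ^ p * 1" by (simp add: m power_mult[symmetric] mult.commute)
    moreover have "y ^ (p ^ m) \<in> U i0" using U_p_pow_pow[OF j(2,1), of m] mi by simp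
    ultimately have "y ^ (p ^ d) \<in> crit" unfolding crit_def using U_one[of "Suc es"] by blast
    then show ?thesis using ies by (simp add: null_def)
  qed
qed

text \<open>The jump vector divided by \<open>p\<close>, as natural exponents on the vectors
  numbered 0: the jump vector encodes the relation \<zeta>^p = 1, this its root \<zeta>.\<close>

definition jump_exp :: "nat set \<times> (nat \<Rightarrow> nat) \<Rightarrow> nat \<times> nat \<Rightarrow> nat" where
  "jump_exp I\<beta> b = (if snd b = 0 \<and> fst b \<in> fst I\<beta> then p ^ (snd I\<beta> (fst b) - 1) else 0)"

text \<open>Among the factors of \<open>\<zeta>\<close>, those dominated by another one can be absorbed into the basis
  vector of the dominating factor; the remaining ones form a jump set.\<close>

lemma jump_basis_exists:
  "\<exists>u I \<beta>. basis u \<and> (I, \<beta>) \<in> ext_jump_sets \<rho> \<and> comb_nat u (jump_exp (I, \<beta>)) = \<zeta>"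
proof -
  obtain S y b where S: "S \<subseteq> insert es T" and y: "\<And>i. i \<in> S \<Longrightarrow> prim i (y i)"
    and zeta: "\<zeta> = (\<Prod>i\<in>S. y i ^ (p ^ b i))"
    using zeta_factorization by blast
  have finS: "finite S" using S finite_T finite_subset by blast
  have S1: "1 \<le> i" if "i \<in> S" for i using that S es_props(4) T_iff by auto
  define dominates where "dominates = (\<lambda>i j. b i \<le> b j \<and> (\<rho> ^^ b i) i \<le> (\<rho> ^^ b j) j)"
  define I where "I = {j \<in> S. \<forall>i\<in>S. dominates i j \<longrightarrow> i = j}"
  have IS: "I \<subseteq> S" by (auto simp: I_def)
  then have finI: "finite I" using finS finite_subset by blast
  have "\<forall>j\<in>S. \<exists>i\<in>I. dominates i j"
    using minimal_dominating[of S _ b] S1 unfolding I_def dominates_def by blast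
  then obtain m where m: "\<And>j. j \<in> S \<Longrightarrow> m j \<in> I \<and> dominates (m j) j" by metis
  have m_id: "m i = i" if "i \<in> I" for i
    using m[of i] that IS by (auto simp: I_def)
  \<comment> \<open>The share of the factor \<open>j\<close> absorbed at \<open>i\<close>,
    normalized so that its p^(b i)-th power is the original factor; this requires b i \<le> b j,
    which is part of domination.\<close>
  define q where "q i j = y j ^ (p ^ (b j - b i))" for i j
  define y' where "y' i = (\<Prod>j\<in>{j \<in> S. m j = i}. q i j)" for i
  have y': "prim i (y' i)" if i: "i \<in> I" for i
  proof -
    define R where "R = (\<Prod>j\<in>{j \<in> S. m j = i} - {i}. q i j)"
    have "i \<in> {j \<in> S. m j = i}" using i IS m_id by auto
    then have split: "y' i = y i * R"
      unfolding y'_def R_def using finS prod.remove[of "{j \<in> S. m j = i}" i "q i"] by (simp add: q_def)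
    have iS: "i \<in> S" "i \<in> insert es T" using i IS S by auto
    have dominates_i: "b i \<le> b j" "i \<le> (\<rho> ^^ (b j - b i)) j" if "j \<in> S" "m j = i" for j
    proof -
      have d: "b i \<le> b j" "(\<rho> ^^ b i) i \<le> (\<rho> ^^ b j) j" using m[OF that(1)] that(2) by (auto simp: dominates_def)
      moreover have "(\<rho> ^^ b j) j = (\<rho> ^^ b i) ((\<rho> ^^ (b j - b i)) j)"
        using d(1) by (metis funpow_add le_add_diff_inverse o_apply)
      ultimately show "b i \<le> b j" "i \<le> (\<rho> ^^ (b j - b i)) j"
        using shift_pow_le_iff[OF rho_shift S1[OF iS(1)] shift_pow_ge1[OF rho_shift S1[OF that(1)]]] by auto
    qed
    have qn: "q i j \<in> null i" if "j \<in> {j \<in> S. m j = i} - {i}" for j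
      unfolding q_def using that y[of j] dominates_i[of j] S1[of j]
      by (intro dominated_null[OF iS(2)]) (auto simp: prim_def)
    have Rn: "R \<in> null i" unfolding R_def using qn by (rule null_prod)
    have RU: "R \<in> U i"
      unfolding R_def q_def
    proof (rule U_prod[OF _ S1[OF iS(1)]])
      fix j assume j: "j \<in> {j \<in> S. m j = i} - {i}"
      then have "y j \<in> U j" using y by (auto simp: prim_def)
      from U_p_pow_pow[OF this, of "b j - b i"] show "y j ^ (p ^ (b j - b i)) \<in> U i"
        using dominates_i[of j] j S1 U_antimono by auto
    qed
    have "y' i \<in> U i" unfolding split using y[OF iS(1)] RU S1[OF iS(1)] by (intro U_mult) (auto simp: prim_def)
    moreover have "y' i \<notin> null i"
    proof
      assume "y' i \<in> null i"
      then have "y' i * inverse R \<in> null i" using Rn by (intro null_mult null_inverse)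
      moreover have "y' i * inverse R = y i"
        unfolding split using U_nonzero[OF RU S1[OF iS(1)]] by (simp add: mult.assoc)
      ultimately have "y i \<in> null i" by simp
      then show False using y[OF iS(1)] by (simp add: prim_def)
    qed
    ultimately show ?thesis by (simp add: prim_def)
  qed
  have zeta': "\<zeta> = (\<Prod>i\<in>I. y' i ^ (p ^ b i))"
  proof -
    have "(\<Prod>i\<in>I. y' i ^ (p ^ b i)) = (\<Prod>i\<in>I. \<Prod>j\<in>{j \<in> S. m j = i}. y j ^ (p ^ b j))"
    proof (rule prod.cong[OF refl])
      fix i assume "i \<in> I"
      show "y' i ^ (p ^ b i) = (\<Prod>j\<in>{j \<in> S. m j = i}. y j ^ (p ^ b j))"
        unfolding y'_def prod_power_distrib
      proof (rule prod.cong[OF refl])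
        fix j assume "j \<in> {j \<in> S. m j = i}"
        then have "b i \<le> b j" using m[of j] by (auto simp: dominates_def)
        then show "q i j ^ (p ^ b i) = y j ^ (p ^ b j)"
          by (simp add: q_def power_mult[symmetric] power_add[symmetric])
      qed
    qed
    also have "\<dots> = \<zeta>"
      unfolding zeta using m by (intro prod.group finS finI) auto
    finally show ?thesis by simp
  qed
  define \<beta> where "\<beta> = (\<lambda>i\<in>I. Suc (b i))"
  have jump: "(I, \<beta>) \<in> ext_jump_sets \<rho>"
    unfolding ext_jump_sets_def
  proof (intro CollectI case_prodI conjI)
    show "I \<subseteq> shift_gaps_star \<rho>" using IS S gaps_star_eq by blast
    show "finite I" by (rule finI)
    show "\<beta> \<in> I \<rightarrow>\<^sub>E {1..}" by (auto simp: \<beta>_def)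
    \<comment> \<open>If b i \<le> b j for i < j, monotonicity of the iterates of \<rho> would make
      \<open>i\<close> dominate \<open>j\<close>, against minimality of \<open>j\<close>.\<close>
    have lt: "b j < b i" if ij: "i \<in> I" "j \<in> I" "i < j" for i j
    proof (rule ccontr)
      assume "\<not> b j < b i"
      then have "b i \<le> b j" by simp
      moreover have "(\<rho> ^^ b i) i \<le> (\<rho> ^^ b i) j" "(\<rho> ^^ b i) j \<le> (\<rho> ^^ b j) j"
        using ij IS S1 shift_pow_less[OF rho_shift, of i j "b i"] shift_pow_mono[OF rho_shift, of j "b i" "b j"] calculation
        by (auto simp: less_imp_le)
      ultimately have "dominates i j" by (simp add: dominates_def)
      then show False using ij IS by (auto simp: I_def)
    qed
    then show "strict_antimono_on I \<beta>" by (auto simp: monotone_on_def \<beta>_def)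
    show "strict_mono_on I (\<lambda>i. (\<rho> ^^ \<beta> i) i)"
    proof (rule strict_mono_onI)
      fix i j assume ij: "i \<in> I" "j \<in> I" "i < j"
      have ge1: "1 \<le> i" "1 \<le> j" using ij IS S1 by auto
      have "(\<rho> ^^ b i) i < (\<rho> ^^ b j) j"
      proof (rule ccontr)
        assume "\<not> (\<rho> ^^ b i) i < (\<rho> ^^ b j) j"
        then have "dominates j i" using lt[OF ij] by (simp add: dominates_def)
        then show False using ij IS by (auto simp: I_def)
      qed
      then show "(\<rho> ^^ \<beta> i) i < (\<rho> ^^ \<beta> j) j"
        using ij shiftD(2)[OF rho_shift shift_pow_ge1[OF rho_shift ge1(1)]] by (simp add: \<beta>_def)
    qed
  qed
  obtain y0 where y0: "\<And>i. i \<in> insert es T \<Longrightarrow> prim i (y0 i)" using prim_exists by metis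
  have prim_all: "prim i (if i \<in> I then y' i else y0 i)" if "i \<in> insert es T" for i
    using y0[OF that] y' by simp
  obtain u where u: "basis u" "\<forall>i\<in>insert es T. u (i, 0) = (if i \<in> I then y' i else y0 i)"
    using basis_extend[of "\<lambda>i. if i \<in> I then y' i else y0 i", OF prim_all] by blast
  have "comb_nat u (jump_exp (I, \<beta>)) = (\<Prod>b\<in>I \<times> {0}. u b ^ jump_exp (I, \<beta>) b)"
    unfolding comb_nat_def
  proof (rule prod.mono_neutral_right[OF finite_idx])
    show "I \<times> {0} \<subseteq> idx" using IS S f_pos by (auto simp: idx_def)
    show "\<forall>b\<in>idx - I \<times> {0}. u b ^ jump_exp (I, \<beta>) b = 1" by (auto simp: jump_exp_def)
  qed
  also have "\<dots> = (\<Prod>i\<in>I. u (i, 0) ^ jump_exp (I, \<beta>) (i, 0))"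
    by (rule prod.reindex_bij_witness[of _ "\<lambda>i. (i, 0)" fst]) auto
  also have "\<dots> = \<zeta>"
    unfolding zeta' using u(2) IS S by (intro prod.cong) (auto simp: jump_exp_def \<beta>_def)
  finally show ?thesis using u(1) jump by blast
qed

text \<open>As \<zeta> lies outside U (i0 + 1), some coordinate has weight exactly
  \<open>i0\<close>, reached after \<open>k\<close> applications of \<rho>. Its exponent is a power
  p^a: weight beyond \<open>i0\<close> fails, so a \<le> k, and weight \<open>i0\<close> holds, so a
  is not below k.\<close>

lemma zeta_expr_jump:
  assumes u: "basis u" and z: "comb_nat u (jump_exp I\<beta>) = \<zeta>"
  shows "\<exists>b0 a. zeta_expr u (jump_exp I\<beta>) b0 a"
proof -
  define x where "x b = Zp_of_int p (int (jump_exp I\<beta> b))" for b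
  have x: "x \<in> exps" unfolding exps_def x_def using Zp_of_int_closed[OF p_pos] by blast
  have "comb u x = comb_nat u (jump_exp I\<beta>)"
    unfolding comb_def comb_nat_def x_def using basis_U1[OF u] by (intro prod.cong) (auto simp: pw_of_nat)
  then have "wt x i0"
    using z zeta_U(1) zeta_absv(3) es_props(3) by (intro wt_es[OF u x]) auto
  then have w: "wt_nat (jump_exp I\<beta>) i0"
    by (subst wt_nat_iff[OF x order_refl]) (simp_all add: x_def Zp_of_int_def)
  have "\<not> wt_nat (jump_exp I\<beta>) (Suc i0)"
    using comb_nat_U[OF u, of "jump_exp I\<beta>" "Suc i0"] z zeta_U(2) by auto
  then obtain b k where b: "b \<in> idx" "(\<rho> ^^ k) (fst b) < Suc i0" "\<not> p ^ Suc k dvd jump_exp I\<beta> b"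
    unfolding wt_nat_def by blast
  then have k: "(\<rho> ^^ k) (fst b) = i0" using wt_natD[OF w b(1), of k] by force
  obtain a where a: "jump_exp I\<beta> b = p ^ a" using b(3) by (auto simp: jump_exp_def split: if_splits)
  have "a \<le> k" using b(3) le_imp_power_dvd[of "Suc k" a p] unfolding a by (metis not_less_eq_eq)
  moreover have "\<not> a < k"
  proof
    assume "a < k"
    then have "p ^ Suc a dvd p ^ a"
      using shift_pow_increasing[OF rho_shift idx_ge1[OF b(1)], of a k] k wt_natD[OF w b(1), of a] unfolding a by simp
    then show False using p2 power_dvd_imp_le[of p "Suc a" a] by simp
  qed
  ultimately have "a = k" by simp
  then show ?thesis using z w b(1) a k unfolding zeta_expr_def by blast
qed

section \<open>Linearity of the parametrization and its kernel\<close>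

lemma comb_add:
  assumes "basis u" "x \<in> exps" "y \<in> exps"
  shows "comb u (\<lambda>b. x b \<oplus>\<^bsub>Zp p\<^esub> y b) = comb u x * comb u y"
  unfolding comb_def prod.distrib[symmetric]
  using assms basis_U1 by (intro prod.cong) (auto simp: exps_def pw_add)

lemma comb_smult:
  assumes "basis u" "x \<in> exps" "a \<in> carrier (Zp p)"
  shows "comb u (\<lambda>b. a \<otimes>\<^bsub>Zp p\<^esub> x b) = pw a (comb u x)"
proof -
  have U1: "pw (x b) (u b) \<in> U 1" if "b \<in> idx" for b
    using assms(2) basis_U1[OF assms(1) that] that by (intro pw_U) (auto simp: exps_def)
  have "pw a (\<Prod>b\<in>idx. pw (x b) (u b)) = (\<Prod>b\<in>idx. pw a (pw (x b) (u b)))"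
    by (rule pw_prod[OF assms(3) U1])
  also have "\<dots> = (\<Prod>b\<in>idx. pw (a \<otimes>\<^bsub>Zp p\<^esub> x b) (u b))"
    using assms basis_U1 by (intro prod.cong) (auto simp: exps_def pw_mult)
  finally show ?thesis by (simp add: comb_def)
qed

lemma comb_cong: "(\<And>b. b \<in> idx \<Longrightarrow> x b = y b) \<Longrightarrow> comb u x = comb u y"
  unfolding comb_def by (rule prod.cong) auto

definition jump_exp_p :: "nat set \<times> (nat \<Rightarrow> nat) \<Rightarrow> nat \<times> nat \<Rightarrow> nat \<Rightarrow> int" where
  "jump_exp_p I\<beta> b = Zp_of_int p (int p * int (jump_exp I\<beta> b))"

lemma jump_exp_p_exps: "jump_exp_p I\<beta> \<in> exps"
  unfolding exps_def jump_exp_p_def using Zp_of_int_closed[OF p_pos] by blast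

lemma comb_jump_exp_p:
  assumes "basis u" "comb_nat u (jump_exp I\<beta>) = \<zeta>"
  shows "comb u (jump_exp_p I\<beta>) = 1"
proof -
  have "comb u (jump_exp_p I\<beta>) = comb_nat u (\<lambda>b. p * jump_exp I\<beta> b)"
    unfolding comb_def comb_nat_def
  proof (rule prod.cong[OF refl])
    fix b assume "b \<in> idx"
    then show "pw (jump_exp_p I\<beta> b) (u b) = u b ^ (p * jump_exp I\<beta> b)"
      using pw_of_nat[of "u b" "p * jump_exp I\<beta> b"] basis_U1[OF assms(1)] by (simp add: jump_exp_p_def)
  qed
  then show ?thesis using assms(2) zeta_power by (simp add: comb_nat_mult)
qed

text \<open>A relation \<open>x\<close> has weight \<open>es\<close>, so at \<open>b0\<close>, whose
  a-th iterate is i0 < es, it is divisible by p^(a + 1), the value of the known relation there.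
  Subtracting that multiple clears the coordinate \<open>b0\<close>, and \<open>comb_eq_1\<close>
  does the rest.\<close>

lemma comb_kernel:
  assumes u: "basis u" and z: "comb_nat u (jump_exp I\<beta>) = \<zeta>" and x: "x \<in> exps"
  shows "comb u x = 1 \<longleftrightarrow> (\<exists>c\<in>carrier (Zp p). \<forall>b\<in>idx. x b = c \<otimes>\<^bsub>Zp p\<^esub> jump_exp_p I\<beta> b)"
proof
  assume "\<exists>c\<in>carrier (Zp p). \<forall>b\<in>idx. x b = c \<otimes>\<^bsub>Zp p\<^esub> jump_exp_p I\<beta> b"
  then obtain c where c: "c \<in> carrier (Zp p)" "\<forall>b\<in>idx. x b = c \<otimes>\<^bsub>Zp p\<^esub> jump_exp_p I\<beta> b" by blast
  then have "comb u x = comb u (\<lambda>b. c \<otimes>\<^bsub>Zp p\<^esub> jump_exp_p I\<beta> b)" by (intro comb_cong) simp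
  also have "\<dots> = 1"
    using comb_smult[OF u jump_exp_p_exps c(1)] comb_jump_exp_p[OF u z] pw_one_base[OF c(1)] by simp
  finally show "comb u x = 1" .
next
  assume 1: "comb u x = 1"
  interpret Z: cring "Zp p" by (rule Zp_cring[OF p_pos])
  obtain b0 a where ze: "zeta_expr u (jump_exp I\<beta>) b0 a" using zeta_expr_jump[OF u z] by blast
  then have b0: "b0 \<in> idx" "jump_exp I\<beta> b0 = p ^ a" "(\<rho> ^^ a) (fst b0) = i0" by (auto simp: zeta_expr_def)
  have xc: "x b \<in> carrier (Zp p)" if "b \<in> idx" for b using x that by (simp add: exps_def)
  have "wt x es" using 1 es_props(4) by (intro wt_es[OF u x]) auto
  then have x0: "x b0 (Suc a) = 0" using b0 es_props(3) by (simp add: wt_def)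
  define c where "c = Zp_shift p (Suc a) (x b0)"
  have c: "c \<in> carrier (Zp p)" unfolding c_def by (rule Zp_shift_closed[OF p_pos xc[OF b0(1)] x0])
  have jc: "jump_exp_p I\<beta> b \<in> carrier (Zp p)" for b
    unfolding jump_exp_p_def by (rule Zp_of_int_closed[OF p_pos])
  have cx: "c \<otimes>\<^bsub>Zp p\<^esub> jump_exp_p I\<beta> b0 = x b0"
    using Zp_shift_mult[OF p_pos xc[OF b0(1)] x0] c jc[of b0]
    by (simp add: jump_exp_p_def b0(2) c_def Z.m_comm)
  define x' where "x' b = x b \<ominus>\<^bsub>Zp p\<^esub> c \<otimes>\<^bsub>Zp p\<^esub> jump_exp_p I\<beta> b" for b
  have x': "x' \<in> exps" unfolding exps_def x'_def using xc c jc by auto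
  have cj: "(\<lambda>b. c \<otimes>\<^bsub>Zp p\<^esub> jump_exp_p I\<beta> b) \<in> exps" unfolding exps_def using c jc by auto
  have cj1: "comb u (\<lambda>b. c \<otimes>\<^bsub>Zp p\<^esub> jump_exp_p I\<beta> b) = 1"
    using comb_smult[OF u jump_exp_p_exps c] comb_jump_exp_p[OF u z] pw_one_base[OF c] by simp
  have eq: "x' b \<oplus>\<^bsub>Zp p\<^esub> c \<otimes>\<^bsub>Zp p\<^esub> jump_exp_p I\<beta> b = x b" if "b \<in> idx" for b
    unfolding x'_def using xc[OF that] c jc by (simp add: Z.minus_eq Z.a_assoc Z.l_neg)
  have "comb u x' * comb u (\<lambda>b. c \<otimes>\<^bsub>Zp p\<^esub> jump_exp_p I\<beta> b) = comb u x"
    unfolding comb_add[OF u x' cj, symmetric] by (rule comb_cong) (rule eq)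
  then have "comb u x' = 1" using 1 cj1 by simp
  moreover have "x' b0 = \<zero>\<^bsub>Zp p\<^esub>" unfolding x'_def cx using xc[OF b0(1)] by (simp add: Z.minus_eq Z.r_neg)
  ultimately have "x' b = \<zero>\<^bsub>Zp p\<^esub>" if "b \<in> idx" for b using comb_eq_1[OF u ze x'] that by blast
  then have "x b = c \<otimes>\<^bsub>Zp p\<^esub> jump_exp_p I\<beta> b" if "b \<in> idx" for b
    using eq[OF that] that c jc by simp
  then show "\<exists>c\<in>carrier (Zp p). \<forall>b\<in>idx. x b = c \<otimes>\<^bsub>Zp p\<^esub> jump_exp_p I\<beta> b" using c by blast
qed

subsection \<open>The isomorphism\<close>

definition flat :: "(nat \<Rightarrow> nat \<Rightarrow> nat \<Rightarrow> int) \<Rightarrow> (nat \<Rightarrow> nat \<Rightarrow> int) \<Rightarrow> nat \<times> nat \<Rightarrow> nat \<Rightarrow> int" where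
  "flat a y b = (if snd b = 0 then y (fst b) else a (snd b - 1) (fst b))"

text \<open>With a free predicate \<open>Q\<close>, one reindexing serves both the carrier condition
  and the weight condition.\<close>

lemma ball_idx_flat:
  "(\<forall>b\<in>idx. Q (fst b) (flat a y b)) \<longleftrightarrow>
   (\<forall>i\<in>shift_gaps_star \<rho>. Q i (y i)) \<and> (\<forall>j<f - 1. \<forall>i\<in>T. Q i (a j i))"
proof
  assume L: "\<forall>b\<in>idx. Q (fst b) (flat a y b)"
  have "Q i (y i)" if "i \<in> shift_gaps_star \<rho>" for i
    using L[rule_format, of "(i, 0)"] that f_pos by (auto simp: idx_def flat_def gaps_star_eq)
  moreover have "Q i (a j i)" if "j < f - 1" "i \<in> T" for i j
    using L[rule_format, of "(i, Suc j)"] that by (auto simp: idx_def flat_def)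
  ultimately show "(\<forall>i\<in>shift_gaps_star \<rho>. Q i (y i)) \<and> (\<forall>j<f - 1. \<forall>i\<in>T. Q i (a j i))" by blast
next
  assume R: "(\<forall>i\<in>shift_gaps_star \<rho>. Q i (y i)) \<and> (\<forall>j<f - 1. \<forall>i\<in>T. Q i (a j i))"
  show "\<forall>b\<in>idx. Q (fst b) (flat a y b)"
  proof
    fix b assume b: "b \<in> idx"
    show "Q (fst b) (flat a y b)"
    proof (cases "snd b")
      case 0
      then show ?thesis using R b by (auto simp: idx_def flat_def gaps_star_eq)
    next
      case (Suc j)
      then have "j < f - 1" "fst b \<in> T" using b by (auto simp: idx_def)
      then show ?thesis using R Suc by (simp add: flat_def)
    qed
  qed
qed

lemma flat_exps_iff:
  assumes "a \<in> extensional {..<f - 1}" "\<And>j. j < f - 1 \<Longrightarrow> a j \<in> extensional T" "y \<in> extensional (shift_gaps_star \<rho>)"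
  shows "flat a y \<in> exps \<longleftrightarrow> a \<in> carrier (fm_power (M_mod p \<rho>) (f - 1)) \<and> y \<in> carrier (M_star_mod p \<rho>)"
  unfolding exps_def mem_Collect_eq ball_idx_flat[of "\<lambda>i x. x \<in> carrier (Zp p)"]
    fm_power_M_mod_sel M_star_mod_sel PiE_iff using assms by auto

lemma flat_filt_iff:
  assumes "a \<in> carrier (fm_power (M_mod p \<rho>) (f - 1))" "y \<in> carrier (M_star_mod p \<rho>)"
  shows "wt (flat a y) n \<longleftrightarrow> a \<in> filt (fm_power (M_mod p \<rho>) (f - 1)) n \<and> y \<in> filt (M_star_mod p \<rho>) n"
proof -
  have S: "x \<in> filt (S_mod p \<rho> i) n \<longleftrightarrow> x \<in> carrier (Zp p) \<and> (\<forall>k. (\<rho> ^^ k) i < n \<longrightarrow> x (Suc k) = 0)"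
    if "i \<in> shift_gaps_star \<rho>" for i x
    using S_filt_iff[OF p_pos rho_shift shift_gaps_star_ge1[OF that]] .
  have TS: "T \<subseteq> shift_gaps_star \<rho>" by (auto simp: gaps_star_eq)
  show ?thesis
    unfolding wt_def ball_idx_flat[of "\<lambda>i x. \<forall>k. (\<rho> ^^ k) i < n \<longrightarrow> x (Suc k) = 0"]
    using assms TS unfolding fm_power_M_mod_sel M_star_mod_sel PiE_iff by (auto simp: S subset_eq)
qed

lemma unflat:
  assumes "x \<in> exps"
  shows "\<exists>a\<in>carrier (fm_power (M_mod p \<rho>) (f - 1)). \<exists>y\<in>carrier (M_star_mod p \<rho>). \<forall>b\<in>idx. flat a y b = x b"
proof -
  define a where "a = (\<lambda>j\<in>{..<f - 1}. \<lambda>i\<in>T. x (i, Suc j))"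
  define y where "y = (\<lambda>i\<in>shift_gaps_star \<rho>. x (i, 0))"
  have eq: "flat a y b = x b" if "b \<in> idx" for b
  proof (cases "snd b")
    case 0
    then show ?thesis using that by (cases b) (auto simp: flat_def y_def idx_def gaps_star_eq)
  next
    case (Suc j)
    then show ?thesis using that by (cases b) (auto simp: flat_def a_def idx_def)
  qed
  then have "flat a y \<in> exps" using assms by (simp add: exps_def)
  then have "a \<in> carrier (fm_power (M_mod p \<rho>) (f - 1))" "y \<in> carrier (M_star_mod p \<rho>)"
    using flat_exps_iff[of a y] by (auto simp: a_def y_def)
  then show ?thesis using eq by blast
qed

lemma flat_add:
  assumes "b \<in> idx"
  shows "flat (a \<oplus>\<^bsub>fm_power (M_mod p \<rho>) (f - 1)\<^esub> a') (y \<oplus>\<^bsub>M_star_mod p \<rho>\<^esub> y') b =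
    flat a y b \<oplus>\<^bsub>Zp p\<^esub> flat a' y' b"
  using assms by (auto simp: flat_def fm_power_M_mod_sel M_star_mod_sel idx_def gaps_star_eq)

lemma flat_smult:
  assumes "b \<in> idx"
  shows "flat (c \<odot>\<^bsub>fm_power (M_mod p \<rho>) (f - 1)\<^esub> a) (c \<odot>\<^bsub>M_star_mod p \<rho>\<^esub> y) b =
    c \<otimes>\<^bsub>Zp p\<^esub> flat a y b"
  using assms by (auto simp: flat_def fm_power_M_mod_sel M_star_mod_sel idx_def gaps_star_eq)

lemma flat_jump_vector:
  assumes "(I, \<beta>) \<in> ext_jump_sets \<rho>" "b \<in> idx"
  shows "flat \<zero>\<^bsub>fm_power (M_mod p \<rho>) (f - 1)\<^esub> (jump_vector p \<rho> (I, \<beta>)) b = jump_exp_p (I, \<beta>) b"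
proof -
  have "int p * int p ^ (\<beta> i - Suc 0) = int p ^ \<beta> i" if "i \<in> I" for i
  proof -
    have "\<beta> i \<ge> 1" using assms(1) that by (auto simp: ext_jump_sets_def)
    then show ?thesis by (cases "\<beta> i") auto
  qed
  moreover have "Zp_of_int p 0 = \<zero>\<^bsub>Zp p\<^esub>" by (simp add: Zp_of_int_def Zp_zero)
  ultimately show ?thesis
    using assms(2) by (auto simp: flat_def fm_power_M_mod_sel jump_vector_def jump_exp_p_def jump_exp_def
        idx_def gaps_star_eq)
qed

lemma principal_units_iso:
  assumes u: "basis u" and J: "(I, \<beta>) \<in> ext_jump_sets \<rho>" and z: "comb_nat u (jump_exp (I, \<beta>)) = \<zeta>"
  shows "fm_iso (Zp p) (principal_units absv) (jump_target p \<rho> (f - 1) (I, \<beta>))"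
proof -
  define P where "P = fm_power (M_mod p \<rho>) (f - 1)"
  define M where "M = M_star_mod p \<rho>"
  define v where "v = jump_vector p \<rho> (I, \<beta>)"
  define N where "N = cyclic_span (Zp p) M v"
  interpret Z: cring "Zp p" by (rule Zp_cring[OF p_pos])
  interpret M: module "Zp p" M unfolding M_def by (rule M_star_mod_module[OF p_pos])
  interpret P: module "Zp p" P
    unfolding P_def M_mod_def fm_power_def by (intro fm_prod_module Zp_cring S_mod_module p_pos)
  have v: "v \<in> carrier M" unfolding v_def M_def by (rule jump_vector_closed[OF p_pos])
  have N: "submodule N (Zp p) M" unfolding N_def by (rule M.cyclic_span_submodule[OF v])
  interpret N: abelian_subgroup N M by (rule M.submodule_abelian_subgroup[OF N])
  have target: "jump_target p \<rho> (f - 1) (I, \<beta>) = P \<oplus>\<^sub>f fm_quotient M N"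
    by (simp add: P_def M_def N_def v_def)
  define \<Phi> where "\<Phi> a y = comb u (flat a y)" for a y
  have exps: "flat a y \<in> exps" if "a \<in> carrier P" "y \<in> carrier M" for a y
    using flat_exps_iff[of a y] that unfolding P_def M_def fm_power_M_mod_sel M_star_mod_sel PiE_iff by auto
  have \<Phi>_U1: "\<Phi> a y \<in> U 1" if "a \<in> carrier P" "y \<in> carrier M" for a y
    unfolding \<Phi>_def by (rule comb_U1[OF u exps[OF that]])
  have \<Phi>_add: "\<Phi> (a \<oplus>\<^bsub>P\<^esub> a') (y \<oplus>\<^bsub>M\<^esub> y') = \<Phi> a y * \<Phi> a' y'"
    if "a \<in> carrier P" "y \<in> carrier M" "a' \<in> carrier P" "y' \<in> carrier M" for a y a' y'
    unfolding \<Phi>_def comb_add[OF u exps[OF that(1,2)] exps[OF that(3,4)], symmetric]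
    unfolding P_def M_def by (rule comb_cong) (rule flat_add)
  have \<Phi>_smult: "\<Phi> (c \<odot>\<^bsub>P\<^esub> a) (c \<odot>\<^bsub>M\<^esub> y) = pw c (\<Phi> a y)"
    if "a \<in> carrier P" "y \<in> carrier M" "c \<in> carrier (Zp p)" for a y c
    unfolding \<Phi>_def comb_smult[OF u exps[OF that(1,2)] that(3), symmetric]
    unfolding P_def M_def by (rule comb_cong) (rule flat_smult)
  have flat_inj: "a = a' \<and> y = y'" if "a \<in> carrier P" "y \<in> carrier M" "a' \<in> carrier P" "y' \<in> carrier M"
    "\<forall>b\<in>idx. flat a y b = flat a' y' b" for a y a' y'
  proof -
    have "y i = y' i" if "i \<in> shift_gaps_star \<rho>" for i
      using \<open>\<forall>b\<in>idx. flat a y b = flat a' y' b\<close>[rule_format, of "(i, 0)"] that f_pos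
      by (auto simp: idx_def flat_def gaps_star_eq)
    moreover have "a j i = a' j i" if "j < f - 1" "i \<in> T" for i j
      using \<open>\<forall>b\<in>idx. flat a y b = flat a' y' b\<close>[rule_format, of "(i, Suc j)"] that
      by (auto simp: idx_def flat_def)
    ultimately have y: "y = y'" and a: "\<And>j. j < f - 1 \<Longrightarrow> a j = a' j"
      using that(1-4) unfolding M_def P_def fm_power_M_mod_sel
      by (auto intro!: M_star_ext[of y p \<rho> y'] PiE_ext[of "a _" T _ "a' _"])
    have "a = a'"
      using that(1,3) a unfolding P_def fm_power_M_mod_sel by (auto intro!: PiE_ext[of a "{..<f - 1}" _ a'])
    with y show ?thesis by simp
  qed
  have kernel: "\<Phi> a y = 1 \<longleftrightarrow> a = \<zero>\<^bsub>P\<^esub> \<and> y \<in> N" if ay: "a \<in> carrier P" "y \<in> carrier M" for a y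
  proof -
    have eq: "flat \<zero>\<^bsub>P\<^esub> (c \<odot>\<^bsub>M\<^esub> v) b = c \<otimes>\<^bsub>Zp p\<^esub> jump_exp_p (I, \<beta>) b"
      if "c \<in> carrier (Zp p)" "b \<in> idx" for c b
      using flat_smult[OF that(2), of c "\<zero>\<^bsub>P\<^esub>" v, folded P_def M_def] P.smult_r_null[OF that(1)]
        flat_jump_vector[OF J that(2)] by (simp add: P_def v_def)
    have "\<Phi> a y = 1 \<longleftrightarrow> (\<exists>c\<in>carrier (Zp p). \<forall>b\<in>idx. flat a y b = c \<otimes>\<^bsub>Zp p\<^esub> jump_exp_p (I, \<beta>) b)"
      unfolding \<Phi>_def by (rule comb_kernel[OF u z exps[OF ay]])
    also have "\<dots> \<longleftrightarrow> (\<exists>c\<in>carrier (Zp p). \<forall>b\<in>idx. flat a y b = flat \<zero>\<^bsub>P\<^esub> (c \<odot>\<^bsub>M\<^esub> v) b)"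
      using eq by auto
    also have "\<dots> \<longleftrightarrow> (\<exists>c\<in>carrier (Zp p). a = \<zero>\<^bsub>P\<^esub> \<and> y = c \<odot>\<^bsub>M\<^esub> v)"
      using flat_inj[OF ay P.M.zero_closed] v by blast
    also have "\<dots> \<longleftrightarrow> a = \<zero>\<^bsub>P\<^esub> \<and> y \<in> N" unfolding N_def cyclic_span_def by blast
    finally show ?thesis .
  qed
  have \<Phi>_zero: "\<Phi> \<zero>\<^bsub>P\<^esub> \<zero>\<^bsub>M\<^esub> = 1" using kernel[OF P.M.zero_closed M.M.zero_closed] by simp
  have \<Phi>_eq: "\<Phi> a y = \<Phi> a' y' \<longleftrightarrow> a = a' \<and> N +>\<^bsub>M\<^esub> y = N +>\<^bsub>M\<^esub> y'"
    if ay: "a \<in> carrier P" "y \<in> carrier M" "a' \<in> carrier P" "y' \<in> carrier M" for a y a' y'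
  proof -
    define d where "d = a \<ominus>\<^bsub>P\<^esub> a'"
    define w where "w = y \<ominus>\<^bsub>M\<^esub> y'"
    have dw: "d \<in> carrier P" "w \<in> carrier M" unfolding d_def w_def using ay by auto
    have ad: "a = d \<oplus>\<^bsub>P\<^esub> a'" and yw: "y = w \<oplus>\<^bsub>M\<^esub> y'" unfolding d_def w_def using ay
      by (simp_all add: P.M.minus_eq M.M.minus_eq P.M.a_assoc M.M.a_assoc P.M.l_neg M.M.l_neg)
    have "\<Phi> a y = \<Phi> d w * \<Phi> a' y'" unfolding ad yw using \<Phi>_add[OF dw ay(3,4)] by simp
    then have "\<Phi> a y = \<Phi> a' y' \<longleftrightarrow> \<Phi> d w = 1" using U_nonzero[OF \<Phi>_U1[OF ay(3,4)]] by auto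
    also have "\<dots> \<longleftrightarrow> d = \<zero>\<^bsub>P\<^esub> \<and> w \<in> N" by (rule kernel[OF dw])
    also have "d = \<zero>\<^bsub>P\<^esub> \<longleftrightarrow> a = a'"
      using ad ay by (auto simp: d_def P.M.minus_eq P.M.r_neg)
    also have "w \<in> N \<longleftrightarrow> N +>\<^bsub>M\<^esub> y = N +>\<^bsub>M\<^esub> y'"
    proof -
      have "w = n" if "n \<in> carrier M" "y = n \<oplus>\<^bsub>M\<^esub> y'" for n
        unfolding w_def that(2) using that(1) ay(4) by (simp add: M.M.minus_eq M.M.a_assoc M.M.r_neg)
      then show ?thesis
        unfolding M.coset_eq_iff[OF N ay(2,4)]
        using yw M.submoduleE(1)[OF N] by blast
    qed
    finally show ?thesis .
  qed
  have \<Phi>_surj: "\<exists>a\<in>filt P n. \<exists>y\<in>filt M n. a \<in> carrier P \<and> y \<in> carrier M \<and> \<Phi> a y = x"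
    if x: "x \<in> U n" and n: "1 \<le> n" for x n
  proof -
    obtain X' where X': "X' \<in> exps" "wt X' n" "comb u X' = x" using comb_surj[OF u n x] by blast
    obtain a y where ay: "a \<in> carrier P" "y \<in> carrier M" "\<forall>b\<in>idx. flat a y b = X' b"
      using unflat[OF X'(1)] unfolding P_def M_def by blast
    have "wt (flat a y) n" using X'(2) ay(3) by (simp add: wt_def)
    then have "a \<in> filt P n" "y \<in> filt M n"
      using flat_filt_iff ay(1,2) unfolding P_def M_def by auto
    moreover have "\<Phi> a y = x" unfolding \<Phi>_def X'(3)[symmetric] using ay(3) by (intro comb_cong) simp
    ultimately show ?thesis using ay by blast
  qed
  have filt_carrier: "filt P n \<subseteq> carrier P" "filt M n \<subseteq> carrier M" for n
    unfolding P_def M_def fm_power_M_mod_sel M_star_mod_sel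
    using S_filt_iff[OF p_pos rho_shift] shift_gaps_star_ge1 T_iff by (auto simp: PiE_iff)
  have \<Phi>_U: "\<Phi> a y \<in> U n" if "a \<in> filt P n" "y \<in> filt M n" "1 \<le> n" for a y n
  proof -
    have c: "a \<in> carrier P" "y \<in> carrier M" using that filt_carrier by auto
    then have "wt (flat a y) n" using flat_filt_iff that unfolding P_def M_def by blast
    then show ?thesis unfolding \<Phi>_def by (rule comb_U[OF u exps[OF c] that(3)])
  qed
  \<comment> \<open>The map goes from the units to the quotient, by choosing a preimage under
    \<Phi>, because \<open>fm_iso_transport\<close> starts from a known filtered module;
    independence of the choice is \<Phi>_eq.\<close>
  define \<theta> where "\<theta> x = (let ay = SOME ay. fst ay \<in> carrier P \<and> snd ay \<in> carrier M \<and> \<Phi> (fst ay) (snd ay) = x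
    in (fst ay, N +>\<^bsub>M\<^esub> snd ay))" for x
  have \<theta>: "\<theta> (\<Phi> a y) = (a, N +>\<^bsub>M\<^esub> y)" if ay: "a \<in> carrier P" "y \<in> carrier M" for a y
  proof -
    define ay' where "ay' = (SOME ay. fst ay \<in> carrier P \<and> snd ay \<in> carrier M \<and> \<Phi> (fst ay) (snd ay) = \<Phi> a y)"
    have "fst ay' \<in> carrier P \<and> snd ay' \<in> carrier M \<and> \<Phi> (fst ay') (snd ay') = \<Phi> a y"
      unfolding ay'_def by (rule someI[of _ "(a, y)"]) (use ay in simp)
    then have "fst ay' = a" "N +>\<^bsub>M\<^esub> snd ay' = N +>\<^bsub>M\<^esub> y" using \<Phi>_eq ay by blast+
    then show ?thesis unfolding \<theta>_def ay'_def[symmetric] Let_def by simp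
  qed
  have U1: "carrier (principal_units absv) = U 1" "\<zero>\<^bsub>principal_units absv\<^esub> = 1"
    "x \<oplus>\<^bsub>principal_units absv\<^esub> y = x * y" "c \<odot>\<^bsub>principal_units absv\<^esub> x = pw c x"
    "filt (principal_units absv) n = U n" for x y c n
    by (simp_all add: principal_units_def higher_units_U)
  have obt: "\<exists>a y. a \<in> carrier P \<and> y \<in> carrier M \<and> x = \<Phi> a y" if "x \<in> U 1" for x
    using \<Phi>_surj[OF that] by blast
  show ?thesis
    unfolding target
  proof (rule fm_iso_transport[OF principal_units_filtered_module, of \<theta>])
    show "bij_betw \<theta> (carrier (principal_units absv)) (carrier (P \<oplus>\<^sub>f fm_quotient M N))"
      unfolding bij_betw_def
    proof
      show "inj_on \<theta> (carrier (principal_units absv))"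
        unfolding U1
      proof (rule inj_onI)
        fix x x' assume "x \<in> U 1" "x' \<in> U 1" and eq: "\<theta> x = \<theta> x'"
        then obtain a y a' y' where x: "a \<in> carrier P" "y \<in> carrier M" "x = \<Phi> a y"
          and x': "a' \<in> carrier P" "y' \<in> carrier M" "x' = \<Phi> a' y'" using obt by metis
        have "a = a' \<and> N +>\<^bsub>M\<^esub> y = N +>\<^bsub>M\<^esub> y'"
          using eq unfolding x(3) x'(3) \<theta>[OF x(1,2)] \<theta>[OF x'(1,2)] by simp
        then show "x = x'" unfolding x(3) x'(3) \<Phi>_eq[OF x(1,2) x'(1,2)] .
      qed
      show "\<theta> ` carrier (principal_units absv) = carrier (P \<oplus>\<^sub>f fm_quotient M N)"
        unfolding U1 fm_sum_quotient_sel
      proof (intro equalityI subsetI)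
        fix t assume "t \<in> \<theta> ` U 1"
        then obtain a y where "a \<in> carrier P" "y \<in> carrier M" "t = (a, N +>\<^bsub>M\<^esub> y)" using obt \<theta> by blast
        then show "t \<in> carrier P \<times> a_rcosets\<^bsub>M\<^esub> N" by (auto simp: A_RCOSETS_def')
      next
        fix t assume "t \<in> carrier P \<times> a_rcosets\<^bsub>M\<^esub> N"
        then obtain a y where "a \<in> carrier P" "y \<in> carrier M" "t = (a, N +>\<^bsub>M\<^esub> y)" by (auto simp: A_RCOSETS_def')
        then show "t \<in> \<theta> ` U 1" using \<theta>[of a y] \<Phi>_U1[of a y] by (intro image_eqI[of _ _ "\<Phi> a y"]) auto
      qed
    qed
    show "\<theta> \<zero>\<^bsub>principal_units absv\<^esub> = \<zero>\<^bsub>P \<oplus>\<^sub>f fm_quotient M N\<^esub>"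
      unfolding U1 fm_sum_quotient_sel \<Phi>_zero[symmetric] \<theta>[OF P.M.zero_closed M.M.zero_closed]
      using M.coset_eq_self_iff[OF N M.M.zero_closed] by simp
  next
    fix x x' assume "x \<in> carrier (principal_units absv)" "x' \<in> carrier (principal_units absv)"
    then obtain a y a' y' where x: "a \<in> carrier P" "y \<in> carrier M" "x = \<Phi> a y"
      and x': "a' \<in> carrier P" "y' \<in> carrier M" "x' = \<Phi> a' y'" using obt unfolding U1 by metis
    show "\<theta> (x \<oplus>\<^bsub>principal_units absv\<^esub> x') = \<theta> x \<oplus>\<^bsub>P \<oplus>\<^sub>f fm_quotient M N\<^esub> \<theta> x'"
      unfolding U1 x(3) x'(3) \<theta>[OF x(1,2)] \<theta>[OF x'(1,2)] \<Phi>_add[OF x(1,2) x'(1,2), symmetric]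
        \<theta>[OF P.M.a_closed[OF x(1) x'(1)] M.M.a_closed[OF x(2) x'(2)]] fm_sum_quotient_sel
        N.a_rcos_sum[OF x(2) x'(2)] ..
  next
    fix c x assume c: "c \<in> carrier (Zp p)" and "x \<in> carrier (principal_units absv)"
    then obtain a y where x: "a \<in> carrier P" "y \<in> carrier M" "x = \<Phi> a y" using obt unfolding U1 by metis
    show "\<theta> (c \<odot>\<^bsub>principal_units absv\<^esub> x) = c \<odot>\<^bsub>P \<oplus>\<^sub>f fm_quotient M N\<^esub> \<theta> x"
      unfolding U1 x(3) \<theta>[OF x(1,2)] \<Phi>_smult[OF x(1,2) c, symmetric]
        \<theta>[OF P.smult_closed[OF c x(1)] M.smult_closed[OF c x(2)]] fm_sum_quotient_sel
        M.quotient_smult[OF N c x(2)] ..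
  next
    fix n :: nat assume n: "1 \<le> n"
    show "filt (P \<oplus>\<^sub>f fm_quotient M N) n = \<theta> ` filt (principal_units absv) n"
      unfolding U1 fm_sum_quotient_sel M.quotient_filt[OF N filt_carrier(2)]
    proof (intro equalityI subsetI)
      fix t assume "t \<in> filt P n \<times> (+>\<^bsub>M\<^esub>) N ` filt M n"
      then obtain a y where ay: "a \<in> filt P n" "y \<in> filt M n" "t = (a, N +>\<^bsub>M\<^esub> y)" by auto
      have "a \<in> carrier P" "y \<in> carrier M" using ay(1,2) filt_carrier by auto
      then have "t = \<theta> (\<Phi> a y)" using \<theta> ay(3) by simp
      then show "t \<in> \<theta> ` U n" using \<Phi>_U[OF ay(1,2) n] by blast
    next
      fix t assume "t \<in> \<theta> ` U n"
      then obtain x where x: "x \<in> U n" "t = \<theta> x" by blast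
      \<comment> \<open>A preimage of weight \<open>n\<close> is needed here, not just any preimage;
        the weight control in \<open>comb_surj\<close> provides it.\<close>
      obtain a y where ay: "a \<in> filt P n" "y \<in> filt M n" "a \<in> carrier P" "y \<in> carrier M" "\<Phi> a y = x"
        using \<Phi>_surj[OF x(1) n] by blast
      have "t = (a, N +>\<^bsub>M\<^esub> y)" unfolding x(2) ay(5)[symmetric] by (rule \<theta>[OF ay(3,4)])
      then show "t \<in> filt P n \<times> (+>\<^bsub>M\<^esub>) N ` filt M n" using ay(1,2) by simp
    qed
  qed
qed

end

theorem theorem1p5:
  fixes absv :: "'a::field \<Rightarrow> real" and p f e :: nat and \<rho> :: "nat \<Rightarrow> nat"
  assumes "local_field absv"
    and "p = residue_characteristic absv"
    and "{\<alpha>::'a. \<alpha> ^ p = 1} \<noteq> {1}"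
    and "card (carrier (residue_field absv)) = p ^ f"
    and "int e = normalized_valuation absv (of_nat p)"
    and "\<rho> = field_shift e p"
  shows "\<exists>!J \<in> ext_jump_sets \<rho>.
           fm_iso (Zp p) (principal_units absv)
             (fm_power (M_mod p \<rho>) (f - 1) \<oplus>\<^sub>f
              fm_quotient (M_star_mod p \<rho>)
                (cyclic_span (Zp p) (M_star_mod p \<rho>) (jump_vector p \<rho> J)))"
proof -
  interpret local_field absv by fact
  have p_prime: "Factorial_Ring.prime p" and p_small: "absv (of_nat p) < 1"
    using residue_characteristic_props assms(2) by auto
  obtain \<pi> where \<pi>: "\<pi> \<noteq> 0" "absv \<pi> < 1" "\<forall>x. absv x < 1 \<longrightarrow> absv x \<le> absv \<pi>"
    using exists_uniformizer by blast
  have r: "0 < absv \<pi>" using absv_pos[OF \<pi>(1)] .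
  have p_gt: "p > 1" using p_prime prime_gt_1_nat by blast
  obtain \<zeta> where \<zeta>: "\<zeta> ^ p = 1" "\<zeta> \<noteq> (1::'a)" using assms(3) by force
  \<comment> \<open>In characteristic \<open>p\<close> the expansion would give (\<zeta> - 1)^p =
    \<zeta>^p - 1 = 0, so the nontrivial root of unity forces characteristic zero.\<close>
  have p0: "(of_nat p :: 'a) \<noteq> 0"
  proof
    assume "(of_nat p :: 'a) = 0"
    have "absv \<zeta> ^ p = 1" using \<zeta>(1) absv_power[of \<zeta> p] by simp
    then have "absv \<zeta> = 1" using absv_nonneg p_gt by (metis power_eq_1_iff abs_of_nonneg real_norm_def not_one_less_zero)
    then have "absv (\<zeta> - 1) \<le> 1" by (intro absv_diff_le) auto
    then obtain h where "(1 + (\<zeta> - 1)) ^ p = 1 + of_nat p * (\<zeta> - 1) * (1 + (\<zeta> - 1) * h) + (\<zeta> - 1) ^ p"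
      using power_prime_expansion[OF p_prime, of "\<zeta> - 1"] by blast
    then show False using \<zeta> \<open>of_nat p = 0\<close> by simp
  qed
  obtain n where n: "absv (of_nat p) = absv \<pi> powi n" using absv_eq_powi[OF \<pi>(2,3,1) p0] by blast
  have ne: "n = int e" using normalized_valuation_absv[OF \<pi>(2,3,1) n] assms(5) by simp
  then have pe: "absv (of_nat p) = absv \<pi> ^ e" using n by simp
  have e1: "e \<ge> 1" using pe p_small by (cases e) auto
  interpret unit_filtration absv \<pi> p e f \<zeta>
  proof
    fix s :: "nat \<Rightarrow> 'a" assume "\<And>n. absv (s n) \<le> 1" "\<And>n. absv (s (Suc n) - s n) \<le> absv \<pi> ^ n"
    then show "\<exists>L. \<forall>n. absv (L - s n) \<le> absv \<pi> ^ n"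
      using integers_complete[of "absv \<pi>" s] r \<pi>(2) by simp
  qed (use \<pi> absv_eq_powi[OF \<pi>(2,3,1)] p_prime e1 pe assms(4) \<zeta> in \<open>auto simp: residue_field_sel\<close>)
  have shift: "shift \<rho>" unfolding assms(6) by (rule rho_shift)
  obtain u I \<beta> where u: "basis u" "(I, \<beta>) \<in> ext_jump_sets (field_shift e p)" "comb_nat u (jump_exp (I, \<beta>)) = \<zeta>"
    using jump_basis_exists by blast
  show ?thesis
  proof (rule ex1I[of _ "(I, \<beta>)"])
    show "(I, \<beta>) \<in> ext_jump_sets \<rho> \<and> fm_iso (Zp p) (principal_units absv) (jump_target p \<rho> (f - 1) (I, \<beta>))"
      using principal_units_iso[OF u] u(2) unfolding assms(6) by blast
    fix J' assume J': "J' \<in> ext_jump_sets \<rho> \<and> fm_iso (Zp p) (principal_units absv) (jump_target p \<rho> (f - 1) J')"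
    have "fm_iso (Zp p) (principal_units absv) (jump_target p \<rho> (f - 1) (I, \<beta>))"
      using principal_units_iso[OF u] unfolding assms(6) .
    then have "fm_iso (Zp p) (jump_target p \<rho> (f - 1) J') (jump_target p \<rho> (f - 1) (I, \<beta>))"
      using fm_iso_trans[OF fm_iso_sym] J' by blast
    then show "J' = (I, \<beta>)"
      using jump_set_determined[OF p_gt shift] J' u(2) unfolding assms(6) by blast
  qed
qed

end
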